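(* Let $D$ be a period domain with automorphism group $G_{\mathbb R}$, and let $(F^\bullet,N)$ be an $\mathbb R$-split nilpotent orbit on $D$ with Deligne bigrading $\mathfrak g_{\mathbb C}=\bigoplus\mathfrak g^{p,q}$. Let $M^0_{\mathbb R}\subset G_{\mathbb R}$ be the connected Lie subgroup with Lie algebra $\mathfrak g^{0,0}_{\mathbb R}$ and $\mathcal N^0=\mathrm{Ad}(M^0_{\mathbb R})\cdot N$. If a nilpotent cone $\sigma=\{\sum_it^iN_i\mid t^i>0\}$ containing $N$ underlies a nilpotent orbit $(F^\bullet;N_1,\dots,N_m)$ on $D$, then $$\sigma\subset\mathcal N^0=\mathrm{Ad}(M^0_{\mathbb R})\cdot N\subset\mathfrak g^{-1,-1}\qquad\text{and}\qquad N_i\in\overline{\mathcal N^0}\ \text{ for all } i.$$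
   Context: $V_{\mathbb R}$ is a finite dimensional real vector space with a rational structure, $w\in\mathbb Z$, and $Q$ is a nondegenerate $(-1)^w$-symmetric bilinear form on $V_{\mathbb R}$ defined over $\mathbb Q$. $D$ is the period domain of weight $w$, $Q$-polarized Hodge structures on $V$ with fixed Hodge numbers, $\check D$ is its compact dual, $G_{\mathbb R}=\mathrm{Aut}(V_{\mathbb R},Q)$, with Lie algebra $\mathfrak g_{\mathbb R}$ and complexification $\mathfrak g_{\mathbb C}$. An ($m$-variable) nilpotent orbit $(F^\bullet;N_1,\dots,N_m)$ on $D$ consists of $F^\bullet\in\check D$ and commuting nilpotent $N_i\in\mathfrak g_{\mathbb R}$ with $N_iF^p\subset F^{p-1}$ such that $\exp(\sum_iz^iN_i)F^\bullet\in D$ whenever all $\mathrm{Im}\,z^i\gg0$. Its associated nilpotent cone is $\sigma=\{\sum_it^iN_i\mid t^i>0\}$, and one says that $\sigma$ underlies the nilpotent orbit. $W(N)$ is the monodromy weight filtration of $N$ on $V$; with the shift by $w$, $(F^\bullet,W(N))$ is a polarized mixed Hodge structure, and $(F^\bullet,N)$ is $\mathbb R$-split if this mixed Hodge structure is split over $\mathbb R$. $V_{\mathbb C}=\bigoplus V^{p,q}$ is its Deligne bigrading, $\mathfrak g^{p,q}=\{X\in\mathfrak g_{\mathbb C}\mid X(V^{r,s})\subset V^{r+p,s+q}\ \forall r,s\}$, and $\mathfrak g^{p,p}_{\mathbb R}=\mathfrak g_{\mathbb R}\cap\mathfrak g^{p,p}$. $\overline{\mathcal N^0}$ is the topological closure.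 *)

theory Defs
  imports "HOL-Analysis.Analysis"
begin

text \<open>
  The real vector space \<open>V\<^sub>\<real>\<close> is \<open>real ^ 'n\<close>, and its complexification \<open>V\<^sub>\<complex>\<close> is \<open>complex ^ 'n\<close> with
  the componentwise conjugation. Endomorphisms are matrices acting by \<open>*v\<close>. The constants
  \<open>vec.subspace\<close>, \<open>vec.span\<close>, \<open>vec.dim\<close> on \<open>complex ^ 'n\<close> refer to the complex scalars, and
  \<open>A + B\<close> for sets is the elementwise sum.
\<close>

subsection \<open>Complexification and rational structure\<close>

definition re_vec :: "complex ^ 'n \<Rightarrow> real ^ 'n" where
  "re_vec v = (\<chi> i. Re (v $ i))"

definition im_vec :: "complex ^ 'n \<Rightarrow> real ^ 'n" where
  "im_vec v = (\<chi> i. Im (v $ i))"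

definition cnj_vec :: "complex ^ 'n \<Rightarrow> complex ^ 'n" where
  "cnj_vec v = (\<chi> i. cnj (v $ i))"

definition complexify_space :: "(real ^ 'n) set \<Rightarrow> (complex ^ 'n) set" where
  "complexify_space U = {v. re_vec v \<in> U \<and> im_vec v \<in> U}"

definition complexify_form ::
    "(real ^ 'n \<Rightarrow> real ^ 'n \<Rightarrow> real) \<Rightarrow> complex ^ 'n \<Rightarrow> complex ^ 'n \<Rightarrow> complex" where
  "complexify_form Q u v =
     Complex (Q (re_vec u) (re_vec v) - Q (im_vec u) (im_vec v))
             (Q (re_vec u) (im_vec v) + Q (im_vec u) (re_vec v))"

definition complexify_mat :: "real ^ 'n ^ 'n \<Rightarrow> complex ^ 'n ^ 'n" where
  "complexify_mat A = map_matrix complex_of_real A"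

definition rational_structure :: "(real ^ 'n) set \<Rightarrow> bool" where
  "rational_structure VQ \<longleftrightarrow>
     (\<exists>B. independent B \<and> span B = UNIV \<and>
          VQ = {(\<Sum>b\<in>B. r b *\<^sub>R b) | r. \<forall>b\<in>B. r b \<in> \<rat>})"

definition polarization_form ::
    "(real ^ 'n) set \<Rightarrow> int \<Rightarrow> (real ^ 'n \<Rightarrow> real ^ 'n \<Rightarrow> real) \<Rightarrow> bool" where
  "polarization_form VQ w Q \<longleftrightarrow>
     bilinear Q \<and>
     (\<forall>u v. Q u v = (-1) powi w * Q v u) \<and>
     (\<forall>u. (\<forall>v. Q u v = 0) \<longrightarrow> u = 0) \<and>
     (\<forall>u\<in>VQ. \<forall>v\<in>VQ. Q u v \<in> \<rat>)"

subsection \<open>Matrix groups and their Lie algebras\<close>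

text \<open>The class operations \<open>*\<close> and \<open>^\<close> on \<open>vec\<close> are componentwise, hence the separate power and
  exponential for the matrix product \<open>**\<close>.\<close>

primrec mat_power :: "'a::semiring_1 ^ 'n ^ 'n \<Rightarrow> nat \<Rightarrow> 'a ^ 'n ^ 'n" where
  "mat_power A 0 = mat 1"
| "mat_power A (Suc k) = A ** mat_power A k"

definition mat_exp :: "'a::real_normed_field ^ 'n ^ 'n \<Rightarrow> 'a ^ 'n ^ 'n" where
  "mat_exp A = (\<Sum>k. (1 / fact k) *\<^sub>R mat_power A k)"

definition nilpotent_mat :: "real ^ 'n ^ 'n \<Rightarrow> bool" where
  "nilpotent_mat A \<longleftrightarrow> (\<exists>k. mat_power A k = 0)"

definition Aut_form :: "(real ^ 'n \<Rightarrow> real ^ 'n \<Rightarrow> real) \<Rightarrow> (real ^ 'n ^ 'n) set" where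
  "Aut_form Q = {g. invertible g \<and> (\<forall>u v. Q (g *v u) (g *v v) = Q u v)}"

definition lie_algebra :: "(real ^ 'n ^ 'n) set \<Rightarrow> (real ^ 'n ^ 'n) set" where
  "lie_algebra H = {X. \<forall>t. mat_exp (t *\<^sub>R X) \<in> H}"

text \<open>Connected Lie subgroups of a matrix Lie group, in the sense of Hall, \<open>Lie Groups, Lie Algebras,
  and Representations\<close>, Chapter 5: these need not be closed in \<open>G\<close>.\<close>

definition connected_Lie_subgroup :: "(real ^ 'n ^ 'n) set \<Rightarrow> (real ^ 'n ^ 'n) set \<Rightarrow> bool" where
  "connected_Lie_subgroup G H \<longleftrightarrow>
     H \<subseteq> G \<and> mat 1 \<in> H \<and> (\<forall>g\<in>H. \<forall>h\<in>H. g ** h \<in> H) \<and> (\<forall>g\<in>H. matrix_inv g \<in> H) \<and>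
     subspace (lie_algebra H) \<and>
     (\<forall>X\<in>lie_algebra H. \<forall>Y\<in>lie_algebra H. X ** Y - Y ** X \<in> lie_algebra H) \<and>
     (\<forall>g\<in>H. \<exists>Xs. set Xs \<subseteq> lie_algebra H \<and> g = foldr (\<lambda>X a. mat_exp X ** a) Xs (mat 1))"

definition Ad_orbit :: "(real ^ 'n ^ 'n) set \<Rightarrow> real ^ 'n ^ 'n \<Rightarrow> (real ^ 'n ^ 'n) set" where
  "Ad_orbit M N = (\<lambda>g. g ** N ** matrix_inv g) ` M"

definition g_real :: "(real ^ 'n \<Rightarrow> real ^ 'n \<Rightarrow> real) \<Rightarrow> (real ^ 'n ^ 'n) set" where
  "g_real Q = lie_algebra (Aut_form Q)"

definition g_complex :: "(real ^ 'n \<Rightarrow> real ^ 'n \<Rightarrow> real) \<Rightarrow> (complex ^ 'n ^ 'n) set" where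
  "g_complex Q = {X. map_matrix Re X \<in> g_real Q \<and> map_matrix Im X \<in> g_real Q}"

subsection \<open>Period domains\<close>

definition decreasing_filtration :: "(int \<Rightarrow> (complex ^ 'n) set) \<Rightarrow> bool" where
  "decreasing_filtration F \<longleftrightarrow>
     (\<forall>p. vec.subspace (F p)) \<and> (\<forall>p. F (p + 1) \<subseteq> F p) \<and>
     (\<exists>p. F p = UNIV) \<and> (\<exists>p. F p = {0})"

definition hodge_structure :: "int \<Rightarrow> (int \<Rightarrow> (complex ^ 'n) set) \<Rightarrow> bool" where
  "hodge_structure w F \<longleftrightarrow>
     decreasing_filtration F \<and>
     (\<forall>p. F p + cnj_vec ` F (w - p + 1) = UNIV \<and> F p \<inter> cnj_vec ` F (w - p + 1) = {0})"

definition hodge_component ::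
    "(int \<Rightarrow> (complex ^ 'n) set) \<Rightarrow> int \<Rightarrow> int \<Rightarrow> (complex ^ 'n) set" where
  "hodge_component F p q = F p \<inter> cnj_vec ` F q"

definition first_bilinear_relation ::
    "(real ^ 'n \<Rightarrow> real ^ 'n \<Rightarrow> real) \<Rightarrow> int \<Rightarrow> (int \<Rightarrow> (complex ^ 'n) set) \<Rightarrow> bool" where
  "first_bilinear_relation Q w F \<longleftrightarrow>
     (\<forall>p. \<forall>u\<in>F p. \<forall>v\<in>F (w - p + 1). complexify_form Q u v = 0)"

definition second_bilinear_relation ::
    "(real ^ 'n \<Rightarrow> real ^ 'n \<Rightarrow> real) \<Rightarrow> int \<Rightarrow> (int \<Rightarrow> (complex ^ 'n) set) \<Rightarrow> bool" where
  "second_bilinear_relation Q w F \<longleftrightarrow>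
     (\<forall>p q. p + q = w \<longrightarrow> (\<forall>v\<in>hodge_component F p q. v \<noteq> 0 \<longrightarrow>
        \<i> powi (p - q) * complexify_form Q v (cnj_vec v) \<in> \<real> \<and>
        Re (\<i> powi (p - q) * complexify_form Q v (cnj_vec v)) > 0))"

text \<open>Below, \<open>h p\<close> is the Hodge number \<open>h\<^bsup>p,w-p\<^esup>\<close>.\<close>

definition period_domain ::
    "(real ^ 'n \<Rightarrow> real ^ 'n \<Rightarrow> real) \<Rightarrow> int \<Rightarrow> (int \<Rightarrow> nat) \<Rightarrow> (int \<Rightarrow> (complex ^ 'n) set) set" where
  "period_domain Q w h =
     {F. hodge_structure w F \<and>
         (\<forall>p. vec.dim (hodge_component F p (w - p)) = h p) \<and>
         first_bilinear_relation Q w F \<and> second_bilinear_relation Q w F}"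

definition compact_dual ::
    "(real ^ 'n \<Rightarrow> real ^ 'n \<Rightarrow> real) \<Rightarrow> int \<Rightarrow> (int \<Rightarrow> nat) \<Rightarrow> (int \<Rightarrow> (complex ^ 'n) set) set" where
  "compact_dual Q w h =
     {F. decreasing_filtration F \<and>
         (\<forall>p. vec.dim (F p) = vec.dim (F (p + 1)) + h p) \<and>
         first_bilinear_relation Q w F}"

subsection \<open>Nilpotent orbits\<close>

definition nilpotent_orbit ::
    "(real ^ 'n \<Rightarrow> real ^ 'n \<Rightarrow> real) \<Rightarrow> int \<Rightarrow> (int \<Rightarrow> nat) \<Rightarrow>
     (int \<Rightarrow> (complex ^ 'n) set) \<Rightarrow> nat \<Rightarrow> (nat \<Rightarrow> real ^ 'n ^ 'n) \<Rightarrow> bool" where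
  "nilpotent_orbit Q w h F m Ns \<longleftrightarrow>
     F \<in> compact_dual Q w h \<and>
     (\<forall>i\<in>{1..m}. Ns i \<in> g_real Q \<and> nilpotent_mat (Ns i)) \<and>
     (\<forall>i\<in>{1..m}. \<forall>j\<in>{1..m}. Ns i ** Ns j = Ns j ** Ns i) \<and>
     (\<forall>i\<in>{1..m}. \<forall>p. (*v) (complexify_mat (Ns i)) ` F p \<subseteq> F (p - 1)) \<and>
     (\<exists>c::real. \<forall>z::nat \<Rightarrow> complex. (\<forall>i\<in>{1..m}. Im (z i) > c) \<longrightarrow>
        (\<lambda>p. (*v) (mat_exp (\<Sum>i=1..m. map_matrix (\<lambda>x. z i * complex_of_real x) (Ns i))) ` F p)
          \<in> period_domain Q w h)"

definition nilpotent_cone :: "nat \<Rightarrow> (nat \<Rightarrow> real ^ 'n ^ 'n) \<Rightarrow> (real ^ 'n ^ 'n) set" where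
  "nilpotent_cone m Ns = {(\<Sum>i=1..m. t i *\<^sub>R Ns i) | t. \<forall>i\<in>{1..m}. t i > 0}"

subsection \<open>Mixed Hodge structures and the Deligne bigrading\<close>

definition increasing_filtration :: "(int \<Rightarrow> (real ^ 'n) set) \<Rightarrow> bool" where
  "increasing_filtration W \<longleftrightarrow>
     (\<forall>k. subspace (W k)) \<and> (\<forall>k. W k \<subseteq> W (k + 1)) \<and>
     (\<exists>k. W k = {0}) \<and> (\<exists>k. W k = UNIV)"

text \<open>The last two conditions say that \<open>N\<^sup>k\<close> induces an injective and a surjective map from
  \<open>W\<^sub>k / W\<^sub>k\<^sub>-\<^sub>1\<close> to \<open>W\<^sub>-\<^sub>k / W\<^sub>-\<^sub>k\<^sub>-\<^sub>1\<close>.\<close>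

definition monodromy_weight_filtration :: "real ^ 'n ^ 'n \<Rightarrow> (int \<Rightarrow> (real ^ 'n) set) \<Rightarrow> bool" where
  "monodromy_weight_filtration N W \<longleftrightarrow>
     increasing_filtration W \<and>
     (\<forall>k. (*v) N ` W k \<subseteq> W (k - 2)) \<and>
     (\<forall>k::nat. \<forall>v\<in>W (int k). mat_power N k *v v \<in> W (- int k - 1) \<longrightarrow> v \<in> W (int k - 1)) \<and>
     (\<forall>k::nat. \<forall>u\<in>W (- int k). \<exists>v\<in>W (int k). u - mat_power N k *v v \<in> W (- int k - 1))"

definition shift_filtration :: "int \<Rightarrow> (int \<Rightarrow> (real ^ 'n) set) \<Rightarrow> int \<Rightarrow> (real ^ 'n) set" where
  "shift_filtration w W k = W (k - w)"

text \<open>\<open>F p \<inter> A + B\<close> is the preimage in \<open>A = W\<^sub>k\<close> of the filtration induced by \<open>F\<close> on \<open>A / B\<close> with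
  \<open>B = W\<^sub>k\<^sub>-\<^sub>1\<close>; the condition is that this filtration is a pure Hodge structure of weight \<open>k\<close>.\<close>

definition mixed_hodge_structure ::
    "(int \<Rightarrow> (real ^ 'n) set) \<Rightarrow> (int \<Rightarrow> (complex ^ 'n) set) \<Rightarrow> bool" where
  "mixed_hodge_structure W F \<longleftrightarrow>
     increasing_filtration W \<and> decreasing_filtration F \<and>
     (\<forall>k p. let A = complexify_space (W k); B = complexify_space (W (k - 1)) in
        (F p \<inter> A + B) + (cnj_vec ` F (k - p + 1) \<inter> A + B) = A \<and>
        (F p \<inter> A + B) \<inter> (cnj_vec ` F (k - p + 1) \<inter> A + B) = B)"

definition deligne ::
    "(int \<Rightarrow> (real ^ 'n) set) \<Rightarrow> (int \<Rightarrow> (complex ^ 'n) set) \<Rightarrow> int \<Rightarrow> int \<Rightarrow> (complex ^ 'n) set" where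
  "deligne W F p q =
     F p \<inter> complexify_space (W (p + q)) \<inter>
     (cnj_vec ` F q \<inter> complexify_space (W (p + q)) +
      vec.span (\<Union>j\<in>{1..}. cnj_vec ` F (q - j) \<inter> complexify_space (W (p + q - j - 1))))"

definition R_split_MHS :: "(int \<Rightarrow> (real ^ 'n) set) \<Rightarrow> (int \<Rightarrow> (complex ^ 'n) set) \<Rightarrow> bool" where
  "R_split_MHS W F \<longleftrightarrow>
     mixed_hodge_structure W F \<and> (\<forall>p q. cnj_vec ` deligne W F p q = deligne W F q p)"

definition g_bigraded ::
    "(real ^ 'n \<Rightarrow> real ^ 'n \<Rightarrow> real) \<Rightarrow> (int \<Rightarrow> (real ^ 'n) set) \<Rightarrow> (int \<Rightarrow> (complex ^ 'n) set) \<Rightarrow>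
     int \<Rightarrow> int \<Rightarrow> (complex ^ 'n ^ 'n) set" where
  "g_bigraded Q W F p q =
     {X \<in> g_complex Q. \<forall>r s. (*v) X ` deligne W F r s \<subseteq> deligne W F (r + p) (s + q)}"

definition g_bigraded_real ::
    "(real ^ 'n \<Rightarrow> real ^ 'n \<Rightarrow> real) \<Rightarrow> (int \<Rightarrow> (real ^ 'n) set) \<Rightarrow> (int \<Rightarrow> (complex ^ 'n) set) \<Rightarrow>
     int \<Rightarrow> (real ^ 'n ^ 'n) set" where
  "g_bigraded_real Q W F p = {X \<in> g_real Q. complexify_mat X \<in> g_bigraded Q W F p p}"

end

theory Submission
  imports Defs
begin

text \<open>
  Two facts carry the proof. Every generator \<open>N\<^sub>i\<close> of the cone has Hodge type \<open>(-1,-1)\<close>, and for every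
  element \<open>A\<close> of the cone the orbit of \<open>A\<close> under \<open>M\<close> is open in the real endomorphisms of type
  \<open>(-1,-1)\<close>. The cone is convex, so it meets only one such orbit, and \<open>N\<^sub>i\<close> is the limit of the
  elements \<open>N\<^sub>i + N/k\<close> of the cone.

  Both facts use one observation (\<open>commuting_positive_zero\<close>). Let \<open>A\<close> be of type \<open>(-1,-1)\<close> with
  \<open>exp(iyA)F\<close> in the period domain, and let \<open>X\<close> of type \<open>(a,b)\<close> commute with \<open>A\<close>. Then \<open>X\<close> shifts the
  filtration \<open>exp(iyA)F\<close> by \<open>a\<close> and its conjugate by \<open>b\<close>. If \<open>a + b > 0\<close>, then \<open>X\<close> sends every Hodge
  component into an intersection of opposed filtrations, so \<open>X = 0\<close>.

  \<^emph>\<open>The generators.\<close> Write \<open>X\<close> for one of the \<open>N\<^sub>i\<close>. It is real and lowers \<open>F\<close> by at most one step, so its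
  components have types \<open>(a,b)\<close> with \<open>a, b \<ge> -1\<close>; it commutes with \<open>N\<close>, so \<open>a + b \<le> 0\<close>. It remains to
  exclude the weights \<open>0\<close> and \<open>-1\<close> (\<open>commuting_type\<close>). Conjugation by the real one-parameter group
  that acts by \<open>\<lambda>\<^bsup>p+q-w\<^esup>\<close> on the component \<open>(p,q)\<close> of the bigrading fixes \<open>F\<close> and turns pieces of the
  nilpotent orbit into curves \<open>exp(isX\<^sub>k) exp(iN) F\<close>, defined for \<open>\<bar>s\<bar> < R\<^sub>k\<close> with \<open>R\<^sub>k \<rightarrow> \<infinity>\<close>, where
  \<open>X\<^sub>k\<close> converges to the part of \<open>X\<close> of weight \<open>0\<close> and, once this part is known to be zero, to the part
  of weight \<open>-1\<close>. Such a limit vanishes (\<open>horizontal_limit_zero\<close>).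

  The reason is the sign of the curvature of the Hodge bundles. Along a horizontal curve
  \<open>\<Phi>\<^sub>s = exp(isX)\<Phi>\<close> with \<open>X\<close> real and \<open>tr X\<^sup>2 = 0\<close>, let \<open>\<psi>(s)\<close> be half the logarithmic derivative of the
  product of the determinants of the Hodge metrics on the steps of \<open>\<Phi>\<^sub>s\<close>. Then
  \<open>\<psi>' = tr B\<^sup>2 = -\<bar>B\<bar>\<^sup>2\<close>, where \<open>B\<close> is the part of \<open>X\<close> that preserves the Hodge decomposition of \<open>\<Phi>\<^sub>s\<close>
  (\<open>trace_identity\<close>), and the Cauchy-Schwarz inequality gives \<open>\<psi>' \<le> -\<psi>\<^sup>2/\<kappa>\<close> with \<open>\<kappa>\<close> uniform
  (\<open>schwarz\<close>). A solution of this Riccati inequality on a long interval is small away from its ends, so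
  \<open>B\<close> vanishes in the limit. What remains of \<open>X\<close> is self-adjoint for the Hodge metric with
  \<open>tr X\<^sup>2 = 0\<close>, hence zero.

  \<^emph>\<open>The orbits.\<close> For \<open>A\<close> in the cone the bracket with \<open>A\<close> is injective on type \<open>(1,1)\<close> by the observation
  above. The trace form pairs type \<open>(1,1)\<close> with type \<open>(-1,-1)\<close> and type \<open>(0,0)\<close> with itself, so the
  bracket maps type \<open>(0,0)\<close> onto type \<open>(-1,-1)\<close>, and this survives the restriction to the real Lie
  algebra (\<open>bracket_surjective\<close>). The differential of the orbit map is therefore surjective, which gives
  the openness (\<open>orbit_open\<close>).
\<close>

section \<open>Square matrices as a Banach algebra\<close>

text \<open>
  The class operations on vectors are componentwise. With a type of its own, the matrix product becomes
  the ring multiplication and the operator norm makes the matrices a Banach algebra, so that \<open>exp\<close> and the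
  noncommutative power series results apply.
\<close>

typedef ('a, 'n::finite) sqmat = "UNIV :: ('a ^ 'n ^ 'n) set"
  morphisms mat_of sqm by simp

declare sqm_inverse [simplified, simp] mat_of_inverse [simp]

lemma scaleR_matrix_mult:
  fixes A B :: "'a::real_algebra_1 ^ 'n ^ 'n"
  shows "(r *\<^sub>R A) ** B = r *\<^sub>R (A ** B)" and "A ** (r *\<^sub>R B) = r *\<^sub>R (A ** B)"
  by (simp_all add: vec_eq_iff matrix_matrix_mult_def scaleR_sum_right)

lemma matrix_mult_add_rdistrib:
  fixes A B C :: "'a::semiring_1 ^ 'n ^ 'n"
  shows "(A + B) ** C = A ** C + B ** C"
  by (simp add: vec_eq_iff matrix_matrix_mult_def distrib_right sum.distrib)

lemma scaleR_matrix_vector_mult: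
  fixes A :: "'a::real_algebra_1 ^ 'n ^ 'm"
  shows "(r *\<^sub>R A) *v x = r *\<^sub>R (A *v x)" "A *v (r *\<^sub>R x) = r *\<^sub>R (A *v x)"
  by (simp_all add: vec_eq_iff matrix_vector_mult_def scaleR_sum_right)

lemma bounded_linear_matrix_vector:
  fixes A :: "'a::{real_normed_field, euclidean_space} ^ 'n ^ 'm"
  shows "bounded_linear ((*v) A)"
  by (rule linear_conv_bounded_linear[THEN iffD1], rule linearI)
     (simp_all add: matrix_vector_right_distrib scaleR_matrix_vector_mult)

instantiation sqmat :: ("{real_normed_field, euclidean_space}", finite) real_normed_algebra_1
begin
definition zero_sqmat where "0 = sqm 0"
definition one_sqmat where "1 = sqm (mat 1)"
definition plus_sqmat where "A + B = sqm (mat_of A + mat_of B)"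
definition minus_sqmat where "A - B = sqm (mat_of A - mat_of B)"
definition uminus_sqmat where "- A = sqm (- mat_of A)"
definition times_sqmat where "A * B = sqm (mat_of A ** mat_of B)"
definition scaleR_sqmat where "r *\<^sub>R A = sqm (r *\<^sub>R mat_of A)"
definition norm_sqmat where "norm A = onorm ((*v) (mat_of A))"
definition dist_sqmat where "dist A B = norm (A - B)" for A B :: "('a, 'b) sqmat"
definition sgn_sqmat where "sgn A = inverse (norm A) *\<^sub>R A" for A :: "('a, 'b) sqmat"
definition uniformity_sqmat where
  "(uniformity :: (('a, 'b) sqmat \<times> ('a, 'b) sqmat) filter) =
     (INF e\<in>{0 <..}. principal {(x, y). dist x y < e})"
definition open_sqmat where
  "open U \<longleftrightarrow> (\<forall>x\<in>U. eventually (\<lambda>(x', y). x' = x \<longrightarrow> y \<in> U) uniformity)"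
  for U :: "('a, 'b) sqmat set"

instance
proof
  fix A B C :: "('a, 'b) sqmat" and r s :: real
  show "A + B + C = A + (B + C)" "A + B = B + A" "0 + A = A" "- A + A = 0" "A - B = A + - B"
    by (simp_all add: plus_sqmat_def zero_sqmat_def minus_sqmat_def uminus_sqmat_def add_ac)
  show "A * B * C = A * (B * C)" "1 * A = A" "A * 1 = A"
    by (simp_all add: times_sqmat_def one_sqmat_def matrix_mul_assoc)
  show "(A + B) * C = A * C + B * C"
    by (simp add: plus_sqmat_def times_sqmat_def matrix_mult_add_rdistrib)
  show "A * (B + C) = A * B + A * C"
    by (simp add: plus_sqmat_def times_sqmat_def matrix_add_ldistrib)
  have "mat 1 \<noteq> (0 :: 'a ^ 'b ^ 'b)" by (auto simp: vec_eq_iff mat_def)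
  then show "(0 :: ('a, 'b) sqmat) \<noteq> 1"
    by (simp add: zero_sqmat_def one_sqmat_def sqm_inject)
  show "r *\<^sub>R (A + B) = r *\<^sub>R A + r *\<^sub>R B" "(r + s) *\<^sub>R A = r *\<^sub>R A + s *\<^sub>R A"
    "r *\<^sub>R s *\<^sub>R A = (r * s) *\<^sub>R A" "1 *\<^sub>R A = A"
    by (simp_all add: plus_sqmat_def scaleR_sqmat_def scaleR_add_right scaleR_add_left)
  show "r *\<^sub>R A * B = r *\<^sub>R (A * B)" "A * r *\<^sub>R B = r *\<^sub>R (A * B)"
    by (simp_all add: times_sqmat_def scaleR_sqmat_def scaleR_matrix_mult)
  show "dist A B = norm (A - B)" "sgn A = inverse (norm A) *\<^sub>R A"
    by (simp_all add: dist_sqmat_def sgn_sqmat_def)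
  show "norm A = 0 \<longleftrightarrow> A = 0"
  proof -
    have "norm A = 0 \<longleftrightarrow> (\<forall>x. mat_of A *v x = 0)"
      by (simp add: norm_sqmat_def onorm_eq_0[OF bounded_linear_matrix_vector])
    also have "\<dots> \<longleftrightarrow> mat_of A = 0"
      by (metis matrix_eq matrix_vector_mult_0)
    also have "\<dots> \<longleftrightarrow> A = 0"
      by (metis mat_of_inverse sqm_inverse UNIV_I zero_sqmat_def)
    finally show ?thesis .
  qed
  show "norm (A + B) \<le> norm A + norm B"
    unfolding norm_sqmat_def plus_sqmat_def
    using onorm_triangle[OF bounded_linear_matrix_vector bounded_linear_matrix_vector, of "mat_of A" "mat_of B"]
    by (simp add: matrix_vector_mult_add_rdistrib[abs_def])
  show "norm (r *\<^sub>R A) = \<bar>r\<bar> * norm A"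
    unfolding norm_sqmat_def scaleR_sqmat_def
    using onorm_scaleR[OF bounded_linear_matrix_vector, of r "mat_of A"]
    by (simp add: scaleR_matrix_vector_mult[abs_def])
  show "norm (A * B) \<le> norm A * norm B"
    unfolding norm_sqmat_def times_sqmat_def
    using onorm_compose[OF bounded_linear_matrix_vector bounded_linear_matrix_vector, of "mat_of A" "mat_of B"]
    by (simp add: o_def matrix_vector_mul_assoc)
  show "norm (1 :: ('a, 'b) sqmat) = 1"
  proof -
    have "(*v) (mat 1 :: 'a ^ 'b ^ 'b) = (\<lambda>x. x)" by (simp add: fun_eq_iff)
    then show ?thesis unfolding norm_sqmat_def one_sqmat_def
      by (simp add: onorm_id)
  qed
qed (rule uniformity_sqmat_def open_sqmat_def)+
end

lemma mat_of_simps [simp]: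
  fixes A B :: "('a::{real_normed_field, euclidean_space}, 'n::finite) sqmat"
  shows "mat_of 0 = (0 :: 'a ^ 'n ^ 'n)" "mat_of 1 = (mat 1 :: 'a ^ 'n ^ 'n)"
    "mat_of (A + B) = mat_of A + mat_of B" "mat_of (A - B) = mat_of A - mat_of B"
    "mat_of (- A) = - mat_of A" "mat_of (A * B) = mat_of A ** mat_of B"
    "mat_of (r *\<^sub>R A) = r *\<^sub>R mat_of A"
  by (simp_all add: zero_sqmat_def one_sqmat_def plus_sqmat_def minus_sqmat_def uminus_sqmat_def
      times_sqmat_def scaleR_sqmat_def)

text \<open>
  Completeness is inherited from the Euclidean norm of the entries. The two norms are compared in both
  directions: an entry is a component of the image of a standard basis vector.
\<close>

lemma norm_component_le_onorm:
  fixes A :: "('a::{real_normed_field, euclidean_space}, 'n::finite) sqmat"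
  shows "norm (mat_of A $ i $ j) \<le> norm A"
proof -
  have n1: "norm (axis j (1::'a) :: 'a ^ 'n) = 1" 
    by (simp add: norm_vec_def L2_set_def axis_def if_distrib[of norm] if_distrib[of "\<lambda>x. x ^ 2"] cong: if_cong)
  have "norm (mat_of A $ i $ j) = norm ((mat_of A *v axis j 1) $ i)"
    
    by (simp add: matrix_vector_mult_def axis_def if_distrib[of "(*) _"] cong: if_cong)
  also have "\<dots> \<le> norm (mat_of A *v axis j 1)" by (rule Finite_Cartesian_Product.norm_nth_le)
  also have "\<dots> \<le> norm A * norm (axis j (1::'a) :: 'a ^ 'n)"
    unfolding norm_sqmat_def by (rule onorm[OF bounded_linear_matrix_vector])
  finally show ?thesis by (simp add: n1)
qed

lemma bounded_linear_mat_of: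
  "bounded_linear (mat_of :: ('a::{real_normed_field, euclidean_space}, 'n::finite) sqmat \<Rightarrow> _)"
proof (rule bounded_linear_intro)
  fix A :: "('a, 'n) sqmat"
  have "norm (mat_of A) \<le> (\<Sum>i\<in>UNIV. norm (mat_of A $ i))"
    unfolding norm_vec_def by (rule L2_set_le_sum) simp
  also have "\<dots> \<le> (\<Sum>i\<in>(UNIV::'n set). \<Sum>j\<in>(UNIV::'n set). norm (mat_of A $ i $ j))"
    by (rule sum_mono) (metis L2_set_le_sum norm_vec_def norm_ge_zero)
  also have "\<dots> \<le> (\<Sum>i\<in>(UNIV::'n set). \<Sum>j\<in>(UNIV::'n set). norm A)"
    by (intro sum_mono norm_component_le_onorm)
  finally show "norm (mat_of A) \<le> norm A * (real CARD('n) * real CARD('n))" by (simp add: mult_ac)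
qed simp_all

lemma norm_matrix_vector_le:
  fixes A :: "'a::{real_normed_field, euclidean_space} ^ 'n ^ 'm"
  shows "norm (A *v x) \<le> real CARD('m) * real CARD('n) * norm A * norm x"
proof -
  have e: "norm (A $ i $ j) \<le> norm A" for i j
    
    by (rule order_trans[OF Finite_Cartesian_Product.norm_nth_le Finite_Cartesian_Product.norm_nth_le])
  have "norm (A *v x) \<le> (\<Sum>i\<in>UNIV. norm ((A *v x) $ i))"
    unfolding norm_vec_def by (rule L2_set_le_sum) simp
  also have "\<dots> \<le> (\<Sum>i\<in>(UNIV::'m set). \<Sum>j\<in>(UNIV::'n set). norm A * norm x)"
  proof (rule sum_mono)
    fix i
    have "norm ((A *v x) $ i) \<le> (\<Sum>j\<in>UNIV. norm (A $ i $ j * x $ j))"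
      by (simp add: matrix_vector_mult_def norm_sum)
    also have "\<dots> \<le> (\<Sum>j\<in>(UNIV::'n set). norm A * norm x)"
      by (intro sum_mono) (simp add: norm_mult mult_mono e Finite_Cartesian_Product.norm_nth_le)
    finally show "norm ((A *v x) $ i) \<le> (\<Sum>j\<in>(UNIV::'n set). norm A * norm x)" .
  qed
  finally show ?thesis by (simp add: mult_ac)
qed

lemma bounded_linear_sqm:
  "bounded_linear (sqm :: 'a::{real_normed_field, euclidean_space} ^ 'n::finite ^ 'n \<Rightarrow> _)"
proof (rule bounded_linear_intro)
  fix A B :: "'a ^ 'n ^ 'n" and r :: real
  show "sqm (A + B) = sqm A + sqm B" "sqm (r *\<^sub>R A) = r *\<^sub>R sqm A"
    by (simp_all add: plus_sqmat_def scaleR_sqmat_def)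
  have "norm (A *v x) \<le> (real CARD('n) * real CARD('n) * norm A) * norm x" for x
    by (rule norm_matrix_vector_le)
  then show "norm (sqm A) \<le> norm A * (real CARD('n) * real CARD('n))"
    unfolding norm_sqmat_def by (simp add: onorm_le mult_ac)
qed

instance sqmat :: ("{real_normed_field, euclidean_space}", finite) banach
proof
  fix X :: "nat \<Rightarrow> ('a, 'b) sqmat"
  assume "Cauchy X"
  then have "Cauchy (\<lambda>k. mat_of (X k))" by (rule bounded_linear.Cauchy[OF bounded_linear_mat_of])
  then obtain L where "(\<lambda>k. mat_of (X k)) \<longlonglongrightarrow> L"
    using Cauchy_convergent_iff convergent_def by blast
  then have "(\<lambda>k. sqm (mat_of (X k))) \<longlonglongrightarrow> sqm L"
    by (rule bounded_linear.tendsto[OF bounded_linear_sqm])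
  then show "convergent X" by (auto simp: convergent_def)
qed

lemma mat_of_power:
  "mat_of (A ^ k) = mat_power (mat_of A) k"
  for A :: "('a::{real_normed_field, euclidean_space}, 'n::finite) sqmat"
  by (induction k) simp_all

lemma mat_exp_eq:
  "mat_exp A = mat_of (exp (sqm A))"
  for A :: "'a::{real_normed_field, euclidean_space} ^ 'n ^ 'n"
proof -
  have "mat_of (exp (sqm A)) = (\<Sum>k. mat_of (sqm A ^ k /\<^sub>R fact k))"
    unfolding exp_def
    by (rule bounded_linear.suminf[OF bounded_linear_mat_of summable_exp_generic])
  then show ?thesis
    by (simp add: mat_exp_def mat_of_power divide_inverse_commute)
qed

definition ap :: "('a::{real_normed_field, euclidean_space}, 'n::finite) sqmat \<Rightarrow> 'a ^ 'n \<Rightarrow> 'a ^ 'n" where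
  "ap A v = mat_of A *v v"

lemma ap_simps [simp]:
  "ap (A * B) v = ap A (ap B v)"
  "ap (A + B) v = ap A v + ap B v" "ap (A - B) v = ap A v - ap B v" "ap (- A) v = - ap A v"
  "ap (r *\<^sub>R A) v = r *\<^sub>R ap A v"
  "ap A (v + u) = ap A v + ap A u" "ap A (v - u) = ap A v - ap A u" "ap A (- v) = - ap A v"
  "ap A (c *s v) = c *s ap A v" "ap A (r *\<^sub>R v) = r *\<^sub>R ap A v"
  "ap A 0 = 0" "ap 0 v = 0" "ap 1 v = v"
  unfolding ap_def
  by (simp_all add: matrix_vector_mult_add_rdistrib matrix_vector_mult_diff_rdistrib
      matrix_vector_right_distrib matrix_vector_mult_diff_distrib scaleR_matrix_vector_mult
      vector_scalar_commute matrix_vector_mul_assoc)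
     (simp_all add: vec_eq_iff matrix_vector_mult_def sum_negf)

lemma ap_sum: "ap (\<Sum>i\<in>I. A i) v = (\<Sum>i\<in>I. ap (A i) v)"
  by (induction I rule: infinite_finite_induct) simp_all

lemma sqmat_eqI: "(\<And>v. ap A v = ap B v) \<Longrightarrow> A = B"
  unfolding ap_def by (metis mat_of_inject matrix_eq)

lemma bounded_bilinear_ap:
  "bounded_bilinear (ap :: ('a::{real_normed_field, euclidean_space}, 'n::finite) sqmat \<Rightarrow> _)"
proof
  fix A :: "('a, 'n) sqmat" and v :: "'a ^ 'n"
  show "\<exists>K. \<forall>(A::('a, 'n) sqmat) v. norm (ap A v) \<le> norm A * norm v * K"
    by (rule exI[of _ 1]) (simp add: ap_def norm_sqmat_def onorm[OF bounded_linear_matrix_vector])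
qed simp_all

lemmas tendsto_ap [tendsto_intros] = bounded_bilinear.tendsto[OF bounded_bilinear_ap]

lemma exp_intertwine:
  fixes A B D :: "'a::{real_normed_algebra_1, banach}"
  assumes "D * A = B * D"
  shows "D * exp A = exp B * D"
proof -
  have p: "D * A ^ k = B ^ k * D" for k
    by (induction k) (simp_all add: assms mult.assoc[symmetric], metis assms mult.assoc)
  have "D * exp A = (\<Sum>k. D * (A ^ k /\<^sub>R fact k))"
    unfolding exp_def
    by (rule bounded_linear.suminf[OF bounded_linear_mult_right summable_exp_generic])
  also have "\<dots> = (\<Sum>k. (B ^ k /\<^sub>R fact k) * D)" by (simp add: p)
  also have "\<dots> = exp B * D"
    unfolding exp_def
    by (rule bounded_linear.suminf[OF bounded_linear_mult_left summable_exp_generic, symmetric])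
  finally show ?thesis .
qed

lemma exp_minus_left: "exp (- A) * exp A = 1" and exp_minus_right: "exp A * exp (- A) = 1"
  for A :: "'a::{real_normed_algebra_1, banach}"
  by (simp_all add: exp_add_commuting[symmetric])

lemma closed_exp_invariant:
  fixes A :: "('a::{real_normed_field, euclidean_space}, 'n::finite) sqmat"
  assumes "subspace S" "\<And>v. v \<in> S \<Longrightarrow> ap A v \<in> S" "v \<in> S"
  shows "ap (exp A) v \<in> S"
proof -
  have p: "ap (A ^ k) v \<in> S" for k
    by (induction k) (simp_all add: assms)
  have "(\<lambda>n. \<Sum>k<n. A ^ k /\<^sub>R fact k) \<longlonglongrightarrow> exp A"
    unfolding exp_def by (rule summable_LIMSEQ[OF summable_exp_generic])
  then have "(\<lambda>n. ap (\<Sum>k<n. A ^ k /\<^sub>R fact k) v) \<longlonglongrightarrow> ap (exp A) v"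
    by (intro tendsto_intros)
  moreover have "ap (\<Sum>k<n. A ^ k /\<^sub>R fact k) v \<in> S" for n
    by (auto simp: ap_sum intro!: subspace_sum[OF assms(1)] subspace_scale[OF assms(1)] p)
  ultimately show ?thesis
    by (rule closed_sequentially[OF closed_subspace[OF assms(1)], rotated])
qed

lemma norm_exp_minus_linear:
  fixes x :: "'a::{real_normed_algebra_1, banach}"
  assumes "norm x \<le> 1"
  shows "norm (exp x - 1 - x) \<le> (norm x)\<^sup>2"
proof -
  let ?f = "\<lambda>n. inverse (fact (n + 2)) *\<^sub>R (x ^ (n + 2))"
  let ?g = "\<lambda>n. inverse (fact (n + 2)) *\<^sub>R (norm x ^ (n + 2))"
  have sg: "summable ?g"
    using summable_exp_generic[of "norm x"] by (subst summable_iff_shift)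
  have nf: "norm (?f n) \<le> ?g n" for n
    by (simp add: mult_left_mono norm_power_ineq[of x "Suc (Suc n)", simplified])
  have sf: "summable (\<lambda>n. norm (?f n))"
    by (rule summable_comparison_test'[OF sg, of 0]) (use nf in auto)
  have "norm (exp x - 1 - x) = norm (suminf ?f)"
    by (subst exp_first_two_terms) simp
  also have "\<dots> \<le> (\<Sum>n. norm (?f n))" by (rule summable_norm[OF sf])
  also have "\<dots> \<le> suminf ?g" by (rule suminf_le[OF nf sf sg])
  also have "\<dots> = exp (norm x) - 1 - norm x"
    by (subst exp_first_two_terms) simp
  also have "\<dots> \<le> (norm x)\<^sup>2"
    using exp_bound[of "norm x"] assms by simp
  finally show ?thesis .
qed

text \<open>
  The remainder of the exponential series after the linear term is at most \<open>\<parallel>x\<parallel>\<^sup>2\<close> for small \<open>x\<close>.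
\<close>

lemma exp_has_derivative_at_0:
  fixes f :: "'b::real_normed_vector \<Rightarrow> 'a::{real_normed_algebra_1, banach}"
  assumes f: "bounded_linear f"
  shows "((\<lambda>x. exp (f x)) has_derivative f) (at 0)"
proof -
  obtain K where K: "K > 0" "\<And>x. norm (f x) \<le> norm x * K"
    using bounded_linear.pos_bounded[OF f] by blast
  have lim: "((\<lambda>x::'b. norm x * K\<^sup>2) \<longlongrightarrow> 0) (at 0)"
    by (rule tendsto_eq_intros refl)+ simp
  have "((\<lambda>x. norm (exp (f x) - exp (f 0) - f (x - 0)) / norm (x - 0)) \<longlongrightarrow> 0) (at 0)"
  proof (rule tendsto_sandwich[OF _ _ tendsto_const lim])
    have "eventually (\<lambda>x::'b. norm x < 1 / K) (at 0)"
      unfolding eventually_at using K(1) by (intro exI[of _ "1 / K"]) (auto simp: dist_norm)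
    moreover have "eventually (\<lambda>x::'b. x \<noteq> 0) (at 0)"
      by (rule eventually_neq_at_within)
    ultimately show "eventually (\<lambda>x. norm (exp (f x) - exp (f 0) - f (x - 0)) / norm (x - 0) \<le> norm x * K\<^sup>2) (at 0)"
    proof eventually_elim
      case (elim x)
      have "norm (f x) \<le> norm x * K" by (rule K)
      also have "\<dots> \<le> 1" using elim(1) K(1) by (simp add: field_simps)
      finally have "norm (exp (f x) - 1 - f x) \<le> (norm (f x))\<^sup>2"
        by (rule norm_exp_minus_linear)
      also have "\<dots> \<le> (norm x * K)\<^sup>2" by (intro power_mono K) simp
      finally show ?case using elim(2)
        by (simp add: bounded_linear.linear[OF f] linear_0 divide_le_eq power2_eq_square mult_ac)
    qed
  qed auto
  then show ?thesis
    using f by (simp add: has_derivative_at)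
qed

lemma continuous_exp_banach_algebra:
  "continuous_on UNIV (exp :: 'a::{real_normed_algebra_1, banach} \<Rightarrow> 'a)"
proof -
  have "continuous_on (ball 0 r) (exp :: 'a \<Rightarrow> 'a)" for r
  proof (rule uniform_limit_theorem)
    show "\<forall>\<^sub>F n in sequentially. continuous_on (ball 0 r) (\<lambda>x::'a. \<Sum>k<n. x ^ k /\<^sub>R fact k)"
      by (intro always_eventually allI continuous_intros)
    show "uniform_limit (ball 0 r) (\<lambda>n x::'a. \<Sum>k<n. x ^ k /\<^sub>R fact k) exp sequentially"
      unfolding exp_def
    proof (rule Weierstrass_m_test[OF _ summable_exp_generic[of r]])
      fix n and x :: 'a
      assume "x \<in> ball 0 r"
      then have "norm x ^ n \<le> r ^ n" by (intro power_mono) auto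
      then have "norm (x ^ n) \<le> r ^ n" using norm_power_ineq[of x n] by linarith
      then show "norm (x ^ n /\<^sub>R fact n) \<le> r ^ n /\<^sub>R fact n"
        by (simp add: mult_left_mono)
    qed
  qed simp
  then have "isCont (exp :: 'a \<Rightarrow> 'a) x" for x
    using continuous_on_eq_continuous_at[OF open_ball] by (metis mem_ball_0 less_add_one)
  then show ?thesis by (simp add: continuous_at_imp_continuous_on)
qed

section \<open>Complex matrices: conjugation, scalars, trace, projections\<close>

type_synonym 'n cmat = "(complex, 'n) sqmat"

lemma cnj_vec_simps [simp]:
  "cnj_vec (u + v) = cnj_vec u + cnj_vec v" "cnj_vec (u - v) = cnj_vec u - cnj_vec v"
  "cnj_vec (- u) = - cnj_vec u"
  "cnj_vec (c *s v) = cnj c *s cnj_vec v" "cnj_vec (r *\<^sub>R v) = r *\<^sub>R cnj_vec v"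
  "cnj_vec (cnj_vec v) = v" "cnj_vec 0 = 0" "cnj_vec u = cnj_vec v \<longleftrightarrow> u = v"
  "cnj_vec u = 0 \<longleftrightarrow> u = 0"
  by (auto simp: cnj_vec_def vec_eq_iff)

lemma cnj_vec_sum: "cnj_vec (\<Sum>i\<in>I. v i) = (\<Sum>i\<in>I. cnj_vec (v i))"
  by (induction I rule: infinite_finite_induct) simp_all

lemma in_cnj_image: "v \<in> cnj_vec ` S \<longleftrightarrow> cnj_vec v \<in> S"
  by (metis cnj_vec_simps(6) image_eqI image_iff)

lemma subspace_cnj: "vec.subspace S \<Longrightarrow> vec.subspace (cnj_vec ` S)"
  by (auto simp: vec.subspace_def in_cnj_image)

definition cj :: "'n::finite cmat \<Rightarrow> 'n cmat" where
  "cj A = sqm (map_matrix cnj (mat_of A))"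

lemma ap_cj: "ap (cj A) v = cnj_vec (ap A (cnj_vec v))"
  by (simp add: ap_def cj_def cnj_vec_def map_matrix_def vec_eq_iff matrix_vector_mult_def)

lemma cnj_vec_ap: "cnj_vec (ap A v) = ap (cj A) (cnj_vec v)"
  by (simp add: ap_cj)

lemma cj_simps [simp]:
  "cj (A + B) = cj A + cj B" "cj (A - B) = cj A - cj B" "cj (- A) = - cj A"
  "cj (A * B) = cj A * cj B" "cj (r *\<^sub>R A) = r *\<^sub>R cj A" "cj (cj A) = A" "cj 0 = 0" "cj 1 = 1"
  by (rule sqmat_eqI, simp add: ap_cj)+

lemma cj_sum: "cj (\<Sum>i\<in>I. A i) = (\<Sum>i\<in>I. cj (A i))"
  by (induction I rule: infinite_finite_induct) simp_all

text \<open>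
  The algebra structure is declared over the reals. Complex scalars act through these central elements.
\<close>

definition scal :: "complex \<Rightarrow> 'n::finite cmat" where
  "scal c = sqm (mat c)"

lemma ap_scal [simp]: "ap (scal c) v = c *s v"
  by (simp add: ap_def scal_def vec_eq_iff matrix_vector_mult_def mat_def
      if_distrib[of "\<lambda>x. x * _"] cong: if_cong)

lemma scal_mult: "scal c * scal d = scal (c * d)"
  by (rule sqmat_eqI) simp

lemma scal_move: "A * (scal c * B) = scal c * (A * B)"
  and scal_scal: "scal c * A * (scal d * B) = scal (c * d) * (A * B)"
  by (rule sqmat_eqI, simp)+

lemma cj_scal [simp]: "cj (scal c) = scal (cnj c)"
  by (rule sqmat_eqI) (simp add: ap_cj)

definition tr :: "'n::finite cmat \<Rightarrow> complex" where
  "tr A = trace (mat_of A)"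

lemma tr_simps [simp]:
  "tr (A + B) = tr A + tr B" "tr (A - B) = tr A - tr B" "tr (- A) = - tr A"
  "tr (r *\<^sub>R A) = r *\<^sub>R tr A" "tr 0 = 0"
  by (simp_all add: tr_def trace_def sum.distrib sum_subtractf scaleR_sum_right sum_negf)

lemma tr_1: "tr (1 :: 'n::finite cmat) = of_nat CARD('n)"
  by (simp add: tr_def trace_I)

lemma tr_commute: "tr (A * B) = tr (B * A)"
  by (simp add: tr_def) (rule trace_mul_sym)

lemma tr_sum: "tr (\<Sum>i\<in>I. A i) = (\<Sum>i\<in>I. tr (A i))"
  by (induction I rule: infinite_finite_induct) simp_all

lemma tr_scal: "tr (scal c * A) = c * tr A"
  by (simp add: tr_def scal_def trace_def matrix_matrix_mult_def mat_def sum_distrib_left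
      if_distrib[of "\<lambda>x. x * _"] cong: if_cong)

lemma bounded_linear_tr: "bounded_linear tr"
proof -
  have "bounded_linear (\<lambda>M::complex ^ 'n ^ 'n. trace M)"
    by (rule linear_conv_bounded_linear[THEN iffD1], rule linearI)
       (simp_all add: trace_def sum.distrib scaleR_sum_right)
  then show ?thesis
    unfolding tr_def[abs_def] by (rule bounded_linear_compose[OF _ bounded_linear_mat_of])
qed

lemmas tendsto_tr [tendsto_intros] = bounded_linear.tendsto[OF bounded_linear_tr]

lemma bounded_linear_cj: "bounded_linear (cj :: 'n::finite cmat \<Rightarrow> 'n cmat)"
proof -
  have "bounded_linear (\<lambda>M::complex ^ 'n ^ 'n. map_matrix cnj M)"
    by (rule linear_conv_bounded_linear[THEN iffD1], rule linearI)
       (simp_all add: map_matrix_def vec_eq_iff)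
  then have "bounded_linear (\<lambda>A::'n cmat. map_matrix cnj (mat_of A))"
    by (rule bounded_linear_compose[OF _ bounded_linear_mat_of])
  then show ?thesis
    unfolding cj_def[abs_def] by (rule bounded_linear_compose[OF bounded_linear_sqm])
qed

lemmas tendsto_cj [tendsto_intros] = bounded_linear.tendsto[OF bounded_linear_cj]

lemma cj_exp: "cj (exp A) = exp (cj A)"
proof -
  have p: "cj (A ^ k) = cj A ^ k" for k by (induction k) simp_all
  have "cj (exp A) = (\<Sum>k. cj (A ^ k /\<^sub>R fact k))"
    unfolding exp_def by (rule bounded_linear.suminf[OF bounded_linear_cj summable_exp_generic])
  then show ?thesis by (simp add: p exp_def)
qed

lemma linear_imp_ap:
  fixes f :: "complex ^ 'n::finite \<Rightarrow> complex ^ 'n"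
  assumes "\<And>u v. f (u + v) = f u + f v" "\<And>c v. f (c *s v) = c *s f v"
  shows "\<exists>A. \<forall>v. ap A v = f v"
proof -
  have "Vector_Spaces.linear (*s) (*s) f"
    by (intro Vector_Spaces.linear_iff[THEN iffD2] conjI allI vec.vector_space_axioms assms)
  then have "ap (sqm (matrix f)) v = f v" for v
    by (simp add: ap_def matrix_works)
  then show ?thesis by blast
qed

text \<open>
  Independence makes the components of a vector in a decomposition unique. Uniqueness makes them linear in
  the vector, so each component is given by a matrix.
\<close>

lemma direct_sum_projections:
  fixes S :: "'i \<Rightarrow> (complex ^ 'n::finite) set"
  assumes fin: "finite J" and sub: "\<And>i. i \<in> J \<Longrightarrow> vec.subspace (S i)"
    and cover: "\<And>v. \<exists>x. (\<forall>i\<in>J. x i \<in> S i) \<and> v = (\<Sum>i\<in>J. x i)"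
    and indep: "\<And>x. (\<And>i. i \<in> J \<Longrightarrow> x i \<in> S i) \<Longrightarrow> (\<Sum>i\<in>J. x i) = 0 \<Longrightarrow> \<forall>i\<in>J. x i = 0"
  obtains e :: "'i \<Rightarrow> 'n cmat"
  where "\<And>i v. i \<in> J \<Longrightarrow> ap (e i) v \<in> S i" "(\<Sum>i\<in>J. e i) = 1"
    "\<And>i v. i \<in> J \<Longrightarrow> v \<in> S i \<Longrightarrow> ap (e i) v = v"
    "\<And>i j v. i \<in> J \<Longrightarrow> j \<in> J \<Longrightarrow> i \<noteq> j \<Longrightarrow> v \<in> S i \<Longrightarrow> ap (e j) v = 0"
    "\<And>i. i \<notin> J \<Longrightarrow> e i = 0"
proof -
  obtain x where x: "\<And>v i. i \<in> J \<Longrightarrow> x v i \<in> S i" "\<And>v. (\<Sum>i\<in>J. x v i) = v"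
    using cover by metis
  have uniq: "y i = x v i" if y: "\<And>i. i \<in> J \<Longrightarrow> y i \<in> S i" "(\<Sum>i\<in>J. y i) = v" and i: "i \<in> J" for y v i
  proof -
    have "(\<Sum>i\<in>J. y i - x v i) = 0" by (simp add: sum_subtractf y(2) x(2))
    then have "\<forall>i\<in>J. y i - x v i = 0"
      by (intro indep) (auto intro!: vec.subspace_diff[OF sub] y x)
    then show ?thesis using i by simp
  qed
  have "\<exists>A. \<forall>v. ap A v = x v i" if i: "i \<in> J" for i
  proof (rule linear_imp_ap)
    fix u v c
    show "x (u + v) i = x u i + x v i"
      by (rule uniq[symmetric, OF _ _ i])
         (simp_all add: vec.subspace_add[OF sub] x(1) sum.distrib x(2))
    show "x (c *s v) i = c *s x v i"
      by (rule uniq[symmetric, OF _ _ i])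
         (simp_all add: vec.subspace_scale[OF sub] x(1) vec.scale_sum_right[symmetric] x(2))
  qed
  then obtain e0 where e0: "\<And>i v. i \<in> J \<Longrightarrow> ap (e0 i) v = x v i" by metis
  have own: "x v j = (if j = i then v else 0)" if "i \<in> J" "j \<in> J" "v \<in> S i" for i j v
    by (rule uniq[symmetric, OF _ _ that(2), of "\<lambda>j. if j = i then v else 0"])
       (use that fin in \<open>auto simp: vec.subspace_0[OF sub]\<close>)
  define e where "e i = (if i \<in> J then e0 i else 0)" for i
  show thesis
  proof (rule that[of e])
    show "(\<Sum>i\<in>J. e i) = 1"
      by (rule sqmat_eqI) (simp add: ap_sum e_def e0 x(2))
  qed (simp_all add: e_def e0 x(1) own)
qed

lemma projection_onto_subspace:
  fixes K :: "(complex ^ 'n::finite) set"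
  assumes "vec.subspace K"
  obtains P where "\<And>v. ap P v \<in> K" "\<And>v. v \<in> K \<Longrightarrow> ap P v = v"
proof -
  have "\<exists>g. g ` UNIV \<subseteq> K \<and> Vector_Spaces.linear (*s) (*s) g \<and> (\<forall>v\<in>K. g (id v) = v)"
    by (rule vec.linear_exists_left_inverse_on[OF vec.linear_id assms]) simp
  then obtain g where g: "range g \<subseteq> K" "Vector_Spaces.linear (*s) (*s) g" "\<And>v. v \<in> K \<Longrightarrow> g v = v"
    by (metis id_apply)
  have "\<exists>P. \<forall>v. ap P v = g v"
    by (rule linear_imp_ap) (use g(2)[THEN Vector_Spaces.linear_iff[THEN iffD1]] in blast)+
  then obtain P where "\<forall>v. ap P v = g v" ..
  then show thesis using g by (intro that[of P]) auto
qed

text \<open>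
  Choose projections \<open>P\<^sub>j\<close> onto the kernels of \<open>A\<^sup>j\<close>. Since \<open>A\<close> maps each kernel into the preceding one,
  \<open>A P\<^sub>j\<^sub>+\<^sub>1 = P\<^sub>j A P\<^sub>j\<^sub>+\<^sub>1\<close>, and cyclicity of the trace gives \<open>tr (A P\<^sub>j\<^sub>+\<^sub>1) = tr (A P\<^sub>j)\<close>.
\<close>

lemma tr_nilpotent:
  fixes A :: "'n::finite cmat"
  assumes "A ^ k = 0"
  shows "tr A = 0"
proof -
  define K where "K j = {v. ap (A ^ j) v = 0}" for j
  have "vec.subspace (K j)" for j by (auto simp: vec.subspace_def K_def)
  then have "\<exists>P. (\<forall>v. ap P v \<in> K j) \<and> (\<forall>v\<in>K j. ap P v = v)" for j
    by (metis projection_onto_subspace)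
  then obtain P where P: "\<And>j v. ap (P j) v \<in> K j" "\<And>j v. v \<in> K j \<Longrightarrow> ap (P j) v = v" by metis
  have K_mono: "K j \<subseteq> K (Suc j)" for j by (auto simp: K_def)
  have KA: "ap A v \<in> K j" if "v \<in> K (Suc j)" for v j
    using that by (simp add: K_def power_Suc2 del: power_Suc)
  have "tr (A * P j) = 0" for j
  proof (induction j)
    case 0
    have "P 0 = 0" using P(1)[of 0] by (intro sqmat_eqI) (auto simp: K_def)
    then show ?case by simp
  next
    case (Suc j)
    have "A * P (Suc j) = P j * (A * P (Suc j))"
      by (rule sqmat_eqI) (simp add: P KA)
    then have "tr (A * P (Suc j)) = tr (A * (P (Suc j) * P j))"
      by (metis tr_commute mult.assoc)
    also have "P (Suc j) * P j = P j"
      using P K_mono by (intro sqmat_eqI) (simp, blast)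
    finally show ?case using Suc by simp
  qed
  moreover have "P k = 1" by (rule sqmat_eqI) (simp add: P K_def assms)
  ultimately show ?thesis by (metis mult.right_neutral)
qed

section \<open>Skew operators for a definite Hermitian form\<close>

locale definite_hermitian =
  fixes H :: "complex ^ 'n::finite \<Rightarrow> complex ^ 'n \<Rightarrow> complex"
  assumes add_left: "H (u + v) x = H u x + H v x" and add_right: "H x (u + v) = H x u + H x v"
    and scale_left: "H (c *s u) x = c * H u x" and scale_right: "H x (c *s u) = cnj c * H x u"
    and definite: "u \<noteq> 0 \<Longrightarrow> H u u \<in> \<real> \<and> Re (H u u) > 0"
begin

lemma zero [simp]: "H 0 x = 0" "H x 0 = 0"
  using scale_left[of 0 0 x] scale_right[of x 0 0] by simp_all

lemma minus: "H (- u) x = - H u x" "H x (- u) = - H x u"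
  using scale_left[of "-1" u x] scale_right[of x "-1" u] by simp_all

lemma diff: "H (u - v) x = H u x - H v x" "H x (u - v) = H x u - H x v"
  using add_left[of u "-v" x] add_right[of x u "-v"] by (simp_all add: minus)

lemma sum_left: "H (\<Sum>i\<in>I. u i) x = (\<Sum>i\<in>I. H (u i) x)"
  by (induction I rule: infinite_finite_induct) (simp_all add: add_left)

lemma sum_right: "H x (\<Sum>i\<in>I. u i) = (\<Sum>i\<in>I. H x (u i))"
  by (induction I rule: infinite_finite_induct) (simp_all add: add_right)

lemma Im_diag: "Im (H u u) = 0"
  using definite[of u] by (cases "u = 0") (auto simp: complex_is_Real_iff)

text \<open>
  A sesquilinear form with real diagonal is Hermitian, by polarization.
\<close>

lemma hermitian: "H v u = cnj (H u v)"
proof -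
  have "Im (H u v + H v u) = 0"
    using Im_diag[of "u + v"] Im_diag[of u] Im_diag[of v] by (simp add: add_left add_right)
  moreover have "Im (\<i> * H v u - \<i> * H u v) = 0"
    using Im_diag[of "u + \<i> *s v"] Im_diag[of u] Im_diag[of v]
    by (simp add: add_left add_right scale_left scale_right)
  ultimately show ?thesis by (simp add: complex_eq_iff)
qed

text \<open>
  Gram-Schmidt: a family indexed by a proper subset of the coordinates cannot span, and the orthogonal
  remainder of a vector outside its span is normalized.
\<close>

lemma orthonormal_family:
  "\<exists>b. \<forall>i\<in>I. \<forall>j\<in>I. H (b i) (b j) = (if i = j then 1 else 0)" for I :: "'n set"
proof (induction I rule: finite_induct[OF finite])
  case (2 k I)
  then obtain b where b: "\<And>i j. i \<in> I \<Longrightarrow> j \<in> I \<Longrightarrow> H (b i) (b j) = (if i = j then 1 else 0)" by blast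
  have "vec.dim (b ` I) \<le> card (b ` I)" by (rule vec.dim_le_card) (simp_all add: vec.span_superset)
  also have "\<dots> \<le> card I" by (rule card_image_le) simp
  also have "\<dots> < CARD('n)" using 2 by (intro psubset_card_mono) auto
  finally have "vec.span (b ` I) \<noteq> UNIV"
    by (metis less_irrefl vec.dim_span vec.dim_UNIV vec_dim_card)
  then obtain x where x: "x \<notin> vec.span (b ` I)" by blast
  define y where "y = x - (\<Sum>i\<in>I. H x (b i) *s b i)"
  have "y \<noteq> 0"
  proof
    assume "y = 0"
    then have "x = (\<Sum>i\<in>I. H x (b i) *s b i)" by (simp add: y_def)
    also have "\<dots> \<in> vec.span (b ` I)" by (intro vec.span_sum vec.span_scale vec.span_base imageI)
    finally show False using x by simp
  qed
  then have pos: "Re (H y y) > 0" and re: "H y y = of_real (Re (H y y))"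
    using definite[of y] by (auto simp: complex_is_Real_iff complex_eq_iff)
  have orth: "H y (b j) = 0" if "j \<in> I" for j
    using that by (simp add: y_def diff sum_left scale_left b if_distrib[of "(*) _"] cong: if_cong)
  define c where "c = complex_of_real (1 / sqrt (Re (H y y)))"
  define b' where "b' i = (if i = k then c *s y else b i)" for i
  have "H (c *s y) (c *s y) = 1"
  proof -
    define r where "r = Re (H y y)"
    have "H (c *s y) (c *s y) = c * (cnj c * of_real r)"
      by (simp add: scale_left scale_right re[folded r_def])
    also have "\<dots> = of_real (1 / sqrt r * (1 / sqrt r * r))"
      by (simp only: c_def r_def[symmetric] complex_cnj_complex_of_real of_real_mult)
    also have "1 / sqrt r * (1 / sqrt r * r) = 1"
      using pos by (simp add: r_def)
    also have "complex_of_real 1 = 1" by simp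
    finally show ?thesis .
  qed
  moreover have "H (c *s y) (b j) = 0" "H (b j) (c *s y) = 0" if "j \<in> I" for j
    using orth[OF that] hermitian[of "b j" y] by (simp_all add: scale_left scale_right)
  ultimately have "\<forall>i\<in>insert k I. \<forall>j\<in>insert k I. H (b' i) (b' j) = (if i = j then 1 else 0)"
    using b 2 by (auto simp: b'_def)
  then show ?case by blast
qed simp

text \<open>
  The matrix \<open>P\<close> whose columns are an orthonormal basis has as left inverse the matrix of coordinate
  functionals, so the trace of \<open>A\<close> can be read off from \<open>P\<^sup>-\<^sup>1 A P\<close>.
\<close>

lemma tr_orthonormal:
  obtains b :: "'n \<Rightarrow> complex ^ 'n"
  where "\<And>A. tr A = (\<Sum>i\<in>UNIV. H (ap A (b i)) (b i))" "\<And>A. (\<forall>i. ap A (b i) = 0) \<Longrightarrow> A = 0"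
proof -
  obtain b :: "'n \<Rightarrow> complex ^ 'n"
    where "\<forall>i\<in>UNIV. \<forall>j\<in>UNIV. H (b i) (b j) = (if i = j then 1 else 0)"
    by (rule exE[OF orthonormal_family[of UNIV]])
  then have b: "H (b i) (b j) = (if i = j then 1 else 0)" for i j by simp
  define P where "P = sqm (\<chi> i j. b j $ i)"
  have "\<exists>R. \<forall>v. ap R v = (\<chi> i. H v (b i))"
    by (rule linear_imp_ap) (simp_all add: vec_eq_iff add_left scale_left)
  then obtain R where R: "\<And>v. ap R v = (\<chi> i. H v (b i))" by blast
  have P_axis: "ap P (axis j 1) = b j" for j
    by (simp add: ap_def P_def vec_eq_iff matrix_vector_mult_def axis_def if_distrib[of "(*) _"] cong: if_cong)
  have comp: "mat_of A $ i $ j = ap A (axis j 1) $ i" for A :: "'n cmat" and i j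
    by (simp add: ap_def matrix_vector_mult_def axis_def if_distrib[of "(*) _"] cong: if_cong)
  have "mat_of (R * P) = mat 1"
    by (simp add: vec_eq_iff comp P_axis R b mat_def del: mat_of_simps)
  then have "mat_of (P * R) = mat 1"
    by (simp add: matrix_left_right_inverse)
  then have PR: "P * R = 1" by (metis mat_of_inverse one_sqmat_def)
  show thesis
  proof (rule that[of b])
    fix A
    have "tr A = tr (P * (R * A))" by (simp add: mult.assoc[symmetric] PR)
    also have "\<dots> = tr (R * A * P)" by (rule tr_commute)
    also have "\<dots> = (\<Sum>i\<in>UNIV. H (ap A (b i)) (b i))"
      by (simp add: tr_def trace_def comp P_axis R del: mat_of_simps)
    finally show "tr A = (\<Sum>i\<in>UNIV. H (ap A (b i)) (b i))" .
  next
    fix A assume A: "\<forall>i. ap A (b i) = 0"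
    have "mat_of (A * P) = mat_of 0" by (simp only: vec_eq_iff comp ap_simps P_axis A) simp
    then have "A * P = 0" by (simp only: mat_of_inject)
    then have "A * (P * R) = 0" by (simp add: mult.assoc[symmetric])
    then show "A = 0" by (simp add: PR)
  qed
qed

text \<open>
  In an orthonormal basis \<open>tr K\<^sup>2 = - \<Sum> \<parallel>K b\<^sub>i\<parallel>\<^sup>2\<close>. All positivity arguments below reduce to this sign.
\<close>

lemma skew_square_trace:
  assumes skew: "\<And>u v. H (ap K u) v = - H u (ap K v)"
  shows "Re (tr (K * K)) \<le> 0" and "Re (tr (K * K)) = 0 \<Longrightarrow> K = 0"
proof -
  obtain b :: "'n \<Rightarrow> complex ^ 'n" where b: "\<And>A. tr A = (\<Sum>i\<in>UNIV. H (ap A (b i)) (b i))"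
    "\<And>A. (\<forall>i. ap A (b i) = 0) \<Longrightarrow> A = 0"
    using tr_orthonormal by blast
  have eq: "Re (tr (K * K)) = - (\<Sum>i\<in>UNIV. Re (H (ap K (b i)) (ap K (b i))))"
    by (simp add: b(1) skew sum_negf)
  have nonneg: "Re (H u u) \<ge> 0" for u using definite[of u] by (cases "u = 0") auto
  then show "Re (tr (K * K)) \<le> 0" by (simp add: eq sum_nonneg)
  assume "Re (tr (K * K)) = 0"
  then have "\<forall>i. Re (H (ap K (b i)) (ap K (b i))) = 0"
    using nonneg by (simp add: eq sum_nonneg_eq_0_iff)
  then have "\<forall>i. ap K (b i) = 0" using definite by (metis less_irrefl)
  then show "K = 0" by (rule b)
qed

end

section \<open>Polarized Hodge structures and their projections\<close>

lemma sum_int_telescope: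
  fixes f :: "int \<Rightarrow> 'a::ab_group_add"
  assumes "m \<le> n + 1"
  shows "(\<Sum>p\<in>{m..n}. f p - f (p + 1)) = f m - f (n + 1)"
proof -
  have "(\<Sum>p\<in>{m..m - 1 + int k}. f p - f (p + 1)) = f m - f (m + int k)" for k
  proof (induction k)
    case (Suc k)
    have "{m..m - 1 + int (Suc k)} = insert (m + int k) {m..m - 1 + int k}" by auto
    then show ?case using Suc by (simp add: add_ac)
  qed simp
  from this[of "nat (n + 1 - m)"] assms show ?thesis by simp
qed

lemma re_im_vec_simps:
  "re_vec (u + v) = re_vec u + re_vec v" "im_vec (u + v) = im_vec u + im_vec v"
  "re_vec (c *s v) = Re c *\<^sub>R re_vec v - Im c *\<^sub>R im_vec v"
  "im_vec (c *s v) = Re c *\<^sub>R im_vec v + Im c *\<^sub>R re_vec v"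
  "re_vec (cnj_vec v) = re_vec v" "im_vec (cnj_vec v) = - im_vec v"
  by (simp_all add: vec_eq_iff re_vec_def im_vec_def cnj_vec_def)

locale polform =
  fixes Q :: "real ^ 'n::finite \<Rightarrow> real ^ 'n \<Rightarrow> real" and w :: int
  assumes bil: "bilinear Q" and Q_sym: "Q u v = (-1) powi w * Q v u"
    and Q_nondeg: "(\<And>v. Q u v = 0) \<Longrightarrow> u = 0"
begin

abbreviation "QC \<equiv> complexify_form Q"

lemma Q_simps:
  "Q (u + v) x = Q u x + Q v x" "Q x (u + v) = Q x u + Q x v"
  "Q (u - v) x = Q u x - Q v x" "Q x (u - v) = Q x u - Q x v"
  "Q (r *\<^sub>R u) x = r * Q u x" "Q x (r *\<^sub>R u) = r * Q x u" "Q 0 x = 0" "Q x 0 = 0"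
  "Q (- u) x = - Q u x" "Q x (- u) = - Q x u"
  using bil by (simp_all add: bilinear_ladd bilinear_radd bilinear_lsub bilinear_rsub
      bilinear_lmul bilinear_rmul bilinear_lzero bilinear_rzero bilinear_lneg bilinear_rneg)

lemma QC_add_left: "QC (u + v) x = QC u x + QC v x"
  and QC_add_right: "QC x (u + v) = QC x u + QC x v"
  and QC_scale_left: "QC (c *s u) x = c * QC u x"
  and QC_scale_right: "QC x (c *s u) = c * QC x u"
  and QC_cnj: "QC (cnj_vec u) (cnj_vec v) = cnj (QC u v)"
  by (simp_all add: complexify_form_def re_im_vec_simps Q_simps complex_eq_iff algebra_simps)

lemma QC_sym: "QC u v = of_real ((-1) powi w) * QC v u"
proof -
  define r :: real where "r = (-1) powi w"
  have s: "Q x y = r * Q y x" for x y unfolding r_def by (rule Q_sym)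
  show ?thesis
    unfolding complexify_form_def r_def[symmetric]
    by (simp add: complex_eq_iff s[of "re_vec u"] s[of "im_vec u"] right_diff_distrib distrib_left)
qed

lemma QC_zero [simp]: "QC 0 x = 0" "QC x 0 = 0"
  using QC_scale_left[of 0 0 x] QC_scale_right[of x 0 0] by simp_all

lemma QC_minus: "QC (- u) x = - QC u x" "QC x (- u) = - QC x u"
  using QC_scale_left[of "-1" u x] QC_scale_right[of x "-1" u] by simp_all

lemma QC_diff: "QC (u - v) x = QC u x - QC v x" "QC x (u - v) = QC x u - QC x v"
  using QC_add_left[of u "-v" x] QC_add_right[of x u "-v"] by (simp_all add: QC_minus)

lemma QC_scaleR: "QC (r *\<^sub>R u) x = r * QC u x" "QC x (r *\<^sub>R u) = r * QC x u"
proof -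
  have "r *\<^sub>R u = of_real r *s u" by (simp add: vec_eq_iff scaleR_conv_of_real[of _ "_ :: complex"])
  then show "QC (r *\<^sub>R u) x = r * QC u x" "QC x (r *\<^sub>R u) = r * QC x u"
    by (simp_all add: QC_scale_left QC_scale_right)
qed

lemma QC_sum_left: "QC (\<Sum>i\<in>I. u i) x = (\<Sum>i\<in>I. QC (u i) x)"
  by (induction I rule: infinite_finite_induct) (simp_all add: QC_add_left)

lemma QC_sum_right: "QC x (\<Sum>i\<in>I. u i) = (\<Sum>i\<in>I. QC x (u i))"
  by (induction I rule: infinite_finite_induct) (simp_all add: QC_add_right)

definition skew :: "'n cmat \<Rightarrow> bool" where
  "skew X \<longleftrightarrow> (\<forall>u v. QC (ap X u) v = - QC u (ap X v))"

definition pol_hodge :: "(int \<Rightarrow> (complex ^ 'n) set) \<Rightarrow> bool" where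
  "pol_hodge \<Phi> \<longleftrightarrow> hodge_structure w \<Phi> \<and> first_bilinear_relation Q w \<Phi> \<and> second_bilinear_relation Q w \<Phi>"

text \<open>
  The projection onto \<open>\<Phi>\<^sup>p\<close> along the conjugate of \<open>\<Phi>\<^bsup>w-p+1\<^esup>\<close>.
\<close>

definition hproj :: "(int \<Rightarrow> (complex ^ 'n) set) \<Rightarrow> int \<Rightarrow> 'n cmat" where
  "hproj \<Phi> p = (SOME P. \<forall>v. ap P v \<in> \<Phi> p \<and> v - ap P v \<in> cnj_vec ` \<Phi> (w - p + 1))"

end

text \<open>
  The range \<open>{w - L..L}\<close> contains all \<open>a\<close> with \<open>h\<^bsup>a,w-a\<^esup> \<noteq> 0\<close>. It is symmetric under \<open>a \<mapsto> w - a\<close>, so sums over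
  it can be conjugated termwise.
\<close>

locale hodge_point = polform Q w for Q :: "real ^ 'n::finite \<Rightarrow> real ^ 'n \<Rightarrow> real" and w :: int +
  fixes \<Phi> :: "int \<Rightarrow> (complex ^ 'n) set" and L :: int
  assumes pol_hodge: "pol_hodge \<Phi>" and L_w: "\<bar>w\<bar> \<le> L" and L_zero: "\<And>p. p > L \<Longrightarrow> \<Phi> p = {0}"
begin

abbreviation "\<pi> \<equiv> hproj \<Phi>"

lemma subspace_F: "vec.subspace (\<Phi> p)"
  using pol_hodge by (simp add: pol_hodge_def hodge_structure_def decreasing_filtration_def)

lemma opposed: "\<Phi> p + cnj_vec ` \<Phi> (w - p + 1) = UNIV" "\<Phi> p \<inter> cnj_vec ` \<Phi> (w - p + 1) = {0}"
  using pol_hodge by (simp_all add: pol_hodge_def hodge_structure_def)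

lemma F_antimono: "p \<le> q \<Longrightarrow> \<Phi> q \<subseteq> \<Phi> p"
proof (induction q rule: int_ge_induct)
  case (step i)
  moreover have "\<Phi> (i + 1) \<subseteq> \<Phi> i"
    using pol_hodge by (simp add: pol_hodge_def hodge_structure_def decreasing_filtration_def)
  ultimately show ?case by blast
qed simp

lemma hproj_exists: "\<exists>P. \<forall>v. ap P v \<in> \<Phi> p \<and> v - ap P v \<in> cnj_vec ` \<Phi> (w - p + 1)"
proof -
  let ?S = "\<lambda>b. if b then \<Phi> p else cnj_vec ` \<Phi> (w - p + 1)"
  obtain e :: "bool \<Rightarrow> 'n cmat" where e: "\<And>b v. ap (e b) v \<in> ?S b" "(\<Sum>b\<in>UNIV. e b) = 1"
  proof (rule direct_sum_projections[of UNIV ?S])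
    show "vec.subspace (?S b)" for b by (simp add: subspace_F subspace_cnj)
    show "\<exists>x. (\<forall>b\<in>UNIV. x b \<in> ?S b) \<and> v = (\<Sum>b\<in>UNIV. x b)" for v
    proof -
      obtain a b where "a \<in> \<Phi> p" "b \<in> cnj_vec ` \<Phi> (w - p + 1)" "v = a + b"
        using opposed(1)[of p] set_plus_elim[of v "\<Phi> p"] by (metis UNIV_I)
      then show ?thesis by (intro exI[of _ "\<lambda>c. if c then a else b"]) (simp add: UNIV_bool add.commute)
    qed
    show "\<forall>b\<in>UNIV. x b = 0" if x: "\<And>b. b \<in> UNIV \<Longrightarrow> x b \<in> ?S b" and s: "(\<Sum>b\<in>UNIV. x b) = 0" for x
    proof -
      have "x True = - x False" using s by (simp add: UNIV_bool add_eq_0_iff2)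
      then have "x True \<in> cnj_vec ` \<Phi> (w - p + 1)"
        using x[of False] vec.subspace_neg[OF subspace_cnj[OF subspace_F]] by simp
      then have "x True = 0" using x[of True] opposed(2)[of p] by auto
      then show ?thesis using \<open>x True = - x False\<close> by (simp add: all_bool_eq)
    qed
  qed (auto intro: that)
  have "v - ap (e True) v = ap (e False) v" for v
    using arg_cong[OF e(2), of "\<lambda>A. ap A v"] by (simp add: UNIV_bool algebra_simps)
  then show ?thesis using e(1)[of True] e(1)[of False] by (intro exI[of _ "e True"]) simp
qed

lemma hproj_in: "ap (\<pi> p) v \<in> \<Phi> p" and hproj_co: "v - ap (\<pi> p) v \<in> cnj_vec ` \<Phi> (w - p + 1)"
  using someI_ex[OF hproj_exists[of p]] by (simp_all add: hproj_def)

lemma opposed_zero: "x \<in> \<Phi> p \<Longrightarrow> x \<in> cnj_vec ` \<Phi> (w - p + 1) \<Longrightarrow> x = 0"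
  using opposed(2)[of p] by blast

lemma hproj_id: assumes "v \<in> \<Phi> p" shows "ap (\<pi> p) v = v"
proof -
  have "v - ap (\<pi> p) v = 0"
    by (rule opposed_zero[OF vec.subspace_diff[OF subspace_F assms hproj_in] hproj_co])
  then show ?thesis by simp
qed

lemma hproj_zero: assumes "v \<in> cnj_vec ` \<Phi> (w - p + 1)" shows "ap (\<pi> p) v = 0"
proof -
  have "v - (v - ap (\<pi> p) v) \<in> cnj_vec ` \<Phi> (w - p + 1)"
    by (rule vec.subspace_diff[OF subspace_cnj[OF subspace_F] assms hproj_co])
  then show ?thesis using opposed_zero[OF hproj_in, of p v] by simp
qed

lemma hproj_unique: "a \<in> \<Phi> p \<Longrightarrow> b \<in> cnj_vec ` \<Phi> (w - p + 1) \<Longrightarrow> ap (\<pi> p) (a + b) = a"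
  by (simp add: hproj_id hproj_zero)

lemma hproj_mult1: "p \<le> q \<Longrightarrow> \<pi> p * \<pi> q = \<pi> q"
  by (rule sqmat_eqI) (use F_antimono hproj_in in \<open>simp add: hproj_id subset_iff\<close>)

lemma hproj_mult2: assumes "p \<le> q" shows "\<pi> q * \<pi> p = \<pi> q"
proof (rule sqmat_eqI)
  fix v
  have "v - ap (\<pi> p) v \<in> cnj_vec ` \<Phi> (w - q + 1)"
    using hproj_co[of v p] F_antimono[of "w - q + 1" "w - p + 1"] assms by auto
  then have "ap (\<pi> q) (v - ap (\<pi> p) v) = 0" by (rule hproj_zero)
  then show "ap (\<pi> q * \<pi> p) v = ap (\<pi> q) v" by simp
qed

lemma hproj_idem: "\<pi> p * \<pi> p = \<pi> p"
  by (rule hproj_mult1) simp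

lemma hproj_max: "\<pi> p * \<pi> q = \<pi> (max p q)"
  by (cases "p \<le> q") (simp_all add: hproj_mult1 hproj_mult2 max_def)

text \<open>
  Conjugation exchanges the two summands: the conjugate of \<open>\<pi>\<^sub>p\<close> projects onto the conjugate of \<open>\<Phi>\<^sup>p\<close> along
  \<open>\<Phi>\<^bsup>w-p+1\<^esup>\<close>.
\<close>

lemma hproj_cj: "cj (\<pi> p) = 1 - \<pi> (w - p + 1)"
proof (rule sqmat_eqI)
  fix v :: "complex ^ 'n"
  let ?x = "cnj_vec v"
  have a: "cnj_vec (?x - ap (\<pi> p) ?x) \<in> \<Phi> (w - p + 1)"
    using hproj_co[of ?x p] by (simp only: in_cnj_image)
  have b: "cnj_vec (ap (\<pi> p) ?x) \<in> cnj_vec ` \<Phi> (w - (w - p + 1) + 1)"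
    using hproj_in[of p ?x] by (simp add: in_cnj_image)
  have "ap (\<pi> (w - p + 1)) v = v - ap (cj (\<pi> p)) v"
    using hproj_unique[OF a b] by (simp add: ap_cj)
  then show "ap (cj (\<pi> p)) v = ap (1 - \<pi> (w - p + 1)) v" by simp
qed

lemma QC_F: "u \<in> \<Phi> p \<Longrightarrow> v \<in> \<Phi> (w - p + 1) \<Longrightarrow> QC u v = 0"
  using pol_hodge by (simp add: pol_hodge_def first_bilinear_relation_def)

text \<open>
  By the first bilinear relation and its conjugate, \<open>\<Phi>\<^sup>p\<close> is orthogonal to \<open>\<Phi>\<^bsup>w-p+1\<^esup>\<close> and the complement of
  \<open>\<Phi>\<^sup>p\<close> is orthogonal to the complement of \<open>\<Phi>\<^bsup>w-p+1\<^esup>\<close>.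
\<close>

lemma QC_hproj: "QC (ap (\<pi> p) u) v = QC u (ap (1 - \<pi> (w - p + 1)) v)"
proof -
  let ?q = "w - p + 1"
  have 1: "QC (ap (\<pi> p) u) (ap (\<pi> ?q) v) = 0"
    by (rule QC_F[OF hproj_in hproj_in])
  have "cnj_vec (u - ap (\<pi> p) u) \<in> \<Phi> ?q"
    using hproj_co[of u p] by (simp only: in_cnj_image)
  moreover have "cnj_vec (v - ap (\<pi> ?q) v) \<in> \<Phi> (w - ?q + 1)"
    using hproj_co[of v ?q] by (simp only: in_cnj_image)
  ultimately have "QC (cnj_vec (u - ap (\<pi> p) u)) (cnj_vec (v - ap (\<pi> ?q) v)) = 0"
    by (rule QC_F)
  then have 2: "QC (u - ap (\<pi> p) u) (v - ap (\<pi> ?q) v) = 0"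
    by (simp only: QC_cnj complex_cnj_zero_iff)
  show ?thesis using 1 2 by (simp add: QC_diff algebra_simps)
qed

lemma hproj_high: "p > L \<Longrightarrow> \<pi> p = 0"
  by (rule sqmat_eqI) (use L_zero hproj_in in \<open>metis ap_simps(12) singletonD\<close>)

lemma hproj_low: assumes "p \<le> w - L" shows "\<pi> p = 1"
proof -
  have "cj (\<pi> p) = 1" using hproj_cj[of p] hproj_high[of "w - p + 1"] assms by simp
  then show ?thesis by (metis cj_simps(6,8))
qed

text \<open>
  The projection onto the Hodge component of type \<open>(a, w - a)\<close>.
\<close>

definition "e a = \<pi> a - \<pi> (a + 1)"

lemma e_mult: "e a * e b = (if a = b then e a else 0)"
proof -
  consider "a < b" | "a = b" | "b < a" by linarith
  then show ?thesis
  proof cases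
    case 1
    then have "max a b = b" "max (a + 1) b = b" "max a (b + 1) = b + 1" "max (a + 1) (b + 1) = b + 1" by auto
    then show ?thesis using 1 by (simp add: e_def left_diff_distrib right_diff_distrib hproj_max)
  next
    case 2
    then show ?thesis by (simp add: e_def left_diff_distrib right_diff_distrib hproj_max)
  next
    case 3
    then have "max a b = a" "max (a + 1) b = a + 1" "max a (b + 1) = a" "max (a + 1) (b + 1) = a + 1" by auto
    then show ?thesis using 3 by (simp add: e_def left_diff_distrib right_diff_distrib hproj_max)
  qed
qed

lemma e_idem: "e a * e a = e a" by (simp add: e_mult)

lemma sum_e: "(\<Sum>a\<in>{w - L..L}. e a) = 1"
  using L_w by (simp add: e_def sum_int_telescope hproj_low hproj_high)

lemma e_outside: "a \<notin> {w - L..L} \<Longrightarrow> e a = 0"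
  by (auto simp: e_def not_le hproj_low hproj_high)

lemma e_cj: "cj (e a) = e (w - a)"
  by (simp add: e_def hproj_cj algebra_simps)

lemma QC_e: "QC (ap (e a) u) v = QC u (ap (e (w - a)) v)"
  by (simp add: e_def QC_diff QC_hproj algebra_simps)

lemma e_in: "ap (e a) v \<in> hodge_component \<Phi> a (w - a)"
proof -
  have "ap (e a) v \<in> \<Phi> a"
    using vec.subspace_diff[OF subspace_F hproj_in[of a v]] hproj_in[of "a + 1" v] F_antimono[of a "a + 1"]
    by (auto simp: e_def)
  moreover have "cnj_vec (ap (e a) v) \<in> \<Phi> (w - a)"
  proof -
    have "cnj_vec (ap (e a) v) = ap (e (w - a)) (cnj_vec v)" by (simp add: cnj_vec_ap e_cj)
    also have "\<dots> = ap (\<pi> (w - a)) (ap (e (w - a)) (cnj_vec v))"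
      by (simp flip: ap_simps(1) add: e_def algebra_simps hproj_max max_def)
    finally show ?thesis using hproj_in by metis
  qed
  ultimately show ?thesis by (simp add: hodge_component_def in_cnj_image)
qed

definition parity :: "int \<Rightarrow> real" where "parity a = (if even a then 1 else -1)"

definition "S = (\<Sum>a\<in>{w - L..L}. parity a *\<^sub>R e a)"

text \<open>
  The Hodge metric: on the component of type \<open>(a, w - a)\<close> the operator \<open>S\<close> is \<open>(-1)\<^sup>a\<close>, and
  \<open>i\<^bsup>a-(w-a)\<^esup> = i\<^bsup>-w\<^esup> (-1)\<^sup>a\<close>. The real factor \<open>S\<close> alone decides which operators are skew or self-adjoint.
\<close>

definition "H u v = \<i> powi (- w) * QC (ap S u) (cnj_vec v)"

lemma e_S: "e a * S = parity a *\<^sub>R e a" and S_e: "S * e a = parity a *\<^sub>R e a"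
  using e_outside[of a]
  by (simp_all add: S_def sum_distrib_left sum_distrib_right e_mult if_distrib[of "(*\<^sub>R) _"] cong: if_cong)

lemma H_e: "H (ap (e a) u) v = H u (ap (e a) v)"
proof -
  have "ap S (ap (e a) u) = ap (e a) (ap S u)" by (simp flip: ap_simps(1) add: e_S S_e)
  then show ?thesis by (simp add: H_def QC_e cnj_vec_ap e_cj)
qed

sublocale definite_hermitian H
proof
  fix u v x c
  show "H (u + v) x = H u x + H v x" "H x (u + v) = H x u + H x v"
    "H (c *s u) x = c * H u x" "H x (c *s u) = cnj c * H x u"
    by (simp_all add: H_def QC_add_left QC_add_right QC_scale_left QC_scale_right algebra_simps)
  assume "u \<noteq> 0"
  define t where "t a = \<i> powi (a - (w - a)) * QC (ap (e a) u) (cnj_vec (ap (e a) u))" for a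
  have t: "t a \<in> \<real> \<and> (ap (e a) u \<noteq> 0 \<longrightarrow> Re (t a) > 0)" for a
  proof (cases "ap (e a) u = 0")
    case False
    have "second_bilinear_relation Q w \<Phi>" using pol_hodge by (simp add: pol_hodge_def)
    then show ?thesis
      unfolding second_bilinear_relation_def t_def using e_in[of a u] False
      by (metis add_diff_cancel_left' add_diff_eq)
  qed (simp add: t_def)
  have t0: "Re (t a) \<ge> 0" for a using t[of a] by (cases "ap (e a) u = 0") (auto simp: t_def)
  have "H u u = (\<Sum>a\<in>{w - L..L}. t a)"
  proof -
    have pw: "\<i> powi (a - (w - a)) = \<i> powi (- w) * of_real (parity a)" for a
    proof -
      have "\<i> powi (a - (w - a)) = \<i> powi (- w + 2 * a)" by (rule arg_cong) simp
      also have "\<dots> = \<i> powi (- w) * \<i> powi (2 * a)" by (rule power_int_add) simp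
      also have "\<i> powi (2 * a) = (\<i> powi 2) powi a" by (rule power_int_mult)
      also have "\<i> powi 2 = -1" by simp
      also have "(-1 :: complex) powi a = of_real (parity a)" by (simp add: parity_def power_int_minus_left)
      finally show ?thesis .
    qed
    have "QC (ap (e a) u) (cnj_vec u) = QC (ap (e a) u) (cnj_vec (ap (e a) u))" for a
    proof -
      have "ap (e a) u = ap (e a) (ap (e a) u)" by (simp flip: ap_simps(1) add: e_idem)
      then have "QC (ap (e a) u) (cnj_vec u) = QC (ap (e a) (ap (e a) u)) (cnj_vec u)" by simp
      also have "\<dots> = QC (ap (e a) u) (cnj_vec (ap (e a) u))" by (simp only: QC_e cnj_vec_ap e_cj)
      finally show ?thesis .
    qed
    moreover have "t a = \<i> powi (- w) * (of_real (parity a) * QC (ap (e a) u) (cnj_vec (ap (e a) u)))" for a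
      by (simp only: t_def pw mult.assoc)
    ultimately show ?thesis
      by (simp add: H_def S_def ap_sum QC_sum_left QC_scaleR sum_distrib_left)
  qed
  moreover have "\<exists>a\<in>{w - L..L}. ap (e a) u \<noteq> 0"
  proof (rule ccontr)
    assume "\<not> ?thesis"
    then have "(\<Sum>a\<in>{w - L..L}. ap (e a) u) = 0" by (intro sum.neutral) auto
    then show False
      using \<open>u \<noteq> 0\<close> arg_cong[OF sum_e, of "\<lambda>A. ap A u"] by (simp add: ap_sum)
  qed
  ultimately show "H u u \<in> \<real> \<and> 0 < Re (H u u)"
    using t t0 by (auto intro!: sum_pos2 sum_in_Reals)
qed

end

section \<open>Traces of horizontal endomorphisms\<close>

context hodge_point
begin

text \<open>
  The components \<open>e a\<close> are self-adjoint for the Hodge metric and \<open>\<pi>\<^sub>p\<close> is a sum of some of them.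
\<close>

lemma H_hproj: "H (ap (\<pi> p) u) v = H u (ap (\<pi> p) v)"
proof -
  have p: "\<pi> p = (\<Sum>a\<in>{w - L..L}. \<pi> p * e a)"
    by (simp add: sum_distrib_left[symmetric] sum_e)
  have "\<pi> p * e a = (if p \<le> a then e a else 0)" for a
  proof (cases "p \<le> a")
    case False
    then have "max p a = p" "max p (a + 1) = p" by auto
    then show ?thesis using False by (simp add: e_def right_diff_distrib hproj_max)
  qed (simp add: e_def right_diff_distrib hproj_mult1)
  then have "H (ap (\<pi> p * e a) u) v = H u (ap (\<pi> p * e a) v)" for a
    by (simp del: ap_simps(1) add: H_e)
  then show ?thesis
    by (subst (1 2) p) (simp del: ap_simps(1) add: ap_sum sum_left sum_right)
qed

text \<open>
  A grading operator of the Hodge structure: it acts as \<open>a - w + L\<close> on the component of type \<open>(a, w - a)\<close>.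
\<close>

definition "Gr = (\<Sum>p\<in>{w - L..L}. \<pi> (p + 1))"

definition "diag X = (\<Sum>a\<in>{w - L..L}. e a * X * e a)"

lemma H_Gr: "H (ap Gr u) v = H u (ap Gr v)"
  by (simp add: Gr_def ap_sum sum_left sum_right H_hproj)

text \<open>
  The operator \<open>i(1 - \<pi>\<^sub>p)\<close> is skew and its square is \<open>-(1 - \<pi>\<^sub>p)\<close>, so \<open>tr (1 - \<pi>\<^sub>p) \<ge> 0\<close>. The bound is uniform
  over all polarized Hodge structures, as the Riccati inequality requires.
\<close>

lemma tr_hproj_le: "Re (tr (\<pi> p)) \<le> real CARD('n)"
proof -
  let ?K = "scal \<i> * (1 - \<pi> p)"
  have "H (ap ?K u) v = - H u (ap ?K v)" for u v
    by (simp add: scale_left scale_right diff H_hproj algebra_simps)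
  then have "Re (tr (?K * ?K)) \<le> 0" by (rule skew_square_trace)
  also have "?K * ?K = scal (-1) * ((1 - \<pi> p) * (1 - \<pi> p))"
    by (simp add: scal_scal)
  also have "(1 - \<pi> p) * (1 - \<pi> p) = 1 - \<pi> p"
    by (simp add: left_diff_distrib right_diff_distrib hproj_idem)
  finally show ?thesis by (simp add: tr_scal tr_1)
qed

lemma tr_Gr_le: "Re (tr (Gr * Gr)) \<le> (real_of_int (2 * L - w + 1))\<^sup>2 * real CARD('n)"
proof -
  have "tr (Gr * Gr) = (\<Sum>p\<in>{w - L..L}. \<Sum>q\<in>{w - L..L}. tr (\<pi> (max (p + 1) (q + 1))))"
    by (simp add: Gr_def sum_product tr_sum hproj_max)
  then have "Re (tr (Gr * Gr)) = (\<Sum>p\<in>{w - L..L}. \<Sum>q\<in>{w - L..L}. Re (tr (\<pi> (max (p + 1) (q + 1)))))"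
    by simp
  also have "\<dots> \<le> (\<Sum>p\<in>{w - L..L}. \<Sum>q\<in>{w - L..L}. real CARD('n))"
    by (intro sum_mono tr_hproj_le)
  also have "\<dots> = (real_of_int (2 * L - w + 1))\<^sup>2 * real CARD('n)"
    using L_w by (simp add: power2_eq_square)
  finally show ?thesis .
qed

lemma e_hproj_commute: "e a * \<pi> p = \<pi> p * e a"
  by (simp add: e_def left_diff_distrib right_diff_distrib hproj_max max.commute)

lemma tr_diag_Gr: "tr (diag X * Gr) = tr (Gr * X)"
proof -
  have eG: "e a * Gr = Gr * e a" for a
    by (simp add: Gr_def sum_distrib_left sum_distrib_right e_hproj_commute)
  have "tr (e a * X * e a * Gr) = tr (e a * (Gr * X))" for a
  proof -
    have "tr (e a * X * e a * Gr) = tr ((e a * X) * (e a * Gr))" by (simp add: mult.assoc)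
    also have "\<dots> = tr (e a * Gr * (e a * X))" by (rule tr_commute)
    also have "\<dots> = tr (e a * (e a * (Gr * X)))" by (simp add: eG mult.assoc[symmetric])
    finally show ?thesis by (simp add: mult.assoc[symmetric] e_idem)
  qed
  then have "tr (diag X * Gr) = (\<Sum>a\<in>{w - L..L}. tr (e a * (Gr * X)))"
    by (simp add: diag_def sum_distrib_right tr_sum)
  also have "\<dots> = tr (Gr * X)"
    by (simp flip: tr_sum sum_distrib_right add: sum_e)
  finally show ?thesis .
qed

end

text \<open>
  A real infinitesimal isometry that is horizontal at \<open>\<Phi>\<close>. Nilpotency enters only
  through the condition on the trace, which is closed under limits.
\<close>

locale horizontal = hodge_point Q w \<Phi> L
  for Q :: "real ^ 'n::finite \<Rightarrow> real ^ 'n \<Rightarrow> real" and w \<Phi> L +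
  fixes X :: "'n cmat"
  assumes X_real: "cj X = X" and X_skew: "skew X"
    and X_shift: "\<And>p v. v \<in> \<Phi> p \<Longrightarrow> ap X v \<in> \<Phi> (p - 1)" and tr_X2: "tr (X * X) = 0"
begin

lemma shift1: "\<pi> (p - 1) * X * \<pi> p = X * \<pi> p"
  by (rule sqmat_eqI) (simp add: hproj_id X_shift hproj_in)

lemma shift2: "\<pi> (p + 1) * X * (1 - \<pi> p) = 0"
proof -
  have "cj (\<pi> (w - p + 1 - 1) * X * \<pi> (w - p + 1)) = cj (X * \<pi> (w - p + 1))"
    by (simp only: shift1)
  then show ?thesis by (simp add: hproj_cj X_real algebra_simps)
qed

text \<open>
  Horizontality bounds the shift of \<open>X\<close> from below, and the conjugate condition bounds it from above.
\<close>

lemma off_diagonal: "a < b - 1 \<or> a > b + 1 \<Longrightarrow> e a * X * e b = 0"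
proof (elim disjE)
  assume ab: "a < b - 1"
  have "e a * \<pi> (b - 1) = 0"
  proof -
    have "max a (b - 1) = b - 1" "max (a + 1) (b - 1) = b - 1" using ab by auto
    then show ?thesis by (simp add: e_def left_diff_distrib hproj_max)
  qed
  then have "e a * (\<pi> (b - 1) * X * \<pi> b) = 0" by (simp add: mult.assoc[symmetric])
  then have "e a * X * (\<pi> b * e b) = 0" by (simp add: shift1 mult.assoc[symmetric])
  also have "\<pi> b * e b = e b" by (simp add: e_def right_diff_distrib hproj_mult1)
  finally show ?thesis .
next
  assume ab: "a > b + 1"
  have "(1 - \<pi> (b + 1)) * e b = e b"
    by (simp add: e_def left_diff_distrib right_diff_distrib hproj_max max_def)
  moreover have "e a * \<pi> (b + 2) = e a"
  proof -
    have "max a (b + 2) = a" "max (a + 1) (b + 2) = a + 1" using ab by auto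
    then show ?thesis by (simp add: e_def left_diff_distrib hproj_max)
  qed
  ultimately have "e a * X * e b = (e a * \<pi> (b + 2)) * X * ((1 - \<pi> (b + 1)) * e b)"
    by (simp only:)
  also have "\<dots> = e a * (\<pi> (b + 1 + 1) * X * (1 - \<pi> (b + 1))) * e b"
    by (simp add: mult.assoc add.commute)
  finally show ?thesis by (simp only: shift2) simp
qed

text \<open>
  With \<open>f p = tr (\<pi>\<^sub>p X \<pi>\<^sub>p X)\<close>, horizontality gives
  \<open>f p - f (p + 1) = tr (e\<^sub>p X e\<^sub>p X) + 2 tr ((1 - \<pi>\<^sub>p\<^sub>+\<^sub>1) X \<pi>\<^sub>p\<^sub>+\<^sub>1 X)\<close>, and the left-hand sides telescope to
  \<open>tr X\<^sup>2 = 0\<close>. The traces on the left of the identity are the squared norms of the second fundamental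
  forms of the Hodge bundles; the right-hand side is the squared norm of the part of \<open>X\<close> that preserves the Hodge decomposition.
\<close>

lemma trace_identity:
  "2 * (\<Sum>p\<in>{w - L..L}. tr ((1 - \<pi> (p + 1)) * X * \<pi> (p + 1) * X)) = - tr (diag X * diag X)"
proof -
  define f where "f p = tr (\<pi> p * X * (\<pi> p * X))" for p
  define d where "d p = tr ((1 - \<pi> p) * X * \<pi> p * X)" for p
  have d': "tr (e p * X * (\<pi> (p + 1) * X)) = d (p + 1)" for p
  proof -
    have "X * \<pi> (p + 1) = \<pi> p * X * \<pi> (p + 1)" using shift1[of "p + 1"] by simp
    then have "(1 - \<pi> (p + 1)) * X * \<pi> (p + 1) = (1 - \<pi> (p + 1)) * \<pi> p * X * \<pi> (p + 1)"
      by (simp add: mult.assoc)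
    also have "(1 - \<pi> (p + 1)) * \<pi> p = e p"
      by (simp add: left_diff_distrib hproj_mult2 e_def)
    finally show ?thesis by (simp add: d_def mult.assoc)
  qed
  have step: "f p - f (p + 1) = tr (e p * X * (e p * X)) + 2 * d (p + 1)" for p
  proof -
    have "\<pi> p = e p + \<pi> (p + 1)" by (simp add: e_def)
    then have "f p = tr ((e p * X + \<pi> (p + 1) * X) * (e p * X + \<pi> (p + 1) * X))"
      by (simp add: f_def distrib_right)
    also have "\<dots> = tr (e p * X * (e p * X)) + 2 * tr (e p * X * (\<pi> (p + 1) * X)) + f (p + 1)"
      using tr_commute[of "e p * X" "\<pi> (p + 1) * X"] by (simp add: f_def distrib_left distrib_right)
    finally show ?thesis by (simp add: d')
  qed
  have "f (w - L) - f (L + 1) = 0"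
    by (simp add: f_def hproj_low hproj_high tr_X2)
  also have "f (w - L) - f (L + 1) = (\<Sum>p\<in>{w - L..L}. f p - f (p + 1))"
    using L_w by (intro sum_int_telescope[symmetric]) simp
  also have "\<dots> = (\<Sum>p\<in>{w - L..L}. tr (e p * X * (e p * X))) + 2 * (\<Sum>p\<in>{w - L..L}. d (p + 1))"
    by (simp add: step sum.distrib sum_distrib_left)
  also have "(\<Sum>p\<in>{w - L..L}. tr (e p * X * (e p * X))) = tr (diag X * diag X)"
  proof -
    have "diag X * diag X = (\<Sum>a\<in>{w - L..L}. \<Sum>b\<in>{w - L..L}. (e a * X) * (e a * e b) * (X * e b))"
      by (simp add: diag_def sum_product mult.assoc)
    also have "\<dots> = (\<Sum>a\<in>{w - L..L}. (e a * X * e a) * (X * e a))"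
      by (rule sum.cong) (simp_all add: e_mult if_distrib[of "\<lambda>x. _ * x * _"] if_distrib[of "(*) _"]
          if_distrib[of "\<lambda>x. x * _"] cong: if_cong)
    finally have "tr (diag X * diag X) = (\<Sum>a\<in>{w - L..L}. tr ((e a * X * e a * X) * e a))"
      by (simp add: tr_sum mult.assoc)
    also have "\<dots> = (\<Sum>a\<in>{w - L..L}. tr (e a * X * (e a * X)))"
    proof (rule sum.cong[OF refl])
      fix a
      have "tr ((e a * X * e a * X) * e a) = tr (e a * (e a * X * e a * X))" by (rule tr_commute)
      then show "tr ((e a * X * e a * X) * e a) = tr (e a * X * (e a * X))"
        by (simp add: mult.assoc[symmetric] e_idem)
    qed
    finally show ?thesis by simp
  qed
  finally show ?thesis by (simp add: d_def[symmetric] eq_neg_iff_add_eq_0 add.commute)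
qed

lemma diag_S: "S * diag X = diag X * S"
proof -
  have "S * (e a * X * e a) = (e a * X * e a) * S" for a
  proof -
    have "S * (e a * X * e a) = (S * e a) * X * e a" by (simp add: mult.assoc)
    also have "\<dots> = e a * X * (e a * S)" by (simp add: e_S S_e)
    finally show ?thesis by (simp add: mult.assoc)
  qed
  then show ?thesis by (simp add: diag_def sum_distrib_left sum_distrib_right)
qed

lemma sum_reflect: "(\<Sum>a\<in>{w - L..L}. f (w - a)) = (\<Sum>a\<in>{w - L..L}. f a)"
  by (rule sum.reindex_bij_witness[of _ "\<lambda>a. w - a" "\<lambda>a. w - a"]) auto

lemma diag_real: "cj (diag X) = diag X"
proof -
  have "cj (diag X) = (\<Sum>a\<in>{w - L..L}. e (w - a) * X * e (w - a))"
    by (simp add: diag_def cj_sum e_cj X_real)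
  then show ?thesis by (simp only: sum_reflect[of "\<lambda>a. e a * X * e a"] diag_def)
qed

lemma diag_skew: "QC (ap (diag X) u) v = - QC u (ap (diag X) v)"
proof -
  have "QC (ap (diag X) u) v = - (\<Sum>a\<in>{w - L..L}. QC u (ap (e (w - a) * X * e (w - a)) v))"
    using X_skew by (simp add: diag_def ap_sum QC_sum_left QC_e skew_def sum_negf)
  also have "\<dots> = - QC u (ap (diag X) v)"
    by (simp only: sum_reflect[of "\<lambda>a. QC u (ap (e a * X * e a) v)"] diag_def ap_sum QC_sum_right)
  finally show ?thesis .
qed

lemma H_diag: "H (ap (diag X) u) v = - H u (ap (diag X) v)"
proof -
  have "ap S (ap (diag X) u) = ap (diag X) (ap S u)" by (simp flip: ap_simps(1) add: diag_S)
  then show ?thesis by (simp add: H_def diag_skew cnj_vec_ap diag_real)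
qed

lemma diag_trace_nonpos: "Re (tr (diag X * diag X)) \<le> 0"
  by (rule skew_square_trace[OF H_diag])

text \<open>
  Both \<open>diag X\<close> and \<open>i Gr\<close> are skew. The inequality \<open>tr K\<^sup>2 \<le> 0\<close> for \<open>K = diag X + t i Gr\<close> is the
  Cauchy-Schwarz inequality for the form \<open>- tr (K K')\<close>, and the choice \<open>t = \<psi>/\<kappa>\<close> gives the bound.
\<close>

lemma schwarz:
  assumes \<kappa>: "(real_of_int (2 * L - w + 1))\<^sup>2 * real CARD('n) \<le> \<kappa>" "\<kappa> > 0"
  shows "Re (tr (diag X * diag X)) \<le> - (Re (\<i> * tr (Gr * X)))\<^sup>2 / \<kappa>"
proof -
  define \<psi> where "\<psi> = Re (\<i> * tr (Gr * X))"
  define t where "t = \<psi> / \<kappa>"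
  define K where "K = diag X + t *\<^sub>R (scal \<i> * Gr)"
  have Hr: "H (r *\<^sub>R u) v = r * H u v" "H v (r *\<^sub>R u) = r * H v u" for r u v
    by (simp_all add: H_def QC_scaleR)
  have "H (ap K u) v = - H u (ap K v)" for u v
    by (simp add: K_def add_left add_right Hr scale_left scale_right H_diag H_Gr algebra_simps)
  then have "Re (tr (K * K)) \<le> 0" by (rule skew_square_trace)
  also have "tr (K * K) = tr (diag X * diag X) + 2 * (t * (\<i> * tr (Gr * X))) - t\<^sup>2 * tr (Gr * Gr)"
  proof -
    have i: "diag X * (scal \<i> * Gr) = scal \<i> * (diag X * Gr)"
      "(scal \<i> * Gr) * (scal \<i> * Gr) = scal (-1) * (Gr * Gr)"
      by (simp add: scal_move) (simp only: scal_scal i_squared)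
    have "tr (K * K) = tr (diag X * diag X) + 2 * (t * tr (scal \<i> * (diag X * Gr))) + t\<^sup>2 * tr (scal (-1) * (Gr * Gr))"
      using tr_commute[of "diag X" "scal \<i> * Gr"]
      by (simp add: K_def distrib_left distrib_right i power2_eq_square scaleR_conv_of_real[of _ "_ :: complex"])
    then show ?thesis by (simp add: tr_scal tr_diag_Gr)
  qed
  finally have "Re (tr (diag X * diag X)) + 2 * (t * \<psi>) - t\<^sup>2 * Re (tr (Gr * Gr)) \<le> 0"
    by (simp add: \<psi>_def flip: of_real_power)
  moreover have "t\<^sup>2 * Re (tr (Gr * Gr)) \<le> t\<^sup>2 * \<kappa>"
    using tr_Gr_le \<kappa>(1) by (intro mult_left_mono) auto
  moreover have "t\<^sup>2 * \<kappa> = \<psi>\<^sup>2 / \<kappa>" "t * \<psi> = \<psi>\<^sup>2 / \<kappa>"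
    using \<kappa>(2) by (simp_all add: t_def power2_eq_square)
  ultimately show ?thesis unfolding \<psi>_def[symmetric] by simp
qed

text \<open>
  If the diagonal part vanishes, then \<open>X\<close> exchanges even and odd components and so anticommutes with \<open>S\<close>.
  Hence \<open>X\<close> is self-adjoint, \<open>iX\<close> is skew, and \<open>tr (iX)\<^sup>2 = - tr X\<^sup>2 = 0\<close>.
\<close>

lemma diag_zero_imp_zero:
  assumes "Re (tr (diag X * diag X)) = 0"
  shows "X = 0"
proof -
  have d0: "diag X = 0" by (rule skew_square_trace(2)[OF H_diag assms])
  have diag0: "e a * X * e a = 0" for a
  proof (cases "a \<in> {w - L..L}")
    case True
    have "e a * diag X * e a = (\<Sum>b\<in>{w - L..L}. (e a * e b) * X * (e b * e a))"
      by (simp add: diag_def sum_distrib_left sum_distrib_right mult.assoc)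
    also have "\<dots> = (\<Sum>b\<in>{w - L..L}. if b = a then e a * X * e a else 0)"
      by (rule sum.cong) (auto simp: e_mult)
    also have "\<dots> = e a * X * e a" using True by simp
    finally show ?thesis by (simp add: d0)
  qed (simp add: e_outside)
  have "parity a *\<^sub>R (e a * X * e b) = - parity b *\<^sub>R (e a * X * e b)" for a b
  proof -
    consider "a < b - 1 \<or> a > b + 1" | "a = b" | "a = b + 1 \<or> b = a + 1" by linarith
    then show ?thesis by cases (auto simp: off_diagonal diag0 parity_def)
  qed
  then have ab: "e a * (S * X) * e b = e a * (- (X * S)) * e b" for a b
    by (metis (no_types, lifting) S_e e_S minus_mult_left minus_mult_right mult.assoc mult_scaleR_left
        mult_scaleR_right scaleR_minus_left)
  have ext: "A = B" if "\<And>a b. e a * A * e b = e a * B * e b" for A B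
  proof -
    have full: "(\<Sum>a\<in>{w - L..L}. \<Sum>b\<in>{w - L..L}. e a * C * e b) = C" for C
      by (simp flip: sum_distrib_left sum_distrib_right add: sum_e)
    have "A = (\<Sum>a\<in>{w - L..L}. \<Sum>b\<in>{w - L..L}. e a * A * e b)" by (simp only: full)
    also have "\<dots> = B" by (simp only: that full)
    finally show ?thesis .
  qed
  have odd: "S * X = - (X * S)" by (rule ext) (rule ab)
  let ?K = "scal \<i> * X"
  have "H (ap ?K u) v = - H u (ap ?K v)" for u v
  proof -
    have "ap S (ap X u) = - ap X (ap S u)" by (simp flip: ap_simps(1) ap_simps(4) add: odd)
    then have "H (ap X u) v = H u (ap X v)"
      using X_skew by (simp add: H_def QC_minus skew_def cnj_vec_ap X_real)
    then show ?thesis by (simp add: scale_left scale_right)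
  qed
  moreover have "Re (tr (?K * ?K)) = 0"
  proof -
    have "?K * ?K = scal (-1) * (X * X)" by (simp add: scal_scal)
    then show ?thesis by (simp add: tr_scal tr_X2)
  qed
  ultimately have "?K = 0" by (rule skew_square_trace)
  then have "scal (- \<i>) * ?K = 0" by simp
  then have "scal 1 * X = 0" by (simp only: mult.assoc[symmetric] scal_mult) simp
  moreover have "scal 1 * X = X" by (rule sqmat_eqI) simp
  ultimately show ?thesis by simp
qed

end

section \<open>Quotients in normed algebras and a Riccati inequality\<close>

text \<open>
  A factor \<open>P\<close> is controlled by its product with a factor near \<open>1\<close>: if \<open>\<parallel>J - 1\<parallel> \<le> 1/2\<close>, then
  \<open>\<parallel>P\<parallel> \<le> 2 \<parallel>P J\<parallel>\<close>. This replaces inversion in the algebra.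
\<close>

lemma tendsto_right_factor:
  fixes J P C :: "'b \<Rightarrow> 'a::real_normed_algebra_1"
  assumes J: "(J \<longlongrightarrow> 1) F" and C: "(C \<longlongrightarrow> c) F" and PJ: "\<forall>\<^sub>F s in F. P s * J s = C s"
  shows "(P \<longlongrightarrow> c) F"
proof -
  have J1: "((\<lambda>s. norm (J s - 1)) \<longlongrightarrow> 0) F"
    using tendsto_norm[OF tendsto_diff[OF J tendsto_const[of 1]]] by simp
  have half: "\<forall>\<^sub>F s in F. norm (J s - 1) < 1/2"
    using order_tendstoD(2)[OF J1, of "1/2"] by simp
  have ev: "\<forall>\<^sub>F s in F. norm (P s - C s) \<le> 2 * norm (C s) * norm (J s - 1)"
    using half PJ
  proof eventually_elim
    case (elim s)
    have "P s - C s = - (P s * (J s - 1))" using elim by (simp add: right_diff_distrib)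
    then have d: "norm (P s - C s) \<le> norm (P s) * norm (J s - 1)" by (simp add: norm_mult_ineq)
    have "norm (P s) \<le> norm (C s) + norm (P s - C s)" using norm_triangle_sub by blast
    also have "norm (P s - C s) \<le> norm (P s) * (1/2)"
      using d mult_left_mono[of "norm (J s - 1)" "1/2" "norm (P s)"] elim by simp
    finally have "norm (P s) \<le> 2 * norm (C s)" by simp
    then show ?case using d mult_right_mono[of "norm (P s)" "2 * norm (C s)" "norm (J s - 1)"] by simp
  qed
  have "((\<lambda>s. 2 * norm (C s) * norm (J s - 1)) \<longlongrightarrow> 2 * norm c * 0) F"
    by (intro tendsto_intros C J1)
  then have "((\<lambda>s. P s - C s) \<longlongrightarrow> 0) F"
    by (intro Lim_null_comparison[OF ev]) simp
  from tendsto_add[OF this C] show ?thesis by simp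
qed

lemma has_vector_derivative_0_iff:
  fixes f :: "real \<Rightarrow> 'a::real_normed_vector"
  shows "(f has_vector_derivative f') (at 0) \<longleftrightarrow> ((\<lambda>s. (f s - f 0) /\<^sub>R s) \<longlongrightarrow> f') (at 0)"
proof -
  have "(f has_vector_derivative f') (at 0) \<longleftrightarrow> (\<lambda>h. norm (f h - f 0 - h *\<^sub>R f') / norm h) \<midarrow>0\<rightarrow> 0"
    unfolding has_vector_derivative_def by (simp add: has_derivative_at bounded_linear_scaleR_left)
  also have "\<dots> \<longleftrightarrow> (\<lambda>h. norm ((f h - f 0) /\<^sub>R h - f')) \<midarrow>0\<rightarrow> 0"
  proof (rule filterlim_cong[OF refl refl])
    show "\<forall>\<^sub>F h in at 0. norm (f h - f 0 - h *\<^sub>R f') / norm h = norm ((f h - f 0) /\<^sub>R h - f')"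
      using eventually_neq_at_within[of 0]
    proof eventually_elim
      case (elim h)
      then have "(f h - f 0) /\<^sub>R h - f' = (f h - f 0 - h *\<^sub>R f') /\<^sub>R h"
        by (simp add: scaleR_diff_right)
      then have "norm ((f h - f 0) /\<^sub>R h - f') = norm ((f h - f 0 - h *\<^sub>R f') /\<^sub>R h)" by (rule arg_cong)
      then show ?case by (simp add: divide_inverse_commute)
    qed
  qed
  also have "\<dots> \<longleftrightarrow> ((\<lambda>s. (f s - f 0) /\<^sub>R s) \<longlongrightarrow> f') (at 0)"
    by (simp add: tendsto_norm_zero_iff LIM_zero_iff)
  finally show ?thesis .
qed

lemma vector_derivative_right_factor:
  fixes J P C :: "real \<Rightarrow> 'a::real_normed_algebra_1"
  assumes J: "(J has_vector_derivative J') (at 0)" "J 0 = 1"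
    and C: "(C has_vector_derivative C') (at 0)" and PJ: "\<forall>\<^sub>F s in at 0. P s * J s = C s" and P0: "P 0 = C 0"
  shows "(P has_vector_derivative C' - P 0 * J') (at 0)"
proof -
  have P: "P \<midarrow>0\<rightarrow> P 0"
    unfolding P0
  proof (rule tendsto_right_factor[OF _ _ PJ])
    show "J \<midarrow>0\<rightarrow> 1" using has_vector_derivative_continuous[OF J(1)] J(2) by (simp add: continuous_within)
    show "C \<midarrow>0\<rightarrow> C 0" using has_vector_derivative_continuous[OF C] by (simp add: continuous_within)
  qed
  have "((\<lambda>s. (C s - C 0) /\<^sub>R s - P s * ((J s - J 0) /\<^sub>R s)) \<longlongrightarrow> C' - P 0 * J') (at 0)"
    using J(1) C P unfolding has_vector_derivative_0_iff by (intro tendsto_intros)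
  then have "((\<lambda>s. (P s - P 0) /\<^sub>R s) \<longlongrightarrow> C' - P 0 * J') (at 0)"
  proof (rule Lim_transform_eventually)
    show "\<forall>\<^sub>F s in at 0. (C s - C 0) /\<^sub>R s - P s * ((J s - J 0) /\<^sub>R s) = (P s - P 0) /\<^sub>R s"
      using PJ
    proof eventually_elim
      case (elim s)
      then show ?case
        by (simp add: J(2) P0 mult_scaleR_right flip: scaleR_diff_right) (simp add: algebra_simps flip: elim)
    qed
  qed
  then show ?thesis by (simp add: has_vector_derivative_0_iff)
qed

text \<open>
  Where \<open>f < 0\<close>, the inequality says that \<open>- 1/f + s/k\<close> decreases, while \<open>- 1/f\<close> stays positive up to the end \<open>R\<close>
  of the interval.
\<close>

lemma riccati_lower:
  fixes f g :: "real \<Rightarrow> real"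
  assumes der: "\<And>s. \<bar>s\<bar> < R \<Longrightarrow> (f has_real_derivative g s) (at s)"
    and le: "\<And>s. \<bar>s\<bar> < R \<Longrightarrow> g s \<le> - (f s)\<^sup>2 / k" and k: "k > 0" and s: "\<bar>s\<bar> < R"
  shows "f s \<ge> - k / (R - s)"
proof (cases "f s \<ge> 0")
  case True
  moreover have "k / (R - s) \<ge> 0" using s k by simp
  ultimately show ?thesis by simp
next
  case False
  have gneg: "g u \<le> 0" if "\<bar>u\<bar> < R" for u
  proof -
    have "(f u)\<^sup>2 / k \<ge> 0" using k by simp
    then show ?thesis using le[OF that] by simp
  qed
  have bd: "- 1 / f s \<ge> (u - s) / k" if u: "s < u" "u < R" for u
  proof -
    have neg: "f v < 0" if v: "s \<le> v" "v \<le> u" for v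
    proof -
      have "f v \<le> f s"
      proof (rule DERIV_nonpos_imp_nonincreasing[OF v(1)])
        fix x assume "s \<le> x" "x \<le> v"
        then have "\<bar>x\<bar> < R" using u v s by linarith
        then show "\<exists>y. (f has_real_derivative y) (at x) \<and> y \<le> 0" using der gneg by blast
      qed
      then show ?thesis using False by linarith
    qed
    have "- inverse (f u) + u / k \<le> - inverse (f s) + s / k"
    proof (rule DERIV_nonpos_imp_nonincreasing[of s u "\<lambda>v. - inverse (f v) + v / k"])
      fix v assume v: "s \<le> v" "v \<le> u"
      then have "\<bar>v\<bar> < R" using s u by linarith
      then have "((\<lambda>v. - inverse (f v) + v / k) has_real_derivative (g v / (f v)\<^sup>2 + 1 / k)) (at v)"
        using neg[OF v] k by (auto intro!: derivative_eq_intros der simp: power2_eq_square field_simps)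
      moreover have "g v / (f v)\<^sup>2 + 1 / k \<le> 0"
        using le[OF \<open>\<bar>v\<bar> < R\<close>] neg[OF v] k by (simp add: field_simps)
      ultimately show "\<exists>y. ((\<lambda>v. - inverse (f v) + v / k) has_real_derivative y) (at v) \<and> y \<le> 0" by blast
    qed (use u in simp)
    moreover have "- inverse (f u) > 0" using neg[of u] u by simp
    ultimately have "u / k - s / k \<le> - inverse (f s)" by linarith
    then show ?thesis by (simp add: diff_divide_distrib inverse_eq_divide)
  qed
  have "- 1 / f s \<ge> (R - s) / k"
  proof (rule tendsto_upperbound)
    show "((\<lambda>u. (u - s) / k) \<longlongrightarrow> (R - s) / k) (at_left R)" by (intro tendsto_intros) (use k in simp)
    show "\<forall>\<^sub>F u in at_left R. (u - s) / k \<le> - 1 / f s"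
      unfolding eventually_at_left_field using s bd by (intro exI[of _ s]) simp
  qed simp
  then show ?thesis using False s k by (simp add: field_simps)
qed

text \<open>
  The lower bound applied to \<open>f\<close> and to \<open>s \<mapsto> - f (- s)\<close> bounds \<open>f (- d) - f d\<close>, and the mean value theorem
  finds a point where the derivative is as small as the average.
\<close>

lemma riccati_small_derivative:
  fixes f g :: "real \<Rightarrow> real"
  assumes der: "\<And>s. \<bar>s\<bar> < R \<Longrightarrow> (f has_real_derivative g s) (at s)"
    and le: "\<And>s. \<bar>s\<bar> < R \<Longrightarrow> g s \<le> - (f s)\<^sup>2 / k" and k: "k > 0" and d: "0 < d" "d < R"
  obtains s where "\<bar>s\<bar> < d" "- g s \<le> k / (d * (R - d))"
proof -
  have 1: "f d \<ge> - k / (R - d)" by (rule riccati_lower[OF der le k]) (use d in auto)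
  have 2: "- f (- d) \<ge> - k / (R - d)"
  proof (rule riccati_lower[of R "\<lambda>s. - f (- s)" "\<lambda>s. g (- s)", OF _ _ k])
    fix s assume "\<bar>s\<bar> < R"
    then show "((\<lambda>s. - f (- s)) has_real_derivative g (- s)) (at s)"
      by (auto intro!: derivative_eq_intros DERIV_chain'[of uminus _ s _ f, OF _ der] )
    show "g (- s) \<le> - (- f (- s))\<^sup>2 / k" using le[of "- s"] \<open>\<bar>s\<bar> < R\<close> by simp
  qed (use d in auto)
  obtain s where s: "- d < s" "s < d" "f d - f (- d) = (d - (- d)) * g s"
    using MVT2[of "- d" d f g] der d by force
  define q where "q = k / (R - d)"
  have "f d - f (- d) \<ge> - (2 * q)" using 1 2 by (simp add: q_def)
  then have "d * (- g s) \<le> q" using s(3) by simp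
  then have "- g s \<le> q / d" using d by (simp add: pos_le_divide_eq mult.commute)
  then have "- g s \<le> k / (d * (R - d))" by (simp add: q_def mult.commute)
  then show thesis using s by (intro that[of s]) auto
qed

section \<open>Horizontal curves in the period domain\<close>

definition flow :: "'n::finite cmat \<Rightarrow> (int \<Rightarrow> (complex ^ 'n) set) \<Rightarrow> int \<Rightarrow> (complex ^ 'n) set" where
  "flow g \<Phi> = (\<lambda>p. ap g ` \<Phi> p)"

lemma flow_mult: "flow (g * h) \<Phi> = flow g (flow h \<Phi>)"
  by (simp add: flow_def image_image)

lemma flow_1: "flow 1 \<Phi> = \<Phi>"
  by (simp add: flow_def)

definition imag_exp :: "real \<Rightarrow> 'n::finite cmat \<Rightarrow> 'n cmat" where
  "imag_exp s X = exp (s *\<^sub>R (scal \<i> * X))"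

lemma imag_exp_0 [simp]: "imag_exp 0 X = 1" by (simp add: imag_exp_def)

lemma imag_exp_add: "imag_exp (s + t) X = imag_exp s X * imag_exp t X"
  unfolding imag_exp_def scaleR_add_left by (rule exp_add_commuting) simp

lemma cj_imag_exp: "cj X = X \<Longrightarrow> cj (imag_exp s X) = imag_exp (- s) X"
proof -
  assume "cj X = X"
  moreover have "scal (- \<i>) * X = - (scal \<i> * X)"
    by (rule sqmat_eqI) (simp add: vec_eq_iff)
  ultimately show ?thesis by (simp add: imag_exp_def cj_exp)
qed

lemma imag_exp_commute: "imag_exp s X * X = X * imag_exp s X"
proof -
  have "X * (s *\<^sub>R (scal \<i> * X)) = s *\<^sub>R (scal \<i> * X) * X" by (simp add: scal_move mult.assoc)
  from exp_intertwine[OF this] show ?thesis by (simp add: imag_exp_def)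
qed

lemma imag_exp_has_vector_derivative: "((\<lambda>s. imag_exp s X) has_vector_derivative scal \<i> * X) (at 0)"
  unfolding has_vector_derivative_def imag_exp_def
  by (rule exp_has_derivative_at_0[OF bounded_linear_scaleR_left])

text \<open>
  The factor in brackets maps \<open>\<Phi>\<^sup>p\<close> to the transported filtration step and the complement of \<open>\<Phi>\<^sup>p\<close> to the
  transported complement. It is close to \<open>1\<close> when \<open>g\<close> is, so the formula determines the transported projection
  near \<open>\<Phi>\<close>.
\<close>

lemma (in hodge_point) hproj_flow:
  assumes "hodge_point Q w (flow g \<Phi>) L"
  shows "hproj (flow g \<Phi>) p * (g * \<pi> p + cj g * (1 - \<pi> p)) = g * \<pi> p"
proof (rule sqmat_eqI)
  fix v
  interpret g: hodge_point Q w "flow g \<Phi>" L by fact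
  have m1: "ap g (ap (\<pi> p) v) \<in> flow g \<Phi> p" by (simp add: flow_def hproj_in)
  have m2: "ap (cj g) (v - ap (\<pi> p) v) \<in> cnj_vec ` flow g \<Phi> (w - p + 1)"
  proof -
    have "cnj_vec (v - ap (\<pi> p) v) \<in> \<Phi> (w - p + 1)"
      using hproj_co[of v p] by (simp only: in_cnj_image)
    then show ?thesis unfolding in_cnj_image flow_def cnj_vec_ap cj_simps by (rule imageI)
  qed
  show "ap (hproj (flow g \<Phi>) p * (g * \<pi> p + cj g * (1 - \<pi> p))) v = ap (g * \<pi> p) v"
    using g.hproj_unique[OF m1 m2] by simp
qed

context horizontal
begin

lemma hproj_derivative_0:
  assumes near: "\<forall>\<^sub>F s in at 0. hodge_point Q w (flow (imag_exp s X) \<Phi>) L"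
  shows "((\<lambda>s. hproj (flow (imag_exp s X) \<Phi>) p) has_vector_derivative
           scal \<i> * ((1 - \<pi> p) * X * \<pi> p + \<pi> p * X * (1 - \<pi> p))) (at 0)"
proof -
  have neg: "((\<lambda>s. imag_exp (- s) X) has_vector_derivative - (scal \<i> * X)) (at 0)"
    unfolding has_vector_derivative_def imag_exp_def
    using exp_has_derivative_at_0[of "\<lambda>s::real. (- s) *\<^sub>R (scal \<i> * X)"]
    by (simp add: bounded_linear_minus bounded_linear_scaleR_left)
  have "((\<lambda>s. hproj (flow (imag_exp s X) \<Phi>) p) has_vector_derivative
      (scal \<i> * X) * \<pi> p - hproj (flow (imag_exp 0 X) \<Phi>) p *
        ((scal \<i> * X) * \<pi> p + (- (scal \<i> * X)) * (1 - \<pi> p))) (at 0)"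
  proof (rule vector_derivative_right_factor)
    show "((\<lambda>s. imag_exp s X * \<pi> p + imag_exp (- s) X * (1 - \<pi> p)) has_vector_derivative
        ((scal \<i> * X) * \<pi> p + (- (scal \<i> * X)) * (1 - \<pi> p))) (at 0)"
      by (intro has_vector_derivative_add neg imag_exp_has_vector_derivative
          bounded_linear.has_vector_derivative[OF bounded_linear_mult_left])
    show "((\<lambda>s. imag_exp s X * \<pi> p) has_vector_derivative (scal \<i> * X) * \<pi> p) (at 0)"
      by (intro imag_exp_has_vector_derivative bounded_linear.has_vector_derivative[OF bounded_linear_mult_left])
    show "\<forall>\<^sub>F s in at 0. hproj (flow (imag_exp s X) \<Phi>) p * (imag_exp s X * \<pi> p + imag_exp (- s) X * (1 - \<pi> p)) = imag_exp s X * \<pi> p"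
      using near
    proof eventually_elim
      case (elim s)
      show ?case using hproj_flow[OF elim, of p] by (simp add: cj_imag_exp X_real)
    qed
  qed (simp_all add: flow_1)
  then show ?thesis by (simp add: flow_1 algebra_simps scal_move)
qed

lemma horizontal_flow:
  assumes "pol_hodge (flow (imag_exp s X) \<Phi>)"
  shows "horizontal Q w (flow (imag_exp s X) \<Phi>) L X"
proof unfold_locales
  fix p v
  show "pol_hodge (flow (imag_exp s X) \<Phi>)" by fact
  show "L < p \<Longrightarrow> flow (imag_exp s X) \<Phi> p = {0}" by (simp add: flow_def L_zero)
  assume "v \<in> flow (imag_exp s X) \<Phi> p"
  then obtain u where u: "u \<in> \<Phi> p" "v = ap (imag_exp s X) u" by (auto simp: flow_def)
  then have "ap X v = ap (imag_exp s X) (ap X u)" by (simp flip: ap_simps(1) add: imag_exp_commute)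
  then show "ap X v \<in> flow (imag_exp s X) \<Phi> (p - 1)" using X_shift[OF u(1)] by (simp add: flow_def)
qed (use L_w X_real X_skew tr_X2 in auto)

end

text \<open>
  The same operator as \<open>diag\<close>, but as a function of an arbitrary filtration, so that it can be followed along
  a curve.
\<close>

definition (in polform) diag_part :: "(int \<Rightarrow> (complex ^ 'n) set) \<Rightarrow> int \<Rightarrow> 'n cmat \<Rightarrow> 'n cmat" where
  "diag_part \<Phi> L X = (\<Sum>a\<in>{w - L..L}. (hproj \<Phi> a - hproj \<Phi> (a + 1)) * X * (hproj \<Phi> a - hproj \<Phi> (a + 1)))"

lemma (in hodge_point) diag_eq: "diag_part \<Phi> L X = diag X"
  by (simp add: diag_part_def diag_def e_def)

text \<open>
  By the group law, a point of the curve can serve as the new origin.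
\<close>

lemma (in horizontal) hproj_derivative:
  assumes phsR: "\<And>s. \<bar>s\<bar> < R \<Longrightarrow> pol_hodge (flow (imag_exp s X) \<Phi>)" and s: "\<bar>s\<bar> < R"
  defines "P \<equiv> \<lambda>s p. hproj (flow (imag_exp s X) \<Phi>) p"
  shows "((\<lambda>s. P s p) has_vector_derivative
           scal \<i> * ((1 - P s p) * X * P s p + P s p * X * (1 - P s p))) (at s)"
proof -
  interpret s: horizontal Q w "flow (imag_exp s X) \<Phi>" L X by (rule horizontal_flow[OF phsR[OF s]])
  have fl: "flow (imag_exp t X) (flow (imag_exp s X) \<Phi>) = flow (imag_exp (s + t) X) \<Phi>" for t
    by (simp add: flow_mult[symmetric] imag_exp_add[symmetric] add.commute)
  have "\<forall>\<^sub>F t in at 0. \<bar>s + t\<bar> < R"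
  proof -
    have "((\<lambda>t. \<bar>s + t\<bar>) \<longlongrightarrow> \<bar>s + 0\<bar>) (at 0)" by (intro tendsto_intros)
    from order_tendstoD(2)[OF this, of R] s show ?thesis by simp
  qed
  then have "\<forall>\<^sub>F t in at 0. hodge_point Q w (flow (imag_exp t X) (flow (imag_exp s X) \<Phi>)) L"
  proof eventually_elim
    case (elim t)
    interpret h: horizontal Q w "flow (imag_exp (s + t) X) \<Phi>" L X by (rule horizontal_flow[OF phsR[OF elim]])
    show ?case unfolding fl by (rule h.hodge_point_axioms)
  qed
  from s.hproj_derivative_0[OF this, of p]
  have "((\<lambda>t. P (s + t) p) has_vector_derivative
           scal \<i> * ((1 - P s p) * X * P s p + P s p * X * (1 - P s p))) (at 0)"
    unfolding fl P_def .
  then show ?thesis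
    unfolding has_vector_derivative_def has_derivative_at by simp
qed

text \<open>
  The function \<open>f\<close> in the proof is half the logarithmic derivative of the determinants of the Hodge metrics. Its
  derivative is given by \<open>trace_identity\<close> and satisfies the Riccati inequality by \<open>schwarz\<close>.
\<close>

lemma (in horizontal) small_diagonal:
  assumes phsR: "\<And>s. \<bar>s\<bar> < R \<Longrightarrow> pol_hodge (flow (imag_exp s X) \<Phi>)" and d: "0 < d" "d < R"
    and k: "(real_of_int (2 * L - w + 1))\<^sup>2 * real CARD('n) \<le> k" "k > 0"
  obtains s where "\<bar>s\<bar> < d"
    "- Re (tr (diag_part (flow (imag_exp s X) \<Phi>) L X * diag_part (flow (imag_exp s X) \<Phi>) L X)) \<le> k / (d * (R - d))"
proof -
  define P where "P s p = hproj (flow (imag_exp s X) \<Phi>) p" for s p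
  define f where "f s = Re (\<i> * (\<Sum>p\<in>{w - L..L}. tr (P s (p + 1) * X)))" for s
  define g where "g s = Re (tr (diag_part (flow (imag_exp s X) \<Phi>) L X * diag_part (flow (imag_exp s X) \<Phi>) L X))" for s
  have der: "(f has_real_derivative g s) (at s)" if s: "\<bar>s\<bar> < R" for s
  proof -
    interpret s: horizontal Q w "flow (imag_exp s X) \<Phi>" L X by (rule horizontal_flow[OF phsR[OF s]])
    define D where "D p = scal \<i> * ((1 - P s p) * X * P s p + P s p * X * (1 - P s p))" for p
    have bl1: "bounded_linear (\<lambda>z. Re (\<i> * z))"
      by (rule bounded_linear_compose[OF bounded_linear_Re bounded_linear_mult_right])
    have bl2: "bounded_linear (\<lambda>A. tr (A * X))"
      by (rule bounded_linear_compose[OF bounded_linear_tr bounded_linear_mult_left])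
    have "((\<lambda>s. P s p) has_vector_derivative D p) (at s)" for p
      unfolding P_def D_def by (rule hproj_derivative[OF phsR s])
    then have "((\<lambda>s. tr (P s p * X)) has_vector_derivative tr (D p * X)) (at s)" for p
      by (rule bounded_linear.has_vector_derivative[OF bl2])
    then have "((\<lambda>s. \<Sum>p\<in>{w - L..L}. tr (P s (p + 1) * X)) has_vector_derivative
        (\<Sum>p\<in>{w - L..L}. tr (D (p + 1) * X))) (at s)"
      by (intro has_vector_derivative_sum)
    then have "(f has_vector_derivative Re (\<i> * (\<Sum>p\<in>{w - L..L}. tr (D (p + 1) * X)))) (at s)"
      unfolding f_def[abs_def] by (rule bounded_linear.has_vector_derivative[OF bl1])
    moreover have t: "tr (D p * X) = 2 * \<i> * tr ((1 - P s p) * X * P s p * X)" for p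
    proof -
      have "tr (P s p * X * (1 - P s p) * X) = tr ((P s p * X) * ((1 - P s p) * X))" by (simp add: mult.assoc)
      also have "\<dots> = tr ((1 - P s p) * X * (P s p * X))" by (rule tr_commute)
      finally have "tr (P s p * X * (1 - P s p) * X) = tr ((1 - P s p) * X * P s p * X)"
        by (simp add: mult.assoc)
      then show ?thesis by (simp add: D_def mult.assoc tr_scal) (simp add: distrib_right mult.assoc)
    qed
    have "\<i> * (\<Sum>p\<in>{w - L..L}. tr (D (p + 1) * X)) = - (2 * (\<Sum>p\<in>{w - L..L}. tr ((1 - P s (p + 1)) * X * P s (p + 1) * X)))"
    proof -
      have "\<i> * (2 * \<i> * x) = - (2 * x)" for x :: complex by (simp add: complex_eq_iff)
      then show ?thesis using t by (simp only: sum_distrib_left sum_negf[symmetric])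
    qed
    then have "Re (\<i> * (\<Sum>p\<in>{w - L..L}. tr (D (p + 1) * X))) = g s"
      by (simp only: P_def s.trace_identity g_def s.diag_eq minus_minus)
    ultimately show ?thesis by (simp add: has_real_derivative_iff_has_vector_derivative)
  qed
  have le: "g s \<le> - (f s)\<^sup>2 / k" if s: "\<bar>s\<bar> < R" for s
  proof -
    interpret s: horizontal Q w "flow (imag_exp s X) \<Phi>" L X by (rule horizontal_flow[OF phsR[OF s]])
    have "f s = Re (\<i> * tr (s.Gr * X))"
      by (simp only: f_def s.Gr_def P_def sum_distrib_right tr_sum)
    then show ?thesis using s.schwarz[OF k] by (simp only: g_def s.diag_eq)
  qed
  show thesis
    using riccati_small_derivative[OF der le k(2) d] that by (auto simp: g_def)
qed

lemma complex_subspace_imp_real: "vec.subspace S \<Longrightarrow> subspace S" for S :: "(complex ^ 'n) set"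
proof -
  have "r *\<^sub>R v = of_real r *s v" for r and v :: "complex ^ 'n"
    by (simp add: vec_eq_iff scaleR_conv_of_real[of _ "_ :: complex"])
  then show "vec.subspace S \<Longrightarrow> subspace S"
    by (simp add: vec.subspace_def subspace_def)
qed

lemma (in polform) bounded_linear_QC: "bounded_linear (\<lambda>v. QC u v)" "bounded_linear (\<lambda>v. QC v u)"
  by (rule linear_conv_bounded_linear[THEN iffD1], rule linearI,
      simp_all add: QC_add_left QC_add_right QC_scaleR scaleR_conv_of_real[of _ "_ :: complex"])+

lemma (in polform) skew_limit:
  assumes "Xs \<longlonglongrightarrow> X" "\<And>k::nat. skew (Xs k)"
  shows "skew X"
  unfolding skew_def
proof (intro allI)
  fix u v
  have "(\<lambda>k. QC (ap (Xs k) u) v) \<longlonglongrightarrow> QC (ap X u) v"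
    by (intro bounded_linear.tendsto[OF bounded_linear_QC(2)] tendsto_intros assms)
  moreover have "(\<lambda>k. - QC u (ap (Xs k) v)) \<longlonglongrightarrow> - QC u (ap X v)"
    by (intro tendsto_minus bounded_linear.tendsto[OF bounded_linear_QC(1)] tendsto_intros assms)
  moreover have "QC (ap (Xs k) u) v = - QC u (ap (Xs k) v)" for k
    using assms(2) by (simp add: skew_def)
  ultimately show "QC (ap X u) v = - QC u (ap X v)" by (simp add: LIMSEQ_unique)
qed

text \<open>
  On the interval \<open>\<bar>s\<bar> < R\<^sub>k\<close> there is a parameter \<open>s\<^sub>k\<close> at which the diagonal part of \<open>X\<^sub>k\<close> is small, and \<open>s\<^sub>k\<close>
  can be chosen to tend to \<open>0\<close>. In the limit the diagonal part of \<open>X\<close> at \<open>\<Phi>\<close> itself is zero.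
\<close>

lemma (in polform) horizontal_limit_zero:
  fixes X :: "'n cmat" and Xs :: "nat \<Rightarrow> 'n cmat" and R :: "nat \<Rightarrow> real"
  assumes pt: "hodge_point Q w \<Phi> L" and lim: "Xs \<longlonglongrightarrow> X" and R: "filterlim R at_top sequentially"
    and hor: "\<And>k. cj (Xs k) = Xs k" "\<And>k. skew (Xs k)" "\<And>k. tr (Xs k * Xs k) = 0"
      "\<And>k p v. v \<in> \<Phi> p \<Longrightarrow> ap (Xs k) v \<in> \<Phi> (p - 1)"
    and phsR: "\<And>k s. \<bar>s\<bar> < R k \<Longrightarrow> pol_hodge (flow (imag_exp s (Xs k)) \<Phi>)"
  shows "X = 0"
proof -
  interpret hodge_point Q w \<Phi> L by fact
  have hk: "horizontal Q w \<Phi> L (Xs k)" for k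
    by unfold_locales (use hor in auto)
  define \<kappa> where "\<kappa> = (real_of_int (2 * L - w + 1))\<^sup>2 * real CARD('n) + 1"
  have \<kappa>: "(real_of_int (2 * L - w + 1))\<^sup>2 * real CARD('n) \<le> \<kappa>" "\<kappa> > 0"
    by (simp_all add: \<kappa>_def add_nonneg_pos)
  define B where "B s k = diag_part (flow (imag_exp s (Xs k)) \<Phi>) L (Xs k)" for s k
  \<comment> \<open>With \<open>d = 1/r\<close> both \<open>d\<close> and the bound \<open>\<kappa> / (d (R - d))\<close> tend to zero.\<close>
  define r where "r k = sqrt (R k)" for k
  have r: "filterlim r at_top sequentially"
    unfolding r_def by (rule filterlim_compose[OF sqrt_at_top R])
  have "\<forall>\<^sub>F k in sequentially. r k > 1" using r by (simp add: filterlim_at_top_dense)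
  then have "\<forall>\<^sub>F k in sequentially. \<exists>s. \<bar>s\<bar> < 1 / r k \<and> \<bar>s\<bar> < R k \<and>
      - Re (tr (B s k * B s k)) \<le> \<kappa> / (1 / r k * (R k - 1 / r k))"
  proof eventually_elim
    case (elim k)
    have R2: "R k = (r k)\<^sup>2" using elim by (simp add: r_def)
    have "1 / r k < 1" using elim by simp
    also have "1 < R k" using elim by (simp add: R2 one_less_power)
    finally have d: "1 / r k < R k" .
    interpret k: horizontal Q w \<Phi> L "Xs k" by (rule hk)
    obtain s where "\<bar>s\<bar> < 1 / r k" "- Re (tr (B s k * B s k)) \<le> \<kappa> / (1 / r k * (R k - 1 / r k))"
      unfolding B_def using k.small_diagonal[OF phsR _ d \<kappa>] elim by auto
    then show ?case using d by (intro exI[of _ s]) auto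
  qed
  then obtain s where s: "\<forall>\<^sub>F k in sequentially. \<bar>s k\<bar> < 1 / r k \<and> \<bar>s k\<bar> < R k \<and>
      - Re (tr (B (s k) k * B (s k) k)) \<le> \<kappa> / (1 / r k * (R k - 1 / r k))"
    unfolding eventually_sequentially by metis
  have inv_r: "(\<lambda>k. 1 / r k) \<longlonglongrightarrow> 0"
    using tendsto_inverse_0_at_top[OF r] by (simp add: inverse_eq_divide)
  have s0: "s \<longlonglongrightarrow> 0"
    by (rule Lim_null_comparison[OF _ inv_r]) (use s in \<open>auto elim: eventually_mono\<close>)
  have rot1: "(\<lambda>k. imag_exp (t k) (Xs k)) \<longlonglongrightarrow> 1" if "t \<longlonglongrightarrow> 0" for t
  proof -
    have "(\<lambda>k. t k *\<^sub>R (scal \<i> * Xs k)) \<longlonglongrightarrow> 0 *\<^sub>R (scal \<i> * X)"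
      by (intro tendsto_intros that lim)
    then have "(\<lambda>k. t k *\<^sub>R (scal \<i> * Xs k)) \<longlonglongrightarrow> 0" by simp
    moreover have "isCont (exp :: 'n cmat \<Rightarrow> 'n cmat) 0"
      using continuous_exp_banach_algebra[where 'a = "'n cmat"] by (simp add: continuous_on_eq_continuous_at)
    ultimately have "(\<lambda>k. exp (t k *\<^sub>R (scal \<i> * Xs k))) \<longlonglongrightarrow> exp 0" by (rule isCont_tendsto_compose[rotated])
    then show ?thesis by (simp add: imag_exp_def)
  qed
  have proj: "(\<lambda>k. hproj (flow (imag_exp (s k) (Xs k)) \<Phi>) p) \<longlonglongrightarrow> \<pi> p" for p
  proof (rule tendsto_right_factor)
    have "(\<lambda>k. imag_exp (s k) (Xs k) * \<pi> p + imag_exp (- s k) (Xs k) * (1 - \<pi> p)) \<longlonglongrightarrow> 1 * \<pi> p + 1 * (1 - \<pi> p)"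
      using s0 tendsto_minus[OF s0] by (intro tendsto_intros rot1) simp_all
    then show "(\<lambda>k. imag_exp (s k) (Xs k) * \<pi> p + imag_exp (- s k) (Xs k) * (1 - \<pi> p)) \<longlonglongrightarrow> 1" by simp
    have "(\<lambda>k. imag_exp (s k) (Xs k) * \<pi> p) \<longlonglongrightarrow> 1 * \<pi> p" by (intro tendsto_intros rot1 s0)
    then show "(\<lambda>k. imag_exp (s k) (Xs k) * \<pi> p) \<longlonglongrightarrow> \<pi> p" by simp
    show "\<forall>\<^sub>F k in sequentially. hproj (flow (imag_exp (s k) (Xs k)) \<Phi>) p *
        (imag_exp (s k) (Xs k) * \<pi> p + imag_exp (- s k) (Xs k) * (1 - \<pi> p)) = imag_exp (s k) (Xs k) * \<pi> p"
      using s
    proof eventually_elim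
      case (elim k)
      interpret k: horizontal Q w \<Phi> L "Xs k" by (rule hk)
      have "horizontal Q w (flow (imag_exp (s k) (Xs k)) \<Phi>) L (Xs k)"
        using elim by (intro k.horizontal_flow phsR) simp
      then interpret f: horizontal Q w "flow (imag_exp (s k) (Xs k)) \<Phi>" L "Xs k" .
      show ?case using hproj_flow[OF f.hodge_point_axioms, of p] by (simp add: cj_imag_exp hor)
    qed
  qed
  have "(\<lambda>k. B (s k) k) \<longlonglongrightarrow> diag X"
    unfolding B_def diag_part_def diag_eq[symmetric] by (intro tendsto_intros proj lim)
  then have BB: "(\<lambda>k. Re (tr (B (s k) k * B (s k) k))) \<longlonglongrightarrow> Re (tr (diag X * diag X))"
    by (intro tendsto_intros)
  have "Re (tr (diag X * diag X)) \<ge> 0"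
  proof -
    have "(\<lambda>k. r k - (1 / r k) * (1 / r k)) = (\<lambda>k. - ((1 / r k) * (1 / r k)) + r k)" by auto
    moreover have "filterlim (\<lambda>k. - ((1 / r k) * (1 / r k)) + r k) at_top sequentially"
      by (rule filterlim_tendsto_add_at_top[OF tendsto_minus[OF tendsto_mult[OF inv_r inv_r]] r])
    ultimately have "filterlim (\<lambda>k. r k - (1 / r k) * (1 / r k)) at_top sequentially" by simp
    then have "(\<lambda>k. \<kappa> * inverse (r k - (1 / r k) * (1 / r k))) \<longlonglongrightarrow> \<kappa> * 0"
      by (intro tendsto_intros tendsto_inverse_0_at_top)
    moreover have "\<forall>\<^sub>F k in sequentially. - Re (tr (B (s k) k * B (s k) k)) \<le> \<kappa> * inverse (r k - (1 / r k) * (1 / r k))"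
      using s \<open>\<forall>\<^sub>F k in sequentially. r k > 1\<close>
    proof eventually_elim
      case (elim k)
      have "R k > 0" using elim(1) abs_ge_zero[of "s k"] by linarith
      then have "R k = r k * r k" by (simp add: r_def)
      then have "1 / r k * (R k - 1 / r k) = r k - (1 / r k) * (1 / r k)"
        using elim(2) by (simp add: field_simps)
      then show ?case using elim(1) by (simp add: divide_inverse)
    qed
    ultimately have "- Re (tr (diag X * diag X)) \<le> \<kappa> * 0"
      using tendsto_minus[OF BB] by (intro tendsto_le[OF trivial_limit_sequentially])
    then show ?thesis by simp
  qed
  moreover have "horizontal Q w \<Phi> L X"
  proof unfold_locales
    have "(\<lambda>k. cj (Xs k)) \<longlonglongrightarrow> cj X" by (intro tendsto_intros lim)
    then show "cj X = X" using lim LIMSEQ_unique by (simp add: hor) blast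
    have "(\<lambda>k. tr (Xs k * Xs k)) \<longlonglongrightarrow> tr (X * X)" by (intro tendsto_intros lim)
    then show "tr (X * X) = 0" by (simp add: hor LIMSEQ_const_iff)
    show "skew X" by (rule skew_limit[OF lim hor(2)])
    show "ap X v \<in> \<Phi> (p - 1)" if "v \<in> \<Phi> p" for p v
    proof -
      have sub: "subspace (\<Phi> (p - 1))" by (rule complex_subspace_imp_real[OF subspace_F])
      have "(\<lambda>k. ap (Xs k) v) \<longlonglongrightarrow> ap X v" by (intro tendsto_intros lim)
      then show ?thesis
        using hor(4)[OF that] by (rule closed_sequentially[OF closed_subspace[OF sub], rotated])
    qed
  qed
  ultimately show ?thesis
    using horizontal.diag_zero_imp_zero horizontal.diag_trace_nonpos by (metis order_antisym)
qed

section \<open>The Deligne bigrading\<close>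

lemma vec_subspace_complexify: "subspace U \<Longrightarrow> vec.subspace (complexify_space U)"
  unfolding vec.subspace_def complexify_space_def
  by (auto simp: re_im_vec_simps subspace_add subspace_diff subspace_scale)
     (simp_all add: re_vec_def im_vec_def vec_eq_iff subspace_0 flip: zero_vec_def)

lemma complexify_space_mono: "U \<subseteq> V \<Longrightarrow> complexify_space U \<subseteq> complexify_space V"
  by (auto simp: complexify_space_def)

lemma complexify_space_0: "complexify_space {0} = {0}"
  by (auto simp: complexify_space_def re_vec_def im_vec_def vec_eq_iff complex_eq_iff)

lemma complexify_space_UNIV: "complexify_space UNIV = UNIV"
  by (simp add: complexify_space_def)

lemma int_chain_mono:
  fixes W :: "int \<Rightarrow> 'a set"
  assumes "\<And>k. W k \<subseteq> W (k + 1)" "k \<le> l"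
  shows "W k \<subseteq> W l"
  using assms(2) by (induction l rule: int_ge_induct) (use assms(1) in auto)

locale mhs =
  fixes W :: "int \<Rightarrow> (real ^ 'n::finite) set" and F :: "int \<Rightarrow> (complex ^ 'n) set"
  assumes mixed: "mixed_hodge_structure W F"
begin

abbreviation "CW k \<equiv> complexify_space (W k)"

lemma subspace_W: "subspace (W k)" and W_step: "W k \<subseteq> W (k + 1)"
  and W_ends: "\<exists>k. W k = {0}" "\<exists>k. W k = UNIV"
  and subspace_F: "vec.subspace (F p)" and F_step: "F (p + 1) \<subseteq> F p"
  and F_ends: "\<exists>p. F p = UNIV" "\<exists>p. F p = {0}"
  using mixed by (simp_all add: mixed_hodge_structure_def increasing_filtration_def decreasing_filtration_def)

lemma subspace_CW: "vec.subspace (CW k)"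
  by (rule vec_subspace_complexify[OF subspace_W])

lemma CW_mono: "k \<le> l \<Longrightarrow> CW k \<subseteq> CW l"
  by (rule complexify_space_mono, rule int_chain_mono[of W], rule W_step)

lemma F_antimono: "p \<le> q \<Longrightarrow> F q \<subseteq> F p"
  using int_chain_mono[of "\<lambda>p. F (- p)" "- q" "- p"] F_step[of "- _ - 1"] by simp

lemmas sub_rules = vec.subspace_add[OF subspace_F] vec.subspace_add[OF subspace_CW]
  vec.subspace_diff[OF subspace_F] vec.subspace_diff[OF subspace_CW]
  vec.subspace_neg[OF subspace_F] vec.subspace_neg[OF subspace_CW]
  vec.subspace_0[OF subspace_F] vec.subspace_0[OF subspace_CW]

text \<open>
  Representatives for the decomposition of \<open>Gr\<^sub>l\<close> into a step of the induced filtration and the opposed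
  conjugate step.
\<close>

lemma graded_split:
  assumes "r \<in> CW l"
  obtains a b c where "a \<in> F p" "a \<in> CW l" "cnj_vec b \<in> F (l - p + 1)" "b \<in> CW l" "c \<in> CW (l - 1)" "r = a + b + c"
proof -
  have "(F p \<inter> CW l + CW (l - 1)) + (cnj_vec ` F (l - p + 1) \<inter> CW l + CW (l - 1)) = CW l"
    using mixed unfolding mixed_hodge_structure_def Let_def by blast
  then have "r \<in> (F p \<inter> CW l + CW (l - 1)) + (cnj_vec ` F (l - p + 1) \<inter> CW l + CW (l - 1))"
    using assms by simp
  then obtain x y where xy: "x \<in> F p \<inter> CW l + CW (l - 1)"
    "y \<in> cnj_vec ` F (l - p + 1) \<inter> CW l + CW (l - 1)" "r = x + y"
    by (rule set_plus_elim)
  obtain a c1 where a: "x = a + c1" "a \<in> F p \<inter> CW l" "c1 \<in> CW (l - 1)"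
    by (rule set_plus_elim[OF xy(1)])
  obtain b c2 where b: "y = b + c2" "b \<in> cnj_vec ` F (l - p + 1) \<inter> CW l" "c2 \<in> CW (l - 1)"
    by (rule set_plus_elim[OF xy(2)])
  show thesis
    using a b xy(3) by (intro that[of a b "c1 + c2"]) (auto simp: in_cnj_image sub_rules)
qed

lemma graded_disjoint:
  assumes "a \<in> F p" "a \<in> CW l" "c \<in> CW (l - 1)" "cnj_vec b \<in> F (l - p + 1)" "b \<in> CW l" "c' \<in> CW (l - 1)"
    "a + c = b + c'"
  shows "a + c \<in> CW (l - 1)"
proof -
  have "(F p \<inter> CW l + CW (l - 1)) \<inter> (cnj_vec ` F (l - p + 1) \<inter> CW l + CW (l - 1)) = CW (l - 1)"
    using mixed unfolding mixed_hodge_structure_def Let_def by blast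
  moreover have "a + c \<in> F p \<inter> CW l + CW (l - 1)" using assms by (intro set_plus_intro) auto
  moreover have "a + c \<in> cnj_vec ` F (l - p + 1) \<inter> CW l + CW (l - 1)"
    unfolding assms(7) using assms by (intro set_plus_intro) (auto simp: in_cnj_image)
  ultimately show ?thesis by blast
qed

lemma deligne_subset: "deligne W F p q \<subseteq> F p \<inter> CW (p + q)"
  by (auto simp: deligne_def)

lemma subspace_deligne: "vec.subspace (deligne W F p q)"
proof -
  have sum: "vec.subspace (A + B)" if "vec.subspace A" "vec.subspace B" for A B :: "(complex ^ 'n) set"
  proof -
    have "A + B = {x + y |x y. x \<in> A \<and> y \<in> B}" by (auto simp: set_plus_def)
    then show ?thesis using vec.subspace_sums[OF that] by simp
  qed
  show ?thesis
    unfolding deligne_def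
    by (intro vec.subspace_inter sum subspace_F subspace_CW subspace_cnj vec.subspace_span)
qed

text \<open>
  Deligne's construction: a class of type \<open>(p,q)\<close> in \<open>Gr\<^sub>p\<^sub>+\<^sub>q\<close> has a representative \<open>u\<close> in \<open>F\<^sup>p\<close> and a representative
  \<open>v\<close> in the conjugate of \<open>F\<^sup>q\<close>. Their difference lies in lower weight, where it is split again; one part
  corrects \<open>u\<close>, the other is collected in the sum that the definition of the bigrading allows, and the weight
  of the remainder drops by one.
\<close>

lemma deligne_lift:
  assumes u: "u \<in> F p" "u \<in> CW (p + q)" and v: "cnj_vec v \<in> F q" "v \<in> CW (p + q)"
    and uv: "u - v \<in> CW (p + q - 1)"
  obtains x where "x \<in> deligne W F p q" "u - x \<in> CW (p + q - 1)"
proof -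
  define Z where "Z = vec.span (\<Union>j\<in>{1..}. cnj_vec ` F (q - j) \<inter> CW (p + q - j - 1))"
  \<comment> \<open>After \<open>n\<close> corrections the remainder \<open>r\<close> has weight \<open>p + q - 1 - n\<close>.\<close>
  have step: "\<exists>x y z r. x \<in> F p \<and> x \<in> CW (p + q) \<and> u - x \<in> CW (p + q - 1) \<and> cnj_vec y \<in> F q \<and> y \<in> CW (p + q) \<and>
      z \<in> Z \<and> r \<in> CW (p + q - 1 - int n) \<and> x = y + z + r" for n
  proof (induction n)
    case 0
    show ?case
      using u v uv by (intro exI[of _ u] exI[of _ v] exI[of _ 0] exI[of _ "u - v"])
        (simp add: Z_def vec.span_zero sub_rules)
  next
    case (Suc n)
    then obtain x y z r where IH: "x \<in> F p" "x \<in> CW (p + q)" "u - x \<in> CW (p + q - 1)" "cnj_vec y \<in> F q" "y \<in> CW (p + q)"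
      "z \<in> Z" "r \<in> CW (p + q - 1 - int n)" "x = y + z + r" by blast
    obtain a b c where abc: "a \<in> F p" "a \<in> CW (p + q - 1 - int n)" "cnj_vec b \<in> F (p + q - 1 - int n - p + 1)"
      "b \<in> CW (p + q - 1 - int n)" "c \<in> CW (p + q - 1 - int n - 1)" "r = a + b + c"
      using graded_split[OF IH(7), of p] by metis
    have lev: "CW (p + q - 1 - int n) \<subseteq> CW (p + q - 1)" "CW (p + q - 1 - int n) \<subseteq> CW (p + q)"
      by (intro CW_mono; simp)+
    have ind: "p + q - 1 - int n - p + 1 = q - int n" "p + q - 1 - int n - 1 = p + q - 1 - int (Suc n)" by simp_all
    have xa: "x - a \<in> F p" "x - a \<in> CW (p + q)"
      using IH(2) abc(2) lev by (blast intro: vec.subspace_diff[OF subspace_F IH(1) abc(1)] vec.subspace_diff[OF subspace_CW])+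
    have "(u - x) + a \<in> CW (p + q - 1)"
      using abc(2) lev by (blast intro: vec.subspace_add[OF subspace_CW IH(3)])
    moreover have "u - (x - a) = (u - x) + a" by simp
    ultimately have ux: "u - (x - a) \<in> CW (p + q - 1)" by (simp only:)
    show ?case
    proof (cases "n = 0")
      case True
      then have "cnj_vec (y + b) \<in> F q" "y + b \<in> CW (p + q)"
        using IH(4,5) abc(3,4) lev by (auto intro!: sub_rules simp: ind)
      then show ?thesis
        using xa ux IH(6,8) abc(5,6) unfolding ind
        by (intro exI[of _ "x - a"] exI[of _ "y + b"] exI[of _ z] exI[of _ c]) simp
    next
      case False
      have "b \<in> Z"
        unfolding Z_def
      proof (rule vec.span_base, rule UN_I[of "int n"])
        show "b \<in> cnj_vec ` F (q - int n) \<inter> CW (p + q - int n - 1)"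
          using abc(3,4) by (simp add: in_cnj_image ind algebra_simps)
      qed (use False in simp)
      then have "z + b \<in> Z" using IH(6) unfolding Z_def by (rule vec.span_add[rotated])
      then show ?thesis
        using xa ux IH(4,5,8) abc(5,6) unfolding ind
        by (intro exI[of _ "x - a"] exI[of _ y] exI[of _ "z + b"] exI[of _ c]) simp
    qed
  qed
  obtain k where k: "CW k = {0}" using W_ends(1) complexify_space_0 by metis
  define n where "n = nat (p + q - 1 - k)"
  have "CW (p + q - 1 - int n) \<subseteq> {0}" using CW_mono[of "p + q - 1 - int n" k] k by (simp add: n_def)
  then obtain x y z where x: "x \<in> F p" "x \<in> CW (p + q)" "u - x \<in> CW (p + q - 1)" "cnj_vec y \<in> F q" "y \<in> CW (p + q)"
      "z \<in> Z" "x = y + z"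
    using step[of n] by auto
  have "x \<in> deligne W F p q"
    unfolding deligne_def Z_def[symmetric] using x by (auto simp: in_cnj_image intro: set_plus_intro)
  then show thesis using x(3) that by blast
qed

text \<open>
  Induction on the weight, and for each weight downwards on \<open>p\<close>: modulo lower weight a vector is the sum of one
  in \<open>F\<^bsup>p+1\<^esup>\<close> and one of type \<open>(p, k - p)\<close>, and the latter lifts to the bigrading.
\<close>

lemma filtered_pieces_span:
  "F p \<inter> CW k \<subseteq> vec.span (\<Union>(r, s)\<in>{(r, s). p \<le> r \<and> r + s \<le> k}. deligne W F r s)" (is "_ \<subseteq> ?D p k")
proof -
  have mono: "?D p' k' \<subseteq> ?D p k" if "p \<le> p'" "k' \<le> k" for p p' k k'
    by (intro vec.span_mono UN_mono) (use that in auto)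
  obtain k0 where k0: "CW k0 = {0}" using W_ends(1) complexify_space_0 by metis
  obtain p0 where p0: "F p0 = {0}" using F_ends(2) by blast
  have up: "F p \<inter> CW (k0 + int n) \<subseteq> ?D p (k0 + int n)" for n p
  proof (induction n arbitrary: p)
    case 0
    then show ?case by (auto simp: k0 vec.span_zero)
  next
    case (Suc n)
    define k where "k = k0 + int (Suc n)"
    have IH: "F p \<inter> CW (k - 1) \<subseteq> ?D p (k - 1)" for p using Suc[of p] by (simp add: k_def)
    have "F (p0 - int j) \<inter> CW k \<subseteq> ?D (p0 - int j) k" for j
    proof (induction j)
      case 0
      then show ?case by (auto simp: p0 vec.span_zero)
    next
      case (Suc j)
      define p where "p = p0 - int (Suc j)"
      have IH': "F (p + 1) \<inter> CW k \<subseteq> ?D (p + 1) k" using Suc by (simp add: p_def)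
      show ?case
        unfolding p_def[symmetric]
      proof
        fix v assume v: "v \<in> F p \<inter> CW k"
        obtain a b c where abc: "a \<in> F (p + 1)" "a \<in> CW k" "cnj_vec b \<in> F (k - (p + 1) + 1)"
          "b \<in> CW k" "c \<in> CW (k - 1)" "v = a + b + c"
          using graded_split[of v k "p + 1"] v by auto
        have ap: "a \<in> F p" using abc(1) F_antimono[of p "p + 1"] by auto
        have va: "v - a \<in> F p" "v - a \<in> CW k" "v - a - b \<in> CW (k - 1)"
          using vec.subspace_diff[OF subspace_F _ ap, of v] vec.subspace_diff[OF subspace_CW _ abc(2), of v] v abc(5,6)
          by (auto simp: algebra_simps)
        obtain x where x: "x \<in> deligne W F p (k - p)" "v - a - x \<in> CW (k - 1)"
          using deligne_lift[of "v - a" p "k - p" b] va abc by auto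
        have "v - a - x \<in> F p" using x(1) deligne_subset[of p "k - p"] va by (auto intro: sub_rules)
        then have "v - a - x \<in> ?D p (k - 1)" using x(2) IH by blast
        then have "v - a - x \<in> ?D p k" using mono[of p p "k - 1" k] by auto
        moreover have "a \<in> ?D p k" using IH' abc(1,2) mono[of p "p + 1" k k] by auto
        moreover have "x \<in> ?D p k"
          by (rule vec.span_base, rule UN_I[of "(p, k - p)"]) (use x(1) in simp_all)
        ultimately have "(v - a - x) + a + x \<in> ?D p k" by (intro vec.span_add)
        then show "v \<in> ?D p k" by simp
      qed
    qed
    then have low: "F p \<inter> CW k \<subseteq> ?D p k" if "p \<le> p0" for p
    proof -
      obtain j where "p0 = p + int j" using \<open>p \<le> p0\<close> zle_iff_zadd by blast
      then show ?thesis using \<open>\<And>j. F (p0 - int j) \<inter> CW k \<subseteq> ?D (p0 - int j) k\<close>[of j] by simp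
    qed
    show ?case
    proof (cases "p \<le> p0")
      case True then show ?thesis using low by (simp add: k_def)
    next
      case False
      then show ?thesis using F_antimono[of p0 p] p0 by (auto simp: vec.span_zero)
    qed
  qed
  show ?thesis
  proof (cases "k < k0")
    case True
    then show ?thesis using CW_mono[of k k0] k0 by (auto simp: vec.span_zero)
  next
    case False
    then obtain n where "k = k0 + int n" using zle_iff_zadd[of k0 k] by auto
    then show ?thesis using up[of p n] by simp
  qed
qed

lemma span_deligne: "vec.span (\<Union>(r, s)\<in>UNIV. deligne W F r s) = UNIV"
proof -
  obtain p k where "F p = UNIV" "W k = UNIV" using F_ends(1) W_ends(2) by blast
  then have "UNIV \<subseteq> vec.span (\<Union>(r, s)\<in>{(r, s). p \<le> r \<and> r + s \<le> k}. deligne W F r s)"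
    using filtered_pieces_span[of p k] by (simp add: complexify_space_UNIV)
  also have "\<dots> \<subseteq> vec.span (\<Union>(r, s)\<in>UNIV. deligne W F r s)"
    by (intro vec.span_mono UN_mono) auto
  finally show ?thesis by blast
qed

text \<open>
  In every graded piece of weight below \<open>p + q\<close> the steps \<open>F\<^sup>p\<close> and conjugate \<open>F\<^sup>q\<close> meet in zero, so the weight of
  \<open>x\<close> can be lowered indefinitely.
\<close>

lemma real_type_zero:
  assumes x: "x \<in> F p" "cnj_vec x \<in> F q" "x \<in> CW l" and l: "l < p + q"
  shows "x = 0"
proof -
  have "x \<in> CW (l - int n)" for n
  proof (induction n)
    case (Suc n)
    have "cnj_vec x \<in> F (l - int n - p + 1)"
      using x(2) F_antimono[of "l - int n - p + 1" q] l by auto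
    then have "x + 0 \<in> CW (l - int n - 1)"
      by (intro graded_disjoint[where p = p and b = x and c' = 0] x Suc sub_rules) simp_all
    then show ?case by (simp add: algebra_simps)
  qed (use x in simp)
  moreover obtain k where k: "CW k = {0}" using W_ends(1) complexify_space_0 by metis
  ultimately have "x \<in> CW (l - int (nat (l - k)))" by blast
  moreover have "CW (l - int (nat (l - k))) \<subseteq> CW k" by (rule CW_mono) simp
  ultimately show ?thesis unfolding k by blast
qed

end

locale split_mhs = mhs W F for W :: "int \<Rightarrow> (real ^ 'n::finite) set" and F +
  assumes split: "cnj_vec ` deligne W F p q = deligne W F q p"
begin

abbreviation "I p q \<equiv> deligne W F p q"

lemma deligne_cnj: "cnj_vec x \<in> I p q \<longleftrightarrow> x \<in> I q p"
  by (metis in_cnj_image split)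

lemma deligne_type: assumes "x \<in> I p q" shows "x \<in> F p" "cnj_vec x \<in> F q" "x \<in> CW (p + q)"
  using assms deligne_cnj[of x q p] deligne_subset[of p q] deligne_subset[of q p] by auto

lemma deligne_bound: "\<exists>K. \<forall>p q. I p q \<noteq> {0} \<longrightarrow> \<bar>p\<bar> \<le> K \<and> \<bar>q\<bar> \<le> K"
proof -
  obtain k where k: "CW k = {0}" using W_ends(1) complexify_space_0 by metis
  obtain m where m: "F m = {0}" using F_ends(2) by blast
  have "\<bar>p\<bar> \<le> 2 * \<bar>m\<bar> + \<bar>k\<bar> \<and> \<bar>q\<bar> \<le> 2 * \<bar>m\<bar> + \<bar>k\<bar>" if ne: "I p q \<noteq> {0}" for p q
  proof -
    obtain x where x: "x \<in> I p q" "x \<noteq> 0" using ne vec.subspace_0[OF subspace_deligne[of p q]] by blast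
    have mF: "y = 0" if "y \<in> F r" "m \<le> r" for y r
      using F_antimono[OF that(2)] that(1) unfolding m by blast
    have "p < m" using mF[OF deligne_type(1)[OF x(1)]] x(2) by force
    moreover have "q < m" using mF[OF deligne_type(2)[OF x(1)]] x(2) by force
    moreover have "k < p + q"
    proof (rule ccontr)
      assume "\<not> k < p + q"
      then have "CW (p + q) \<subseteq> CW k" by (intro CW_mono) simp
      then show False using deligne_type(3)[OF x(1)] x(2) unfolding k by blast
    qed
    ultimately show ?thesis by linarith
  qed
  then show ?thesis by blast
qed

text \<open>
  Take a nonzero summand of maximal weight \<open>k\<close> and, among these, of maximal first index \<open>p\<close>. Modulo lower weight it
  equals a sum of vectors in the conjugate of \<open>F\<^bsup>k-p+1\<^esup>\<close>, which is opposed to \<open>F\<^sup>p\<close>. So it has lower weight and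
  vanishes by \<open>real_type_zero\<close>.
\<close>

lemma deligne_independent:
  assumes fin: "finite J" and x: "\<And>i. i \<in> J \<Longrightarrow> x i \<in> I (fst i) (snd i)" and sum: "(\<Sum>i\<in>J. x i) = 0"
  shows "\<forall>i\<in>J. x i = 0"
proof (rule ccontr)
  assume neq: "\<not> (\<forall>i\<in>J. x i = 0)"
  define Z where "Z = {i \<in> J. x i \<noteq> 0}"
  have Z: "finite Z" "Z \<noteq> {}" using fin neq by (auto simp: Z_def)
  have "(\<Sum>i\<in>Z. x i) = (\<Sum>i\<in>J. x i)"
    by (rule sum.mono_neutral_left[OF fin]) (auto simp: Z_def)
  then have sumZ: "(\<Sum>i\<in>Z. x i) = 0" unfolding sum .
  define k where "k = Max ((\<lambda>i. fst i + snd i) ` Z)"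
  have k: "fst i + snd i \<le> k" if "i \<in> Z" for i unfolding k_def using Z that by (intro Max_ge) auto
  define Y where "Y = {i \<in> Z. fst i + snd i = k}"
  have "k \<in> (\<lambda>i. fst i + snd i) ` Z" unfolding k_def using Z by (intro Max_in) auto
  then obtain i0 where "i0 \<in> Y" unfolding Y_def by blast
  then have Y: "finite Y" "Y \<noteq> {}" using Z(1) unfolding Y_def by (simp, blast)
  define p where "p = Max (fst ` Y)"
  have "p \<in> fst ` Y" unfolding p_def using Y by (intro Max_in) auto
  then have jY: "(p, k - p) \<in> Y" by (auto simp: Y_def)
  have p: "fst i < p" if "i \<in> Y" "i \<noteq> (p, k - p)" for i
  proof -
    have "fst i \<le> p" unfolding p_def using Y that by (intro Max_ge) auto
    moreover have "fst i \<noteq> p" using that by (cases i) (auto simp: Y_def)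
    ultimately show ?thesis by simp
  qed
  let ?j = "(p, k - p)"
  define low where "low = (\<Sum>i\<in>Z - Y. x i)"
  define rest where "rest = (\<Sum>i\<in>Y - {?j}. x i)"
  have "0 = low + (x ?j + rest)"
    using sumZ sum.subset_diff[of Y Z x] Z(1) Y(1) sum.remove[OF Y(1) jY, of x]
    by (simp add: low_def rest_def Y_def)
  then have eq: "x ?j + low = - rest + 0" by (simp add: algebra_simps eq_neg_iff_add_eq_0)
  have xj: "x ?j \<in> I p (k - p)" "x ?j \<noteq> 0" using x[of ?j] jY by (auto simp: Y_def Z_def)
  have low: "low \<in> CW (k - 1)"
    unfolding low_def
  proof (rule vec.subspace_sum[OF subspace_CW])
    fix i assume i: "i \<in> Z - Y"
    then have "fst i + snd i \<le> k - 1" using k[of i] by (auto simp: Y_def)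
    from CW_mono[OF this] show "x i \<in> CW (k - 1)" using deligne_type(3)[OF x[of i]] i by (auto simp: Z_def)
  qed
  have inY: "x i \<in> I (fst i) (snd i)" "fst i + snd i = k" if "i \<in> Y" for i
    using that x by (auto simp: Y_def Z_def)
  have r1: "cnj_vec rest \<in> F (k - p + 1)"
    unfolding rest_def cnj_vec_sum
  proof (rule vec.subspace_sum[OF subspace_F])
    fix i assume i: "i \<in> Y - {?j}"
    then have "k - p + 1 \<le> snd i" using p[of i] inY(2)[of i] by auto
    from F_antimono[OF this] show "cnj_vec (x i) \<in> F (k - p + 1)" using deligne_type(2)[OF inY(1)[of i]] i by auto
  qed
  have r2: "rest \<in> CW k"
    unfolding rest_def
  proof (rule vec.subspace_sum[OF subspace_CW])
    fix i assume i: "i \<in> Y - {?j}"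
    then show "x i \<in> CW k" using deligne_type(3)[OF inY(1)[of i]] inY(2)[of i] by simp
  qed
  have "x ?j + low \<in> CW (k - 1)"
  proof (rule graded_disjoint[OF _ _ low _ _ _ eq])
    show "x ?j \<in> F p" "x ?j \<in> CW k" using deligne_type[OF xj(1)] by simp_all
    show "cnj_vec (- rest) \<in> F (k - p + 1)" using vec.subspace_neg[OF subspace_F r1] by simp
    show "- rest \<in> CW k" by (rule vec.subspace_neg[OF subspace_CW r2])
    show "0 \<in> CW (k - 1)" by (rule vec.subspace_0[OF subspace_CW])
  qed
  from vec.subspace_diff[OF subspace_CW this low] have "x ?j \<in> CW (k - 1)" by simp
  then have "x ?j = 0" by (rule real_type_zero[OF deligne_type(1,2)[OF xj(1)]]) simp
  then show False using xj(2) by simp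
qed

end

context split_mhs
begin

definition is_projections :: "(int \<Rightarrow> int \<Rightarrow> 'n cmat) \<Rightarrow> (int \<times> int) set \<Rightarrow> bool" where
  "is_projections E J \<longleftrightarrow> finite J \<and> (\<Sum>(p, q)\<in>J. E p q) = 1 \<and>
     (\<forall>p q v. ap (E p q) v \<in> I p q) \<and> (\<forall>p q. \<forall>v\<in>I p q. ap (E p q) v = v) \<and>
     (\<forall>p q r s. \<forall>v\<in>I p q. (r, s) \<noteq> (p, q) \<longrightarrow> ap (E r s) v = 0) \<and>
     (\<forall>p q. (p, q) \<notin> J \<longrightarrow> E p q = 0)"

lemma projections_exist: "\<exists>E J. is_projections E J"
proof -
  obtain K where K: "\<And>p q. I p q \<noteq> {0} \<Longrightarrow> \<bar>p\<bar> \<le> K \<and> \<bar>q\<bar> \<le> K" using deligne_bound by blast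
  define J where "J = {- K..K} \<times> {- K..K}"
  have out: "I p q = {0}" if "(p, q) \<notin> J" for p q
  proof (rule ccontr)
    assume "I p q \<noteq> {0}"
    from K[OF this] show False using that by (simp add: J_def abs_le_iff)
  qed
  have fin: "finite J" by (simp add: J_def)
  let ?S = "\<lambda>i. I (fst i) (snd i)"
  have sub: "vec.subspace (?S i)" if "i \<in> J" for i by (rule subspace_deligne)
  have indep: "\<forall>i\<in>J. x i = 0" if "\<And>i. i \<in> J \<Longrightarrow> x i \<in> ?S i" "(\<Sum>i\<in>J. x i) = 0" for x
    by (rule deligne_independent[OF fin that])
  have cover: "\<exists>x. (\<forall>i\<in>J. x i \<in> ?S i) \<and> v = (\<Sum>i\<in>J. x i)" for v
  proof -
    define T where "T = {v. \<exists>x. (\<forall>i\<in>J. x i \<in> ?S i) \<and> v = (\<Sum>i\<in>J. x i)}"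
    have "vec.subspace T"
      unfolding vec.subspace_def
    proof (intro conjI ballI allI)
      show "0 \<in> T" unfolding T_def by (auto intro!: exI[of _ "\<lambda>_. 0"] vec.subspace_0 subspace_deligne)
      fix u v c assume "u \<in> T"
      then obtain x where x: "\<forall>i\<in>J. x i \<in> ?S i" "u = (\<Sum>i\<in>J. x i)" by (auto simp: T_def)
      show "c *s u \<in> T" unfolding T_def using x
        by (auto intro!: exI[of _ "\<lambda>i. c *s x i"] vec.subspace_scale subspace_deligne simp: vec.scale_sum_right)
      assume "v \<in> T"
      then obtain y where y: "\<forall>i\<in>J. y i \<in> ?S i" "v = (\<Sum>i\<in>J. y i)" by (auto simp: T_def)
      show "u + v \<in> T" unfolding T_def using x y
        by (auto intro!: exI[of _ "\<lambda>i. x i + y i"] vec.subspace_add subspace_deligne simp: sum.distrib)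
    qed
    moreover have "(\<Union>(r, s)\<in>UNIV. I r s) \<subseteq> T"
    proof (clarify)
      fix r s v assume v: "v \<in> I r s"
      show "v \<in> T"
      proof (cases "(r, s) \<in> J")
        case True
        then show ?thesis unfolding T_def using v fin
          by (intro CollectI exI[of _ "\<lambda>i. if i = (r, s) then v else 0"])
             (auto simp: vec.subspace_0 subspace_deligne)
      next
        case False
        then show ?thesis using v out \<open>vec.subspace T\<close> by (auto simp: vec.subspace_0)
      qed
    qed
    ultimately have "vec.span (\<Union>(r, s)\<in>UNIV. I r s) \<subseteq> T" by (intro vec.span_minimal)
    then have "v \<in> T" unfolding span_deligne by blast
    then show "\<exists>x. (\<forall>i\<in>J. x i \<in> ?S i) \<and> v = (\<Sum>i\<in>J. x i)" by (simp add: T_def)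
  qed
  show ?thesis
  proof (rule direct_sum_projections[OF fin sub cover indep])
    fix e :: "int \<times> int \<Rightarrow> 'n cmat"
    assume e: "\<And>i v. i \<in> J \<Longrightarrow> ap (e i) v \<in> ?S i" "(\<Sum>i\<in>J. e i) = 1"
    "\<And>i v. i \<in> J \<Longrightarrow> v \<in> ?S i \<Longrightarrow> ap (e i) v = v"
    "\<And>i j v. i \<in> J \<Longrightarrow> j \<in> J \<Longrightarrow> i \<noteq> j \<Longrightarrow> v \<in> ?S i \<Longrightarrow> ap (e j) v = 0"
    "\<And>i. i \<notin> J \<Longrightarrow> e i = 0"
  have "is_projections (\<lambda>p q. e (p, q)) J"
    unfolding is_projections_def
  proof (intro conjI allI ballI impI)
    fix p q r s v
    show "finite J" by (rule fin)
    show "(\<Sum>(p, q)\<in>J. e (p, q)) = 1" using e(2) by simp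
    show "ap (e (p, q)) v \<in> I p q"
      using e(1)[of "(p, q)"] e(5)[of "(p, q)"] vec.subspace_0[OF subspace_deligne] by (cases "(p, q) \<in> J") auto
    show "(p, q) \<notin> J \<Longrightarrow> e (p, q) = 0" by (rule e(5))
    assume v: "v \<in> I p q"
    show "ap (e (p, q)) v = v" using e(3)[of "(p, q)" v] out[of p q] v by (cases "(p, q) \<in> J") auto
    assume "(r, s) \<noteq> (p, q)"
    then show "ap (e (r, s)) v = 0"
      using e(4)[of "(p, q)" "(r, s)" v] e(5)[of "(r, s)"] out[of p q] v
      by (cases "(p, q) \<in> J"; cases "(r, s) \<in> J") auto
  qed
  then show "\<exists>E J. is_projections E J" by blast
  qed
qed

definition "Idx = (SOME J. \<exists>E. is_projections E J)"
definition "E = (SOME E. is_projections E Idx)"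

lemma projections: "is_projections E Idx"
proof -
  have "\<exists>E. is_projections E Idx" unfolding Idx_def
    by (rule someI_ex[of "\<lambda>J. \<exists>E. is_projections E J"]) (use projections_exist in blast)
  then show ?thesis unfolding E_def by (rule someI_ex)
qed

lemma finite_Idx: "finite Idx" and sum_E: "(\<Sum>(p, q)\<in>Idx. E p q) = 1"
  and E_in: "ap (E p q) v \<in> I p q" and E_id: "v \<in> I p q \<Longrightarrow> ap (E p q) v = v"
  and E_other: "v \<in> I p q \<Longrightarrow> (r, s) \<noteq> (p, q) \<Longrightarrow> ap (E r s) v = 0"
  and E_out: "(p, q) \<notin> Idx \<Longrightarrow> E p q = 0"
  using projections unfolding is_projections_def by blast+

lemma E_mult: "E p q * E r s = (if p = r \<and> q = s then E p q else 0)"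
  by (rule sqmat_eqI) (auto simp: E_id[OF E_in] E_other[OF E_in])

lemma sum_ap_E: "(\<Sum>(p, q)\<in>Idx. ap (E p q) v) = v"
  using arg_cong[OF sum_E, of "\<lambda>A. ap A v"] by (simp add: ap_sum case_prod_unfold)

lemma E_extR: assumes "\<And>r s. A * E r s = B * E r s" shows "A = B"
proof -
  have "A * (\<Sum>(p, q)\<in>Idx. E p q) = B * (\<Sum>(p, q)\<in>Idx. E p q)"
    using assms by (simp add: sum_distrib_left case_prod_unfold)
  then show ?thesis by (simp add: sum_E)
qed

lemma E_extL: assumes "\<And>r s. E r s * A = E r s * B" shows "A = B"
proof -
  have "(\<Sum>(p, q)\<in>Idx. E p q) * A = (\<Sum>(p, q)\<in>Idx. E p q) * B"
    using assms by (simp add: sum_distrib_right case_prod_unfold)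
  then show ?thesis by (simp add: sum_E)
qed

lemma kernel_E_subspace: "vec.subspace {v. ap A v = 0}"
  by (auto simp: vec.subspace_def)

text \<open>
  The filtration is a sum of pieces of the bigrading.
\<close>

lemma F_iff: "v \<in> F p \<longleftrightarrow> (\<forall>r s. r < p \<longrightarrow> ap (E r s) v = 0)"
proof
  assume v: "v \<in> F p"
  obtain k where k: "W k = UNIV" using W_ends(2) by blast
  show "\<forall>r s. r < p \<longrightarrow> ap (E r s) v = 0"
  proof (intro allI impI)
    fix r s assume "r < p"
    then have "vec.span (\<Union>(r, s)\<in>{(r, s). p \<le> r \<and> r + s \<le> k}. I r s) \<subseteq> {v. ap (E r s) v = 0}"
      by (intro vec.span_minimal kernel_E_subspace) (auto intro: E_other)
    then show "ap (E r s) v = 0" using filtered_pieces_span[of p k] v by (auto simp: k complexify_space_UNIV)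
  qed
next
  assume 0: "\<forall>r s. r < p \<longrightarrow> ap (E r s) v = 0"
  have "(\<Sum>(r, s)\<in>Idx. ap (E r s) v) \<in> F p"
  proof (rule vec.subspace_sum[OF subspace_F], clarify)
    fix r s
    show "ap (E r s) v \<in> F p"
    proof (cases "r < p")
      case False
      then show ?thesis using deligne_type(1)[OF E_in] F_antimono[of p r] by auto
    qed (use 0 vec.subspace_0[OF subspace_F] in auto)
  qed
  then show "v \<in> F p" by (simp add: sum_ap_E)
qed

lemma E_CW: assumes v: "v \<in> CW k" and rs: "r + s > k" shows "ap (E r s) v = 0"
proof -
  obtain p where p: "F p = UNIV" using F_ends(1) by blast
  have "vec.span (\<Union>(r, s)\<in>{(r, s). p \<le> r \<and> r + s \<le> k}. I r s) \<subseteq> {v. ap (E r s) v = 0}"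
    using rs by (intro vec.span_minimal kernel_E_subspace) (auto intro: E_other)
  then show ?thesis using filtered_pieces_span[of p k] v by (auto simp: p)
qed

lemma cj_E: "cj (E p q) = E q p"
proof (rule E_extR, rule sqmat_eqI)
  fix r s v
  have x: "cnj_vec (ap (E r s) v) \<in> I s r" using E_in by (simp add: deligne_cnj)
  show "ap (cj (E p q) * E r s) v = ap (E q p * E r s) v"
    using E_id[OF x] E_other[OF x] E_id[OF E_in] E_other[OF E_in]
    by (cases "(p, q) = (s, r)") (auto simp: ap_cj)
qed

text \<open>
  For a mixed Hodge structure that splits over the reals the bigrading has no correction terms.
\<close>

lemma deligne_iff: "v \<in> I p q \<longleftrightarrow> v \<in> F p \<and> cnj_vec v \<in> F q \<and> v \<in> CW (p + q)"
proof (intro iffI conjI)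
  assume v: "v \<in> F p \<and> cnj_vec v \<in> F q \<and> v \<in> CW (p + q)"
  have "ap (E r s) v = (if (r, s) = (p, q) then ap (E p q) v else 0)" for r s
  proof -
    have "ap (E s r) (cnj_vec v) = cnj_vec (ap (E r s) v)" by (simp add: cnj_vec_ap cj_E)
    then have "s < q \<Longrightarrow> ap (E r s) v = 0" using v F_iff[of "cnj_vec v" q] by auto
    moreover have "r < p \<Longrightarrow> ap (E r s) v = 0" using v F_iff[of v p] by auto
    moreover have "p + q < r + s \<Longrightarrow> ap (E r s) v = 0" using v E_CW by auto
    moreover have "(r, s) = (p, q) \<or> r < p \<or> s < q \<or> p + q < r + s" by auto
    ultimately show ?thesis by auto
  qed
  then have "v = (\<Sum>i\<in>Idx. if i = (p, q) then ap (E p q) v else 0)"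
    using sum_ap_E[of v] by (simp add: case_prod_unfold prod_eq_iff)
  also have "\<dots> \<in> I p q"
    by (rule vec.subspace_sum[OF subspace_deligne]) (auto intro: E_in vec.subspace_0[OF subspace_deligne])
  finally show "v \<in> I p q" .
qed (use deligne_type in auto)

section \<open>Endomorphisms by Hodge type\<close>

text \<open>
  Endomorphisms of Hodge type \<open>(a,b)\<close>.
\<close>

definition gl :: "int \<Rightarrow> int \<Rightarrow> 'n cmat set" where
  "gl a b = {X. \<forall>r s. X * E r s = E (r + a) (s + b) * X * E r s}"

lemma gl_iff: "X \<in> gl a b \<longleftrightarrow> (\<forall>r s. ap X ` I r s \<subseteq> I (r + a) (s + b))"
proof
  assume X: "X \<in> gl a b"
  show "\<forall>r s. ap X ` I r s \<subseteq> I (r + a) (s + b)"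
  proof clarify
    fix r s v assume v: "v \<in> I r s"
    have "ap X v = ap (X * E r s) v" using E_id[OF v] by simp
    also have "\<dots> = ap (E (r + a) (s + b) * X * E r s) v" using X by (simp add: gl_def)
    finally show "ap X v \<in> I (r + a) (s + b)" using E_in by simp
  qed
next
  assume X: "\<forall>r s. ap X ` I r s \<subseteq> I (r + a) (s + b)"
  show "X \<in> gl a b"
    unfolding gl_def
  proof (intro CollectI allI sqmat_eqI)
    fix r s v
    have "ap X (ap (E r s) v) \<in> I (r + a) (s + b)" using X E_in[of r s v] by blast
    then show "ap (X * E r s) v = ap (E (r + a) (s + b) * X * E r s) v" by (simp add: E_id)
  qed
qed

lemma gl_commute: assumes "X \<in> gl a b" shows "X * E r s = E (r + a) (s + b) * X"
proof (rule E_extR)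
  fix t u
  have X: "X * E t u = E (t + a) (u + b) * X * E t u" for t u using assms by (simp add: gl_def)
  have "X * E r s * E t u = (if (r, s) = (t, u) then X * E t u else 0)" by (auto simp: mult.assoc E_mult)
  moreover have "E (r + a) (s + b) * X * E t u = E (r + a) (s + b) * (E (t + a) (u + b) * X * E t u)"
    unfolding mult.assoc[of "E (r + a) (s + b)" X "E t u"] by (rule arg_cong[OF X])
  moreover have "\<dots> = (if (r, s) = (t, u) then X * E t u else 0)"
    using X[of t u] by (auto simp: E_mult mult.assoc[symmetric])
  ultimately show "X * E r s * E t u = E (r + a) (s + b) * X * E t u" by simp
qed

lemma gl_I: "(\<And>r s. X * E r s = E (r + a) (s + b) * X) \<Longrightarrow> X \<in> gl a b"
  by (simp add: gl_def mult.assoc E_mult) (metis E_mult mult.assoc)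

definition type_part :: "int \<Rightarrow> int \<Rightarrow> 'n cmat \<Rightarrow> 'n cmat" where
  "type_part a b X = (\<Sum>(r, s)\<in>Idx. E (r + a) (s + b) * X * E r s)"

lemma type_part_E: "type_part a b X * E r s = E (r + a) (s + b) * X * E r s"
proof -
  have "type_part a b X * E r s = (\<Sum>i\<in>Idx. if i = (r, s) then E (r + a) (s + b) * X * E r s else 0)"
    unfolding type_part_def sum_distrib_right case_prod_unfold
    by (rule sum.cong) (auto simp: mult.assoc E_mult)
  also have "\<dots> = E (r + a) (s + b) * X * E r s"
    using E_out[of r s] by (simp add: finite_Idx)
  finally show ?thesis .
qed

lemma E_type_part: "E t u * type_part a b X = E t u * X * E (t - a) (u - b)"
proof (rule E_extR)
  fix r s
  have "E t u * type_part a b X * E r s = E t u * (E (r + a) (s + b) * X * E r s)" by (simp add: mult.assoc type_part_E)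
  also have "\<dots> = (if t = r + a \<and> u = s + b then E t u * X * E r s else 0)"
    by (auto simp: E_mult mult.assoc[symmetric])
  also have "\<dots> = E t u * X * E (t - a) (u - b) * E r s"
    by (auto simp: E_mult mult.assoc)
  finally show "E t u * type_part a b X * E r s = E t u * X * E (t - a) (u - b) * E r s" .
qed

lemma type_part_gl: "type_part a b X \<in> gl a b"
  by (simp add: gl_def mult.assoc type_part_E) (simp add: mult.assoc[symmetric] E_mult)

lemma type_part_id: "X \<in> gl a b \<Longrightarrow> type_part a b X = X"
  by (rule E_extR) (simp add: type_part_E gl_def)

lemma gl_ap: "X \<in> gl a b \<Longrightarrow> v \<in> I r s \<Longrightarrow> ap X v \<in> I (r + a) (s + b)"
  unfolding gl_iff by blast

lemma gl_mult: assumes X: "X \<in> gl a b" and Y: "Y \<in> gl c d" shows "X * Y \<in> gl (a + c) (b + d)"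
  unfolding gl_iff
proof clarify
  fix r s v assume "v \<in> I r s"
  from gl_ap[OF X gl_ap[OF Y this]] show "ap (X * Y) v \<in> I (r + (a + c)) (s + (b + d))"
    by (simp add: add_ac)
qed

lemma gl_diff: "X \<in> gl a b \<Longrightarrow> Y \<in> gl a b \<Longrightarrow> X - Y \<in> gl a b"
  unfolding gl_iff by (simp add: image_subset_iff vec.subspace_diff[OF subspace_deligne])

lemma cj_type_part: "cj (type_part a b X) = type_part b a (cj X)"
proof (rule E_extR)
  fix r s
  have "cj (type_part a b X) * E r s = cj (type_part a b X * E s r)" by (simp only: cj_simps cj_E)
  also have "\<dots> = cj (E (s + a) (r + b) * X * E s r)" by (simp only: type_part_E)
  also have "\<dots> = type_part b a (cj X) * E r s" by (simp only: cj_simps cj_E type_part_E)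
  finally show "cj (type_part a b X) * E r s = type_part b a (cj X) * E r s" .
qed

text \<open>
  The trace form pairs type \<open>(a,b)\<close> with type \<open>(-a,-b)\<close>.
\<close>

lemma tr_type_part: "tr (type_part a b X * Y) = tr (X * type_part (- a) (- b) Y)"
proof -
  have "tr (type_part a b X * Y) = (\<Sum>(r, s)\<in>Idx. tr (type_part a b X * (E r s * Y)))"
    by (simp flip: tr_sum sum_distrib_left sum_distrib_right add: case_prod_unfold sum_E[unfolded case_prod_unfold])
  also have "\<dots> = (\<Sum>(r, s)\<in>Idx. tr (X * (E r s * type_part (- a) (- b) Y)))"
  proof (rule sum.cong[OF refl], clarify)
    fix r s
    have "tr (type_part a b X * (E r s * Y)) = tr (E (r + a) (s + b) * (X * E r s * Y))"
      by (simp add: mult.assoc[symmetric] type_part_E)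
    also have "\<dots> = tr (X * E r s * Y * E (r + a) (s + b))" by (rule tr_commute)
    also have "\<dots> = tr (X * (E r s * type_part (- a) (- b) Y))" by (simp add: E_type_part mult.assoc)
    finally show "tr (type_part a b X * (E r s * Y)) = tr (X * (E r s * type_part (- a) (- b) Y))" .
  qed
  also have "\<dots> = tr (X * type_part (- a) (- b) Y)"
    by (simp flip: tr_sum sum_distrib_left sum_distrib_right add: case_prod_unfold sum_E[unfolded case_prod_unfold])
  finally show ?thesis .
qed

end

section \<open>Adjoints and the bracket with an element of type (-1,-1)\<close>

definition transp :: "'n::finite cmat \<Rightarrow> 'n cmat" where "transp A = sqm (transpose (mat_of A))"

lemma ap_nth: "ap A v $ i = (\<Sum>j\<in>UNIV. mat_of A $ i $ j * v $ j)"
  by (simp add: ap_def matrix_vector_mult_def)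

lemma mat_of_transp: "mat_of (transp A) $ i $ j = mat_of A $ j $ i"
  by (simp add: transp_def transpose_def)

definition conj_transp :: "'n::finite cmat \<Rightarrow> 'n cmat" where "conj_transp A = cj (transp A)"

lemma Re_tr_conj_transp: "Re (tr (conj_transp A * B)) = mat_of A \<bullet> mat_of B"
proof -
  have "Re (tr (conj_transp A * B)) = (\<Sum>i\<in>UNIV. \<Sum>k\<in>UNIV. mat_of A $ k $ i \<bullet> mat_of B $ k $ i)"
    by (simp add: tr_def trace_def matrix_matrix_mult_def conj_transp_def cj_def transp_def transpose_def map_matrix_def inner_complex_def)
  also have "\<dots> = mat_of A \<bullet> mat_of B"
    unfolding inner_vec_def by (rule sum.swap)
  finally show ?thesis .
qed

context polform
begin

lemma QC_nondeg_left: "(\<And>v. QC u v = 0) \<Longrightarrow> u = 0"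
proof -
  assume u: "\<And>v. QC u v = 0"
  have "re_vec u = 0 \<and> im_vec u = 0"
  proof -
    have "Q (re_vec u) x = 0 \<and> Q (im_vec u) x = 0" for x
    proof -
      let ?v = "(\<chi> i. of_real (x $ i)) :: complex ^ 'n"
      have "re_vec ?v = x" "im_vec ?v = 0" by (simp_all add: re_vec_def im_vec_def vec_eq_iff)
      then show ?thesis using u[of ?v] by (simp add: complexify_form_def Q_simps complex_eq_iff)
    qed
    then show ?thesis using Q_nondeg by blast
  qed
  then show "u = 0" by (simp add: vec_eq_iff complex_eq_iff re_vec_def im_vec_def)
qed

lemma QC_nondeg_right: assumes "\<And>u. QC u v = 0" shows "v = 0"
  by (rule QC_nondeg_left) (simp add: QC_sym[of v] assms)

text \<open>
  If \<open>T\<close> is the Gram matrix of the form, the adjoint of \<open>X\<close> is \<open>T\<^sup>-\<^sup>1 X\<^sup>t T\<close>.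
\<close>

lemma adjoint_exists: "\<exists>Y. \<forall>u v. QC (ap X u) v = QC u (ap Y v)"
proof -
  obtain T where T: "\<And>v. ap T v = (\<chi> i. QC (axis i 1) v)"
    using linear_imp_ap[of "\<lambda>v. \<chi> i. QC (axis i 1) v"] by (auto simp: vec_eq_iff QC_add_right QC_scale_right)
  have QT: "QC u v = (\<Sum>i\<in>UNIV. u $ i * ap T v $ i)" for u v
  proof -
    have "u = (\<Sum>i\<in>UNIV. u $ i *s axis i 1)" by (simp add: basis_expansion)
    then have "QC u v = QC (\<Sum>i\<in>UNIV. u $ i *s axis i 1) v" by simp
    then show ?thesis by (simp add: QC_sum_left QC_scale_left T)
  qed
  have "v = 0" if "mat_of T *v v = 0" for v
    by (rule QC_nondeg_right) (use that in \<open>simp add: QT ap_def\<close>)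
  then obtain B where "B ** mat_of T = mat 1" using matrix_left_invertible_ker[of "mat_of T"] by blast
  then have "mat_of T ** B = mat 1" by (simp add: matrix_left_right_inverse)
  then have TB: "T * sqm B = 1" by (simp add: times_sqmat_def one_sqmat_def)
  have "QC (ap X u) v = QC u (ap (sqm B * transp X * T) v)" for u v
  proof -
    have "ap T (ap (sqm B * transp X * T) v) = ap (T * sqm B) (ap (transp X) (ap T v))" by simp
    then have h1: "ap T (ap (sqm B * transp X * T) v) = ap (transp X) (ap T v)" by (simp only: TB ap_simps)
    have "QC u (ap (sqm B * transp X * T) v) = (\<Sum>i\<in>UNIV. \<Sum>j\<in>UNIV. u $ i * (mat_of X $ j $ i * ap T v $ j))"
      by (simp only: QT h1) (simp add: ap_nth[of "transp X"] mat_of_transp sum_distrib_left)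
    also have "\<dots> = (\<Sum>j\<in>UNIV. \<Sum>i\<in>UNIV. u $ i * (mat_of X $ j $ i * ap T v $ j))" by (rule sum.swap)
    also have "\<dots> = QC (ap X u) v"
      by (simp only: QT) (simp add: ap_nth[of X] sum_distrib_left sum_distrib_right mult_ac)
    finally show ?thesis by simp
  qed
  then show ?thesis by blast
qed

definition "adj X = (SOME Y. \<forall>u v. QC (ap X u) v = QC u (ap Y v))"

lemma QC_adj: "QC (ap X u) v = QC u (ap (adj X) v)"
proof -
  have "\<forall>u v. QC (ap X u) v = QC u (ap (adj X) v)"
    unfolding adj_def by (rule someI_ex[OF adjoint_exists])
  then show ?thesis by blast
qed

lemma adj_unique: assumes "\<And>u v. QC (ap X u) v = QC u (ap Y v)" shows "adj X = Y"
proof (rule sqmat_eqI)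
  fix v
  have "ap (adj X) v - ap Y v = 0"
    by (rule QC_nondeg_right) (simp add: QC_diff assms flip: QC_adj)
  then show "ap (adj X) v = ap Y v" by simp
qed

lemma adj_simps: "adj (X + Y) = adj X + adj Y" "adj (X - Y) = adj X - adj Y" "adj (X * Y) = adj Y * adj X"
  "adj (r *\<^sub>R X) = r *\<^sub>R adj X"
  by (rule adj_unique, simp add: QC_add_left QC_add_right QC_diff QC_scaleR QC_adj)+

lemma adj_adj: "adj (adj X) = X"
proof (rule adj_unique)
  fix u v
  have "QC (ap (adj X) u) v = of_real ((-1) powi w) * QC v (ap (adj X) u)" by (rule QC_sym)
  also have "\<dots> = of_real ((-1) powi w) * QC (ap X v) u" by (simp only: QC_adj)
  also have "\<dots> = QC u (ap X v)" by (rule QC_sym[symmetric])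
  finally show "QC (ap (adj X) u) v = QC u (ap X v)" .
qed

lemma adj_cj: "adj (cj X) = cj (adj X)"
proof (rule adj_unique)
  fix u v
  have "QC (ap (cj X) u) v = cnj (QC (ap X (cnj_vec u)) (cnj_vec v))"
    by (simp add: ap_cj QC_cnj[symmetric])
  also have "\<dots> = QC u (ap (cj (adj X)) v)" by (simp add: QC_adj QC_cnj[symmetric] ap_cj)
  finally show "QC (ap (cj X) u) v = QC u (ap (cj (adj X)) v)" .
qed

lemma skew_iff_adj: "skew X \<longleftrightarrow> adj X = - X"
proof
  assume "skew X"
  then show "adj X = - X" by (intro adj_unique) (simp add: skew_def QC_minus)
qed (simp add: skew_def QC_adj QC_minus)

end

locale split_pol = polform Q w + split_mhs W F
  for Q :: "real ^ 'n::finite \<Rightarrow> real ^ 'n \<Rightarrow> real" and w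
    and W :: "int \<Rightarrow> (real ^ 'n) set" and F :: "int \<Rightarrow> (complex ^ 'n) set" +
  assumes first: "first_bilinear_relation Q w F"
    and weights_orthogonal: "\<And>k l u v. k + l < 2 * w \<Longrightarrow> u \<in> W k \<Longrightarrow> v \<in> W l \<Longrightarrow> Q u v = 0"
begin

lemma QC_weights: "k + l < 2 * w \<Longrightarrow> u \<in> CW k \<Longrightarrow> v \<in> CW l \<Longrightarrow> QC u v = 0"
  by (simp add: complexify_form_def complexify_space_def weights_orthogonal complex_eq_iff)

lemma QC_filtration: assumes "u \<in> F p" "v \<in> F r" "p + r > w" shows "QC u v = 0"
proof -
  have "v \<in> F (w - p + 1)" using assms(2,3) F_antimono[of "w - p + 1" r] by auto
  then show ?thesis using first assms(1) by (simp add: first_bilinear_relation_def)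
qed

text \<open>
  If \<open>(r,s) \<noteq> (w - p, w - q)\<close>, then \<open>p + r > w\<close>, or \<open>q + s > w\<close>, or the total weight is below \<open>2w\<close>. The pairing
  vanishes by the first bilinear relation, by its conjugate, or by the orthogonality of the weight filtration.
\<close>

lemma QC_deligne: assumes u: "u \<in> I p q" and v: "v \<in> I r s" and ne: "(r, s) \<noteq> (w - p, w - q)"
  shows "QC u v = 0"
proof -
  note u = deligne_type[OF u] and v = deligne_type[OF v]
  consider "p + r > w" | "q + s > w" | "(p + q) + (r + s) < 2 * w" using ne by force
  then show ?thesis
  proof cases
    case 2
    have "QC (cnj_vec u) (cnj_vec v) = 0" by (rule QC_filtration[OF u(2) v(2) 2])
    then show ?thesis by (simp add: QC_cnj)
  qed (use QC_filtration[OF u(1) v(1)] QC_weights[OF _ u(3) v(3)] in auto)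
qed

lemma QC_E: "QC (ap (E p q) u) v = QC u (ap (E (w - p) (w - q)) v)"
proof -
  have drop: "(\<Sum>i\<in>Idx. f i) = f j" if "\<And>i. i \<noteq> j \<Longrightarrow> f i = 0" "j \<notin> Idx \<Longrightarrow> f j = 0" for f :: "int \<times> int \<Rightarrow> complex" and j
  proof -
    have "(\<Sum>i\<in>Idx. f i) = (\<Sum>i\<in>Idx. if i = j then f j else 0)" by (rule sum.cong) (use that in auto)
    then show ?thesis using that(2) by (simp add: finite_Idx)
  qed
  have "QC (ap (E p q) u) v = QC (ap (E p q) u) (\<Sum>(r, s)\<in>Idx. ap (E r s) v)" by (simp only: sum_ap_E)
  also have "\<dots> = (\<Sum>i\<in>Idx. QC (ap (E p q) u) (ap (E (fst i) (snd i)) v))" by (simp add: QC_sum_right case_prod_unfold)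
  also have "\<dots> = QC (ap (E p q) u) (ap (E (w - p) (w - q)) v)"
    by (subst drop[of "(w - p, w - q)"]) (auto simp: QC_deligne[OF E_in E_in] prod_eq_iff E_out)
  also have "\<dots> = (\<Sum>i\<in>Idx. QC (ap (E (fst i) (snd i)) u) (ap (E (w - p) (w - q)) v))"
    by (subst drop[of "(p, q)"]) (auto simp: QC_deligne[OF E_in E_in] prod_eq_iff E_out)
  also have "\<dots> = QC (\<Sum>(r, s)\<in>Idx. ap (E r s) u) (ap (E (w - p) (w - q)) v)" by (simp add: QC_sum_left case_prod_unfold)
  also have "\<dots> = QC u (ap (E (w - p) (w - q)) v)" by (simp only: sum_ap_E)
  finally show ?thesis .
qed

lemma adj_E: "adj (E p q) = E (w - p) (w - q)"
  by (rule adj_unique) (rule QC_E)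

lemma adj_gl: assumes X: "X \<in> gl a b" shows "adj X \<in> gl a b"
proof (rule gl_I)
  fix r s
  have "adj (X * E (w - r - a) (w - s - b)) = adj (E (w - r) (w - s) * X)"
    using gl_commute[OF X, of "w - r - a" "w - s - b"] by simp
  then show "adj X * E r s = E (r + a) (s + b) * adj X" by (simp add: adj_simps adj_E algebra_simps)
qed

lemma cj_gl: "X \<in> gl a b \<Longrightarrow> cj X \<in> gl b a"
  using type_part_gl[of b a "cj X"] cj_type_part[of a b X] by (simp add: type_part_id)

lemma gl_F: assumes X: "X \<in> gl a b" and v: "v \<in> F p" shows "ap X v \<in> F (p + a)"
  unfolding F_iff
proof (intro allI impI)
  fix r s assume r: "r < p + a"
  have "E r s * X = X * E (r - a) (s - b)" using gl_commute[OF X, of "r - a" "s - b"] by simp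
  then have "ap (E r s) (ap X v) = ap X (ap (E (r - a) (s - b)) v)" by (metis ap_simps(1))
  also have "\<dots> = 0" using v r unfolding F_iff by simp
  finally show "ap (E r s) (ap X v) = 0" .
qed

lemma hodge_level: obtains L where "\<bar>w\<bar> \<le> L" "\<And>p. p > L \<Longrightarrow> F p = {0}"
proof -
  obtain m where m: "F m = {0}" using F_ends(2) by blast
  show thesis
  proof (rule that[of "max \<bar>w\<bar> m"])
    fix p assume "max \<bar>w\<bar> m < p"
    then have "F p \<subseteq> {0}" using F_antimono[of m p] m by simp
    then show "F p = {0}" using vec.subspace_0[OF subspace_F[of p]] by blast
  qed simp
qed

lemma flow_hodge_point:
  assumes "\<bar>w\<bar> \<le> L" "\<And>p. p > L \<Longrightarrow> F p = {0}" "pol_hodge (flow g F)"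
  shows "hodge_point Q w (flow g F) L"
  by unfold_locales (use assms in \<open>simp_all add: flow_def\<close>)

text \<open>
  Since \<open>X\<close> commutes with \<open>N\<close>, it shifts the filtration \<open>exp(iyN)F\<close> by \<open>a\<close> and its conjugate by \<open>b\<close>. A vector of
  type \<open>(c, w - c)\<close> is therefore sent into the intersection of step \<open>c + a\<close> and conjugate step \<open>w - c + b\<close>, which is
  zero because \<open>a + b \<ge> 1\<close>.
\<close>

lemma commuting_positive_zero:
  assumes N: "cj N = N" and pt: "pol_hodge (flow (imag_exp y N) F)"
    and X: "X \<in> gl a b" "a + b \<ge> 1" "X * N = N * X"
  shows "X = 0"
proof -
  obtain L where L: "\<bar>w\<bar> \<le> L" "\<And>p. p > L \<Longrightarrow> F p = {0}" using hodge_level by blast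
  let ?g = "imag_exp y N"
  interpret h: hodge_point Q w "flow ?g F" L by (rule flow_hodge_point[OF L pt])
  have com: "X * imag_exp t N = imag_exp t N * X" for t
  proof -
    have "X * (t *\<^sub>R (scal \<i> * N)) = t *\<^sub>R (scal \<i> * N) * X"
      by (simp add: scal_move X(3) mult.assoc)
    from exp_intertwine[OF this] show ?thesis by (simp add: imag_exp_def)
  qed
  have "X * h.e c = 0" for c
  proof (rule sqmat_eqI)
    fix v
    have "ap (h.e c) v \<in> flow ?g F c" "cnj_vec (ap (h.e c) v) \<in> flow ?g F (w - c)"
      using h.e_in[of c v] by (auto simp: hodge_component_def in_cnj_image)
    then obtain u u' where u: "u \<in> F c" "ap (h.e c) v = ap ?g u" and u': "u' \<in> F (w - c)" "cnj_vec (ap (h.e c) v) = ap ?g u'"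
      by (auto simp: flow_def)
    have "ap X (ap (h.e c) v) = ap ?g (ap X u)" using com[of y] u(2) by (metis ap_simps(1))
    then have 1: "ap X (ap (h.e c) v) \<in> flow ?g F (c + a)" using gl_F[OF X(1) u(1)] by (simp add: flow_def)
    have "cnj_vec (ap X (ap (h.e c) v)) = ap (cj X) (ap ?g u')" by (simp only: cnj_vec_ap[of X] u'(2))
    also have "\<dots> = ap ?g (ap (cj X) u')"
    proof -
      have "cj (X * imag_exp (- y) N) = cj (imag_exp (- y) N * X)" by (simp only: com)
      then have "cj X * ?g = ?g * cj X" by (simp add: cj_imag_exp[OF N])
      then show ?thesis by (metis ap_simps(1))
    qed
    finally have "cnj_vec (ap X (ap (h.e c) v)) \<in> flow ?g F (w - c + b)"
      using gl_F[OF cj_gl[OF X(1)] u'(1)] by (simp add: flow_def)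
    then have 2: "cnj_vec (ap X (ap (h.e c) v)) \<in> flow ?g F (w - (c + a) + 1)"
      using h.F_antimono[of "w - (c + a) + 1" "w - c + b"] X(2) by auto
    show "ap (X * h.e c) v = ap 0 v" using h.opposed_zero[OF 1] 2 by (simp add: in_cnj_image)
  qed
  then have "X * (\<Sum>c\<in>{w - L..L}. h.e c) = 0" by (simp add: sum_distrib_left)
  then show ?thesis by (simp add: h.sum_e)
qed

text \<open>
  Let \<open>Y\<close> be the part of \<open>T\<close> orthogonal to the image, and \<open>X\<close> the component of type \<open>(1,1)\<close> of its conjugate
  transpose. Then \<open>tr (X [Z,N]) = tr ([N,X] Z)\<close> has real part zero for all \<open>Z\<close> of type \<open>(0,0)\<close>, so \<open>[N,X] = 0\<close>,
  so \<open>X = 0\<close>, and \<open>\<parallel>Y\<parallel>\<^sup>2 = Re (tr (X Y)) = 0\<close>.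
\<close>

lemma bracket_surjective_gl:
  assumes N: "N \<in> gl (-1) (-1)" and inj: "\<And>X. X \<in> gl 1 1 \<Longrightarrow> X * N = N * X \<Longrightarrow> X = 0"
    and T: "T \<in> gl (-1) (-1)"
  shows "\<exists>Z\<in>gl 0 0. Z * N - N * Z = T"
proof -
  define S where "S = (\<lambda>Z. mat_of (Z * N - N * Z)) ` gl 0 0"
  have gl0: "0 \<in> gl a b" "X \<in> gl a b \<Longrightarrow> Y \<in> gl a b \<Longrightarrow> X + Y \<in> gl a b" "X \<in> gl a b \<Longrightarrow> c *\<^sub>R X \<in> gl a b"
    for a b X Y c
    by (simp_all add: gl_def distrib_left distrib_right)
  have subS: "subspace S"
    unfolding subspace_def
  proof (intro conjI ballI allI)
    show "0 \<in> S" unfolding S_def using gl0(1) by (intro image_eqI[of _ _ 0]) simp_all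
    fix x y c assume "x \<in> S"
    then obtain X where X: "X \<in> gl 0 0" "x = mat_of (X * N - N * X)" by (auto simp: S_def)
    show "c *\<^sub>R x \<in> S" unfolding S_def using gl0(3)[OF X(1), of c] X(2)
      by (intro image_eqI[of _ _ "c *\<^sub>R X"]) (simp_all add: scaleR_matrix_mult scaleR_diff_right)
    assume "y \<in> S"
    then obtain Y where Y: "Y \<in> gl 0 0" "y = mat_of (Y * N - N * Y)" by (auto simp: S_def)
    have "(X + Y) * N - N * (X + Y) = (X * N - N * X) + (Y * N - N * Y)" by (simp add: algebra_simps)
    then show "x + y \<in> S" unfolding S_def using gl0(2)[OF X(1) Y(1)] X(2) Y(2)
      by (intro image_eqI[of _ _ "X + Y"]) (metis mat_of_simps(3))+
  qed
  obtain y z where yz: "y \<in> span S" "\<And>x. x \<in> span S \<Longrightarrow> orthogonal z x" "mat_of T = y + z"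
    using orthogonal_subspace_decomp_exists[of S "mat_of T"] by blast
  have spanS: "span S = S" using subS by simp
  have yS: "y \<in> S" using yz(1) unfolding spanS .
  obtain Z where Z: "y = mat_of (Z * N - N * Z)" "Z \<in> gl 0 0"
    using yS unfolding S_def by (rule imageE)
  define Y where "Y = T - (Z * N - N * Z)"
  have zY: "z = mat_of Y" using yz(3) Z(1) by (simp add: Y_def)
  have brN: "Z * N - N * Z \<in> gl (-1) (-1)" if "Z \<in> gl 0 0" for Z
    using gl_mult[OF that N] gl_mult[OF N that] by (simp add: gl_diff)
  have Ygl: "Y \<in> gl (-1) (-1)" unfolding Y_def by (intro gl_diff T brN Z(2))
  have orth: "Re (tr (conj_transp Y * (Z * N - N * Z))) = 0" if "Z \<in> gl 0 0" for Z
  proof -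
    have "mat_of (Z * N - N * Z) \<in> span S" unfolding spanS unfolding S_def using that by (rule imageI)
    then show ?thesis using yz(2) by (simp add: Re_tr_conj_transp zY orthogonal_def del: mat_of_simps)
  qed
  define X where "X = type_part 1 1 (conj_transp Y)"
  have Xgl: "X \<in> gl 1 1" unfolding X_def by (rule type_part_gl)
  have Xtr: "tr (X * A) = tr (conj_transp Y * A)" if "A \<in> gl (-1) (-1)" for A
    by (simp add: X_def tr_type_part type_part_id[OF that])
  define U where "U = N * X - X * N"
  have Ugl: "U \<in> gl 0 0" using gl_mult[OF N Xgl] gl_mult[OF Xgl N] by (simp add: U_def gl_diff)
  have U0: "Re (tr (U * A)) = 0" for A
  proof -
    have "tr (U * A) = tr (U * type_part 0 0 A)"
      using tr_type_part[of 0 0 U A] by (simp add: type_part_id[OF Ugl])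
    also have "\<dots> = tr (N * (X * type_part 0 0 A)) - tr (X * N * type_part 0 0 A)"
      by (simp add: U_def left_diff_distrib mult.assoc)
    also have "tr (N * (X * type_part 0 0 A)) = tr (X * type_part 0 0 A * N)" by (rule tr_commute)
    also have "tr (X * type_part 0 0 A * N) - tr (X * N * type_part 0 0 A) = tr (X * (type_part 0 0 A * N - N * type_part 0 0 A))"
      by (simp add: right_diff_distrib mult.assoc)
    also have "\<dots> = tr (conj_transp Y * (type_part 0 0 A * N - N * type_part 0 0 A))" by (rule Xtr[OF brN[OF type_part_gl]])
    finally show ?thesis using orth[OF type_part_gl] by simp
  qed
  have "mat_of U \<bullet> mat_of U = 0" using U0[of "conj_transp U"] Re_tr_conj_transp[of U U] by (simp add: tr_commute[of U])
  then have "U = 0" by (metis inner_eq_zero_iff mat_of_inject mat_of_simps(1))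
  then have "X = 0" by (intro inj[OF Xgl]) (simp add: U_def)
  then have "mat_of Y \<bullet> mat_of Y = 0" using Xtr[OF Ygl] Re_tr_conj_transp[of Y Y] by simp
  then have "Y = 0" by (metis inner_eq_zero_iff mat_of_inject mat_of_simps(1))
  then show ?thesis using Z(2) by (intro bexI[of _ Z]) (simp_all add: Y_def)
qed

text \<open>
  A preimage \<open>Z\<close> is averaged with its conjugate and with \<open>- adj Z\<close>. Both averages have the same bracket with \<open>N\<close>,
  because \<open>N\<close> and \<open>T\<close> are real and skew.
\<close>

lemma bracket_surjective:
  assumes N: "N \<in> gl (-1) (-1)" "cj N = N" "skew N" and inj: "\<And>X. X \<in> gl 1 1 \<Longrightarrow> X * N = N * X \<Longrightarrow> X = 0"
    and T: "T \<in> gl (-1) (-1)" "cj T = T" "skew T"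
  shows "\<exists>Z\<in>gl 0 0. cj Z = Z \<and> skew Z \<and> Z * N - N * Z = T"
proof -
  obtain Z where Z: "Z \<in> gl 0 0" "Z * N - N * Z = T" using bracket_surjective_gl[OF N(1) inj T(1)] by blast
  define Y where "Y = (1/2) *\<^sub>R (Z + cj Z)"
  have Y1: "cj Y = Y" by (simp add: Y_def add.commute)
  have sum: "(1/2) *\<^sub>R (A + B) \<in> gl 0 0" "(1/2) *\<^sub>R (A - B) \<in> gl 0 0" if "A \<in> gl 0 0" "B \<in> gl 0 0" for A B
    using that by (simp_all add: gl_def distrib_left distrib_right left_diff_distrib right_diff_distrib)
  have Y2: "Y \<in> gl 0 0" unfolding Y_def by (intro sum cj_gl Z)
  have "cj Z * N - N * cj Z = T" using arg_cong[OF Z(2), of cj] N(2) T(2) by simp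
  then have Y3: "Y * N - N * Y = T"
    using Z(2) by (simp add: Y_def distrib_left distrib_right flip: scaleR_diff_right)
      (metis add_diff_add scaleR_half_double)
  define K where "K = (1/2) *\<^sub>R (Y - adj Y)"
  have "adj T = adj N * adj Y - adj Y * adj N" using arg_cong[OF Y3, of adj] by (simp add: adj_simps)
  then have "adj Y * N - N * adj Y = - T" using N(3) T(3) by (simp add: skew_iff_adj algebra_simps)
  then have "K * N - N * K = T"
    using Y3 by (simp add: K_def left_diff_distrib right_diff_distrib flip: scaleR_diff_right)
      (smt (verit) add_diff_add diff_diff_eq2 diff_minus_eq_add scaleR_half_double minus_diff_eq diff_add_eq)
  moreover have "skew K" by (simp add: skew_iff_adj K_def adj_simps adj_adj flip: scaleR_minus_right)
  moreover have "cj K = K" using Y1 by (simp add: K_def flip: adj_cj)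
  moreover have "K \<in> gl 0 0" unfolding K_def by (intro sum adj_gl Y2)
  ultimately show ?thesis by blast
qed

end

section \<open>Directions commuting with an element of type (-1,-1)\<close>

lemma (in polform) pol_hodge_isometry:
  assumes pol_hodge: "pol_hodge \<Phi>" and D: "cj D = D" "D * D' = 1" "D' * D = 1" and iso: "\<And>u v. QC (ap D u) (ap D v) = QC u v"
  shows "pol_hodge (flow D \<Phi>)"
proof -
  have inv: "ap D (ap D' v) = v" "ap D' (ap D v) = v" for v
    using arg_cong[OF D(2), of "\<lambda>A. ap A v"] arg_cong[OF D(3), of "\<lambda>A. ap A v"] by simp_all
  have mem: "v \<in> flow D \<Phi> p \<longleftrightarrow> ap D' v \<in> \<Phi> p" for v p
    unfolding flow_def using inv by (metis image_iff)
  have D': "cj D' = D'"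
  proof -
    have "D' = D' * (D * cj D')" using arg_cong[OF D(2), of cj] D(1) by simp
    then show ?thesis using D(3) by (simp add: mult.assoc[symmetric])
  qed
  have cmem: "v \<in> cnj_vec ` flow D \<Phi> p \<longleftrightarrow> ap D' v \<in> cnj_vec ` \<Phi> p" for v p
    by (simp add: in_cnj_image mem cnj_vec_ap D')
  have hs: "hodge_structure w \<Phi>" and b1: "first_bilinear_relation Q w \<Phi>" and b2: "second_bilinear_relation Q w \<Phi>"
    using pol_hodge by (simp_all add: pol_hodge_def)
  have opp: "\<Phi> p + cnj_vec ` \<Phi> (w - p + 1) = UNIV" "\<Phi> p \<inter> cnj_vec ` \<Phi> (w - p + 1) = {0}" for p
    using hs by (simp_all add: hodge_structure_def)
  have dec: "decreasing_filtration (flow D \<Phi>)"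
    unfolding decreasing_filtration_def
  proof (intro conjI allI)
    fix p
    have "vec.subspace (\<Phi> p)" "\<Phi> (p + 1) \<subseteq> \<Phi> p"
      using hs by (simp_all add: hodge_structure_def decreasing_filtration_def)
    then show "vec.subspace (flow D \<Phi> p)" "flow D \<Phi> (p + 1) \<subseteq> flow D \<Phi> p"
      by (auto simp: vec.subspace_def mem)
  next
    obtain p q where "\<Phi> p = UNIV" "\<Phi> q = {0}"
      using hs by (auto simp: hodge_structure_def decreasing_filtration_def)
    then have "flow D \<Phi> p = UNIV" "flow D \<Phi> q = {0}" using mem[of _ p]
      by (simp add: set_eq_iff) (simp add: \<open>\<Phi> q = {0}\<close> flow_def)
    then show "\<exists>p. flow D \<Phi> p = UNIV" "\<exists>p. flow D \<Phi> p = {0}" by blast+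
  qed
  have "flow D \<Phi> p + cnj_vec ` flow D \<Phi> (w - p + 1) = UNIV" for p
  proof -
    have "v \<in> flow D \<Phi> p + cnj_vec ` flow D \<Phi> (w - p + 1)" for v
    proof -
      have "ap D' v \<in> \<Phi> p + cnj_vec ` \<Phi> (w - p + 1)" unfolding opp by simp
      then obtain a b where ab: "ap D' v = a + b" "a \<in> \<Phi> p" "b \<in> cnj_vec ` \<Phi> (w - p + 1)" by (rule set_plus_elim)
      have "v = ap D a + ap D b" using inv(1)[of v] ab(1) by simp
      then show ?thesis using ab(2,3) by (simp add: set_plus_intro mem cmem inv)
    qed
    then show ?thesis by blast
  qed
  moreover have "flow D \<Phi> p \<inter> cnj_vec ` flow D \<Phi> (w - p + 1) = {0}" for p
  proof -
    have "v \<in> flow D \<Phi> p \<inter> cnj_vec ` flow D \<Phi> (w - p + 1) \<longleftrightarrow> ap D' v \<in> \<Phi> p \<inter> cnj_vec ` \<Phi> (w - p + 1)" for v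
      by (simp only: Int_iff mem cmem)
    also have "\<dots> v \<longleftrightarrow> v = 0" for v
      unfolding opp using inv(1)[of v] by auto
    finally show ?thesis by blast
  qed
  ultimately have "hodge_structure w (flow D \<Phi>)" using dec by (simp add: hodge_structure_def)
  moreover have "first_bilinear_relation Q w (flow D \<Phi>)"
    using b1 unfolding first_bilinear_relation_def by (auto simp: flow_def iso)
  moreover have "second_bilinear_relation Q w (flow D \<Phi>)"
    unfolding second_bilinear_relation_def
  proof (intro allI impI ballI)
    fix p q v assume pq: "p + q = w" and v: "v \<in> hodge_component (flow D \<Phi>) p q" "v \<noteq> 0"
    have 1: "ap D' v \<in> hodge_component \<Phi> p q" using v(1) by (simp add: hodge_component_def mem cmem)
    have 2: "ap D' v \<noteq> 0" using v(2) inv(1)[of v] by auto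
    have 3: "QC v (cnj_vec v) = QC (ap D' v) (cnj_vec (ap D' v))"
      using iso[of "ap D' v" "ap D' (cnj_vec v)"] by (simp add: inv cnj_vec_ap D')
    show "\<i> powi (p - q) * QC v (cnj_vec v) \<in> \<real> \<and> 0 < Re (\<i> powi (p - q) * QC v (cnj_vec v))"
      unfolding 3 using b2 pq 1 2 unfolding second_bilinear_relation_def by blast
  qed
  ultimately show ?thesis by (simp add: pol_hodge_def)
qed

context split_pol
begin

text \<open>
  The grading by weight, exponentiated: a real isometry of the form that preserves \<open>F\<close> and scales an
  endomorphism of type \<open>(a,b)\<close> by \<open>l\<^bsup>a+b\<^esup>\<close>.
\<close>

definition dil :: "real \<Rightarrow> 'n cmat" where
  "dil l = (\<Sum>(r, s)\<in>Idx. (l powi (r + s - w)) *\<^sub>R E r s)"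

lemma dil_E: "dil l * E r s = (l powi (r + s - w)) *\<^sub>R E r s"
  and E_dil: "E r s * dil l = (l powi (r + s - w)) *\<^sub>R E r s"
proof -
  have "dil l * E r s = (\<Sum>i\<in>Idx. if i = (r, s) then (l powi (r + s - w)) *\<^sub>R E r s else 0)"
    unfolding dil_def sum_distrib_right case_prod_unfold by (rule sum.cong) (auto simp: E_mult)
  then show "dil l * E r s = (l powi (r + s - w)) *\<^sub>R E r s"
    using E_out[of r s] by (simp add: finite_Idx)
  have "E r s * dil l = (\<Sum>i\<in>Idx. if i = (r, s) then (l powi (r + s - w)) *\<^sub>R E r s else 0)"
    unfolding dil_def sum_distrib_left case_prod_unfold by (rule sum.cong) (auto simp: E_mult)
  then show "E r s * dil l = (l powi (r + s - w)) *\<^sub>R E r s"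
    using E_out[of r s] by (simp add: finite_Idx)
qed

lemma dil_inverse: "l \<noteq> 0 \<Longrightarrow> dil l * dil (inverse l) = 1"
  by (rule E_extR) (simp add: mult.assoc dil_E power_int_inverse)

lemma dil_inverse': "l \<noteq> 0 \<Longrightarrow> dil (inverse l) * dil l = 1"
  using dil_inverse[of "inverse l"] by simp

lemma cj_dil: "cj (dil l) = dil l"
proof (rule E_extR)
  fix r s
  have "cj (dil l) * E r s = cj (dil l * E s r)" by (simp only: cj_simps cj_E)
  also have "\<dots> = dil l * E r s" by (simp add: dil_E cj_E add.commute)
  finally show "cj (dil l) * E r s = dil l * E r s" .
qed

lemma adj_dil: "adj (dil l) = dil (inverse l)"
proof (rule E_extR)
  fix r s
  have "adj (dil l) * E r s = adj (E (w - r) (w - s) * dil l)" by (simp add: adj_simps adj_E)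
  also have "\<dots> = (l powi - (r + s - w)) *\<^sub>R E r s"
    by (simp add: E_dil adj_simps adj_E) (simp add: algebra_simps)
  also have "\<dots> = dil (inverse l) * E r s"
    unfolding dil_E power_int_minus power_int_inverse ..
  finally show "adj (dil l) * E r s = dil (inverse l) * E r s" .
qed

lemma dil_isometry: assumes "l \<noteq> 0" shows "QC (ap (dil l) u) (ap (dil l) v) = QC u v"
proof -
  have "QC (ap (dil l) u) (ap (dil l) v) = QC u (ap (dil (inverse l) * dil l) v)"
    by (simp add: QC_adj adj_dil)
  then show ?thesis by (simp only: dil_inverse'[OF assms] ap_simps)
qed

lemma flow_dil: assumes "l \<noteq> 0" shows "flow (dil l) F = F"
proof
  fix p
  have sub: "ap (dil m) v \<in> F p" if "v \<in> F p" for v m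
    unfolding F_iff
  proof (intro allI impI)
    fix r s assume "r < p"
    then have "ap (E r s) v = 0" using that unfolding F_iff by blast
    moreover have "ap (E r s) (ap (dil m) v) = ap (E r s * dil m) v" by simp
    ultimately show "ap (E r s) (ap (dil m) v) = 0" unfolding E_dil by simp
  qed
  have "v \<in> ap (dil l) ` F p" if "v \<in> F p" for v
  proof (rule image_eqI[OF _ sub[OF that, of "inverse l"]])
    show "v = ap (dil l) (ap (dil (inverse l)) v)" using dil_inverse[OF assms] by (metis ap_simps(1,13))
  qed
  then show "flow (dil l) F p = F p" using sub by (auto simp: flow_def)
qed

lemma dil_gl: assumes "X \<in> gl a b" "l \<noteq> 0" shows "dil l * X = (l powi (a + b)) *\<^sub>R (X * dil l)"
proof (rule E_extR)
  fix r s
  have "dil l * X * E r s = (l powi (r + a + (s + b) - w)) *\<^sub>R (X * E r s)"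
    by (simp add: mult.assoc gl_commute[OF assms(1)]) (simp add: mult.assoc[symmetric] dil_E)
  also have "l powi (r + a + (s + b) - w) = l powi (a + b) * l powi (r + s - w)"
    using assms(2) by (simp flip: power_int_add add: algebra_simps)
  finally show "dil l * X * E r s = (l powi (a + b)) *\<^sub>R (X * dil l) * E r s"
    by (simp add: mult.assoc dil_E)
qed

definition "Ad_dil l X = dil l * X * dil (inverse l)"

lemma Ad_dil_gl: assumes "X \<in> gl a b" "l \<noteq> 0" shows "Ad_dil l X = (l powi (a + b)) *\<^sub>R X"
  using dil_gl[OF assms] dil_inverse[OF assms(2)] by (simp add: Ad_dil_def mult.assoc)

lemma Ad_dil_add: "Ad_dil l (X + Y) = Ad_dil l X + Ad_dil l Y"
  and Ad_dil_scaleR: "Ad_dil l (c *\<^sub>R X) = c *\<^sub>R Ad_dil l X"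
  by (simp_all add: Ad_dil_def distrib_left distrib_right)

lemma Ad_dil_mult: assumes "l \<noteq> 0" shows "Ad_dil l (X * Y) = Ad_dil l X * Ad_dil l Y"
proof -
  have "Ad_dil l X * Ad_dil l Y = dil l * X * (dil (inverse l) * dil l) * Y * dil (inverse l)"
    by (simp add: Ad_dil_def mult.assoc)
  then show ?thesis using assms by (simp add: dil_inverse' Ad_dil_def mult.assoc)
qed

lemma flow_Ad_dil:
  assumes l: "l \<noteq> 0" and pt: "pol_hodge (flow (exp (scal \<i> * X)) F)"
  shows "pol_hodge (flow (exp (scal \<i> * Ad_dil l X)) F)"
proof -
  have "dil l * (scal \<i> * X) = scal \<i> * Ad_dil l X * dil l"
    using l by (simp add: Ad_dil_def mult.assoc dil_inverse' scal_move)
  from exp_intertwine[OF this] have "flow (exp (scal \<i> * Ad_dil l X)) (flow (dil l) F) = flow (dil l) (flow (exp (scal \<i> * X)) F)"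
    by (simp add: flow_mult[symmetric])
  then have "flow (exp (scal \<i> * Ad_dil l X)) F = flow (dil l) (flow (exp (scal \<i> * X)) F)"
    using l by (simp add: flow_dil)
  then show ?thesis
    using pol_hodge_isometry[OF pt cj_dil dil_inverse[OF l] dil_inverse'[OF l] dil_isometry[OF l]] by simp
qed

lemma type_part_commute:
  assumes N: "N \<in> gl c d" and com: "X * N = N * X"
  shows "type_part a b X * N = N * type_part a b X"
proof (rule E_extR)
  fix r s
  have "type_part a b X * N * E r s = type_part a b X * E (r + c) (s + d) * N" by (simp add: mult.assoc gl_commute[OF N])
  also have "\<dots> = E (r + c + a) (s + d + b) * X * (E (r + c) (s + d) * N)" by (simp add: type_part_E mult.assoc)
  also have "\<dots> = E (r + c + a) (s + d + b) * (X * N) * E r s" by (simp add: gl_commute[OF N, symmetric] mult.assoc)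
  also have "\<dots> = E (r + a + c) (s + b + d) * N * X * E r s" by (simp add: com mult.assoc add_ac)
  also have "\<dots> = N * (E (r + a) (s + b) * X * E r s)" by (simp add: gl_commute[OF N, symmetric] mult.assoc)
  also have "\<dots> = N * type_part a b X * E r s" by (simp add: type_part_E mult.assoc)
  finally show "type_part a b X * N * E r s = N * type_part a b X * E r s" .
qed

lemma type_part_horizontal:
  assumes "\<And>p v. v \<in> F p \<Longrightarrow> ap X v \<in> F (p - 1)" "a < -1"
  shows "type_part a b X = 0"
proof (rule E_extR, rule sqmat_eqI)
  fix r s v
  have "ap X (ap (E r s) v) \<in> F (r - 1)" by (rule assms(1)[OF deligne_type(1)[OF E_in]])
  then have "ap (E (r + a) (s + b)) (ap X (ap (E r s) v)) = 0" using assms(2) unfolding F_iff by simp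
  then show "ap (type_part a b X * E r s) v = ap (0 * E r s) v" by (simp only: type_part_E) simp
qed

text \<open>
  The curves \<open>exp(i(l\<^sup>2 N + sX))F\<close>, dilated by \<open>l\<close>, become \<open>exp(is Ad_dil l X) exp(iN)F\<close> with
  \<open>\<bar>s\<bar> \<le> \<rho> l\<^sup>2\<close>, where \<open>Ad_dil l X = X\<^sub>0 + l\<^sup>-\<^sup>1 X\<^sub>1 + l\<^sup>-\<^sup>2 X\<^sub>2\<close> according to weight. Letting \<open>l\<close> grow gives \<open>X\<^sub>0 = 0\<close>.
  After that, multiplication by \<open>l\<close> leaves an interval of length proportional to \<open>l\<close> and gives \<open>X\<^sub>1 = 0\<close>.
\<close>

lemma commuting_type:
  assumes N: "N \<in> gl (-1) (-1)" "cj N = N"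
    and X: "cj X = X" "skew X" "X * N = N * X" "X ^ n = 0" "\<And>p v. v \<in> F p \<Longrightarrow> ap X v \<in> F (p - 1)"
    and rho: "\<rho> > 0" and orbit: "\<And>y s. y \<ge> y0 \<Longrightarrow> \<bar>s\<bar> \<le> \<rho> * y \<Longrightarrow> pol_hodge (flow (exp (scal \<i> * (y *\<^sub>R N + s *\<^sub>R X))) F)"
  shows "X \<in> gl (-1) (-1)"
proof -
  obtain L where L: "\<bar>w\<bar> \<le> L" "\<And>p. p > L \<Longrightarrow> F p = {0}" using hodge_level by blast
  define y1 where "y1 = max 1 y0"
  have y1: "y1 \<ge> 1" "y1 \<ge> y0" by (simp_all add: y1_def)
  have ptN: "pol_hodge (flow (imag_exp y1 N) F)"
    using orbit[OF y1(2), of 0] y1(1) rho by (simp add: imag_exp_def scaleR_right_distrib)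
  have pos0: "type_part a b X = 0" if "a + b \<ge> 1" for a b
    by (rule commuting_positive_zero[OF N(2) ptN type_part_gl that type_part_commute[OF N(1) X(3)]])
  have a0: "type_part a b X = 0" if "a < -1" for a b by (rule type_part_horizontal[OF X(5) that])
  have b0: "type_part a b X = 0" if "b < -1" for a b
  proof -
    have "cj (type_part a b X) = 0" by (simp add: cj_type_part X(1) a0[OF that])
    then show ?thesis by (metis cj_simps(6,7))
  qed
  \<comment> \<open>The types with \<open>a, b \<ge> -1\<close> and \<open>a + b \<le> 0\<close>, grouped by weight.\<close>
  define X0 where "X0 = type_part 1 (-1) X + type_part 0 0 X + type_part (-1) 1 X"
  define X1 where "X1 = type_part (-1) 0 X + type_part 0 (-1) X"
  define X2 where "X2 = type_part (-1) (-1) X"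
  have dec: "X = X0 + X1 + X2"
  proof (rule E_extR, rule E_extL)
    have c: "E t u * (type_part a b X * E r s) = (if t = r + a \<and> u = s + b then E t u * (X * E r s) else 0)" for a b r s t u
      by (simp add: type_part_E mult.assoc[symmetric] E_mult)
    fix r s t u
    have z: "E t u * (X * E r s) = 0" if "type_part (t - r) (u - s) X = 0"
      using c[of t u "t - r" "u - s" r s] that by simp
    have "t - r < -1 \<or> u - s < -1 \<or> t - r + (u - s) \<ge> 1 \<or> (t = r + 1 \<and> u = s - 1) \<or> (t = r \<and> u = s) \<or> (t = r - 1 \<and> u = s + 1)
       \<or> (t = r - 1 \<and> u = s) \<or> (t = r \<and> u = s - 1) \<or> (t = r - 1 \<and> u = s - 1)" by linarith
    then show "E t u * (X * E r s) = E t u * ((X0 + X1 + X2) * E r s)"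
    proof (elim disjE)
    qed (auto simp: X0_def X1_def X2_def distrib_left distrib_right c z a0 b0 pos0)
  qed
  have dX: "Ad_dil l X = X0 + inverse l *\<^sub>R X1 + (inverse l)\<^sup>2 *\<^sub>R X2" if "l \<noteq> 0" for l
    using Ad_dil_gl[OF type_part_gl that]
    by (subst dec) (simp add: X0_def X1_def X2_def Ad_dil_add scaleR_right_distrib power_int_minus power_inverse)
  have dN: "Ad_dil l N = (inverse l)\<^sup>2 *\<^sub>R N" if "l \<noteq> 0" for l
    using Ad_dil_gl[OF N(1) that] by (simp add: power_int_minus power_inverse)
  have cX: "cj (Ad_dil l X) = Ad_dil l X" for l by (simp add: Ad_dil_def cj_dil X(1))
  have sX: "skew (Ad_dil l X)" for l
    using X(2) by (simp add: skew_iff_adj Ad_dil_def adj_simps adj_dil mult.assoc)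
  have tX: "tr (Ad_dil l X * Ad_dil l X) = 0" if "l \<noteq> 0" for l
  proof -
    have "(X ^ 2) ^ n = (X ^ n) ^ 2" by (simp only: power_mult[symmetric] mult.commute)
    then have "(X * X) ^ n = 0" using X(4) by (simp add: power2_eq_square)
    then have "tr (X * X) = 0" by (rule tr_nilpotent)
    have "tr (Ad_dil l (X * X)) = tr (dil (inverse l) * (dil l * (X * X)))"
      unfolding Ad_dil_def by (rule tr_commute)
    also have "\<dots> = tr (X * X)" by (simp add: mult.assoc[symmetric] dil_inverse'[OF that])
    finally show ?thesis using \<open>tr (X * X) = 0\<close> by (simp add: Ad_dil_mult[OF that])
  qed
  have hX: "ap (Ad_dil l X) v \<in> F (p - 1)" if "v \<in> F p" "l \<noteq> 0" for l p v
  proof -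
    have 1: "ap (dil m) v \<in> F p" if "v \<in> F p" "m \<noteq> 0" for m v p
      using flow_dil[OF that(2)] that(1) unfolding flow_def by (metis image_eqI)
    show ?thesis unfolding Ad_dil_def using 1 X(5) that by simp
  qed
  have comN: "Ad_dil l X * N = N * Ad_dil l X" if "l \<noteq> 0" for l
  proof -
    have "Ad_dil l X * Ad_dil l N = Ad_dil l N * Ad_dil l X"
      using X(3) by (simp add: Ad_dil_mult[OF that, symmetric])
    then show ?thesis using that by (simp add: dN)
  qed
  have orb: "pol_hodge (flow (imag_exp s (Ad_dil l X)) (flow (imag_exp 1 N) F))" if l: "l > 0" "l\<^sup>2 \<ge> y0" and s: "\<bar>s\<bar> \<le> \<rho> * l\<^sup>2" for l s
  proof -
    have "pol_hodge (flow (exp (scal \<i> * Ad_dil l (l\<^sup>2 *\<^sub>R N + s *\<^sub>R X))) F)"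
      by (rule flow_Ad_dil[OF _ orbit[OF l(2) s]]) (use l in simp)
    moreover have "Ad_dil l (l\<^sup>2 *\<^sub>R N + s *\<^sub>R X) = s *\<^sub>R Ad_dil l X + N"
      using l by (simp add: Ad_dil_add Ad_dil_scaleR dN power_inverse)
    moreover have "exp (scal \<i> * (s *\<^sub>R Ad_dil l X + N)) = imag_exp s (Ad_dil l X) * imag_exp 1 N"
    proof -
      have "exp (s *\<^sub>R (scal \<i> * Ad_dil l X) + 1 *\<^sub>R (scal \<i> * N)) = imag_exp s (Ad_dil l X) * imag_exp 1 N"
        unfolding imag_exp_def
        by (rule exp_add_commuting) (use comN[of l] l in \<open>simp add: scal_scal del: ap_simps\<close>)
      then show ?thesis by (simp add: distrib_left)
    qed
    ultimately show ?thesis by (simp add: flow_mult)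
  qed
  have horN: "ap (Ad_dil l X) v \<in> flow (imag_exp 1 N) F (p - 1)" if v: "v \<in> flow (imag_exp 1 N) F p" and l: "l \<noteq> 0" for l v p
  proof -
    obtain u where u: "u \<in> F p" "v = ap (imag_exp 1 N) u" using v by (auto simp: flow_def)
    have "Ad_dil l X * (1 *\<^sub>R (scal \<i> * N)) = 1 *\<^sub>R (scal \<i> * N) * Ad_dil l X"
      using comN[OF l] by (simp add: mult.assoc scal_move)
    from exp_intertwine[OF this] have "Ad_dil l X * imag_exp 1 N = imag_exp 1 N * Ad_dil l X" by (simp add: imag_exp_def)
    then have "ap (Ad_dil l X) v = ap (imag_exp 1 N) (ap (Ad_dil l X) u)" unfolding u(2) by (metis ap_simps(1))
    then show ?thesis using hX[OF u(1) l] by (simp add: flow_def)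
  qed
  define l where "l k = real k + y1" for k
  have lpos: "l k > 0" "l k \<noteq> 0" and ly: "(l k)\<^sup>2 \<ge> y0" for k
  proof -
    show "l k > 0" "l k \<noteq> 0" using y1(1) by (simp_all add: l_def add_nonneg_pos)
    have "y0 \<le> l k" using y1 by (simp add: l_def)
    also have "l k \<le> (l k)\<^sup>2" using y1(1) by (simp add: l_def power2_eq_square)
    finally show "(l k)\<^sup>2 \<ge> y0" .
  qed
  have linf: "filterlim l at_top sequentially"
    unfolding l_def by (rule filterlim_at_top_mono[OF filterlim_real_sequentially]) (use y1 in auto)
  have linv: "(\<lambda>k. inverse (l k)) \<longlonglongrightarrow> 0" by (rule tendsto_inverse_0_at_top[OF linf])
  have "pol_hodge (flow (imag_exp 0 (Ad_dil (l 0) X)) (flow (imag_exp 1 N) F))"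
    by (rule orb[OF lpos(1) ly]) (use rho in simp)
  then have ptN1: "pol_hodge (flow (imag_exp 1 N) F)" unfolding imag_exp_0 flow_1 .
  have pt1: "hodge_point Q w (flow (imag_exp 1 N) F) L"
    by (rule flow_hodge_point[OF L ptN1])
  have X0: "X0 = 0"
  proof (rule horizontal_limit_zero[OF pt1, where Xs = "\<lambda>k. Ad_dil (l k) X" and R = "\<lambda>k. \<rho> * (l k)\<^sup>2"])
    have "(\<lambda>k. X0 + inverse (l k) *\<^sub>R X1 + (inverse (l k))\<^sup>2 *\<^sub>R X2) \<longlonglongrightarrow> X0 + 0 *\<^sub>R X1 + 0\<^sup>2 *\<^sub>R X2"
      by (intro tendsto_intros linv)
    then show "(\<lambda>k. Ad_dil (l k) X) \<longlonglongrightarrow> X0" by (simp add: dX[OF lpos(2)])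
    show "filterlim (\<lambda>k. \<rho> * (l k)\<^sup>2) at_top sequentially"
      by (intro filterlim_tendsto_pos_mult_at_top[OF tendsto_const rho] filterlim_pow_at_top linf) simp
    fix k p v s
    show "v \<in> flow (imag_exp 1 N) F p \<Longrightarrow> ap (Ad_dil (l k) X) v \<in> flow (imag_exp 1 N) F (p - 1)" by (rule horN[OF _ lpos(2)])
    show "\<bar>s\<bar> < \<rho> * (l k)\<^sup>2 \<Longrightarrow> pol_hodge (flow (imag_exp s (Ad_dil (l k) X)) (flow (imag_exp 1 N) F))"
      by (rule orb[OF lpos(1) ly]) simp
  qed (auto simp: cX sX tX lpos)
  have X1: "X1 = 0"
  proof (rule horizontal_limit_zero[OF pt1, where Xs = "\<lambda>k. l k *\<^sub>R Ad_dil (l k) X" and R = "\<lambda>k. \<rho> * l k"])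
    have "(\<lambda>k. X1 + inverse (l k) *\<^sub>R X2) \<longlonglongrightarrow> X1 + 0 *\<^sub>R X2"
      by (intro tendsto_intros linv)
    moreover have "l k *\<^sub>R Ad_dil (l k) X = X1 + inverse (l k) *\<^sub>R X2" for k
    proof -
      have "l k * (inverse (l k) * inverse (l k)) = inverse (l k)" using lpos(2)[of k] by simp
      then show ?thesis by (simp add: dX[OF lpos(2)] X0 scaleR_right_distrib power2_eq_square lpos)
    qed
    ultimately show "(\<lambda>k. l k *\<^sub>R Ad_dil (l k) X) \<longlonglongrightarrow> X1" by simp
    show "filterlim (\<lambda>k. \<rho> * l k) at_top sequentially"
      by (intro filterlim_tendsto_pos_mult_at_top[OF tendsto_const rho] linf)
    fix k p v s
    have sub: "vec.subspace (flow (imag_exp 1 N) F (p - 1))" by (rule hodge_point.subspace_F[OF pt1])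
    show "v \<in> flow (imag_exp 1 N) F p \<Longrightarrow> ap (l k *\<^sub>R Ad_dil (l k) X) v \<in> flow (imag_exp 1 N) F (p - 1)"
      using horN[OF _ lpos(2)] subspace_scale[OF complex_subspace_imp_real[OF sub]] by simp
    show "cj (l k *\<^sub>R Ad_dil (l k) X) = l k *\<^sub>R Ad_dil (l k) X" by (simp add: cX)
    show "skew (l k *\<^sub>R Ad_dil (l k) X)" using sX[of "l k"] by (simp add: skew_iff_adj adj_simps)
    show "tr (l k *\<^sub>R Ad_dil (l k) X * l k *\<^sub>R Ad_dil (l k) X) = 0" by (simp add: tX lpos)
    assume s: "\<bar>s\<bar> < \<rho> * l k"
    have "\<bar>s * l k\<bar> \<le> \<rho> * (l k)\<^sup>2" using s lpos(1)[of k] by (simp add: abs_mult power2_eq_square)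
    from orb[OF lpos(1) ly this] show "pol_hodge (flow (imag_exp s (l k *\<^sub>R Ad_dil (l k) X)) (flow (imag_exp 1 N) F))"
      by (simp add: imag_exp_def mult.commute)
  qed
  have "X = type_part (-1) (-1) X" using dec X0 X1 unfolding X2_def by simp
  then show ?thesis by (metis type_part_gl)
qed

end

section \<open>Isotropy of the monodromy weight filtration\<close>

lemma (in polform) skew_power:
  assumes "\<And>u v. Q (N *v u) v = - Q u (N *v v)"
  shows "Q (mat_power N k *v u) v = (-1) ^ k * Q u (mat_power N k *v v)"
proof (induction k arbitrary: u v)
  case (Suc k)
  have com: "mat_power N k ** N = N ** mat_power N k"
    by (induction k) (simp_all add: matrix_mul_assoc[symmetric])
  have "Q (mat_power N (Suc k) *v u) v = - Q (mat_power N k *v u) (N *v v)"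
    by (simp add: assms flip: matrix_vector_mul_assoc)
  also have "\<dots> = - ((-1) ^ k * Q u ((mat_power N k ** N) *v v))"
    by (simp add: Suc flip: matrix_vector_mul_assoc)
  also have "\<dots> = (-1) ^ Suc k * Q u (mat_power N (Suc k) *v v)" by (simp add: com)
  finally show ?case .
qed simp

text \<open>
  Induction on the smaller index, from the bottom of the filtration. If \<open>l = -j\<close> is the smaller index, write
  \<open>v = N\<^sup>j v'\<close> modulo \<open>W\<^sub>l\<^sub>-\<^sub>1\<close> with \<open>v'\<close> in \<open>W\<^sub>j\<close>. Moving \<open>N\<^sup>j\<close> to the other side pairs \<open>W\<^bsub>k-2j\<^esub>\<close> with \<open>W\<^sub>j\<close>: the
  sum of the indices is unchanged and the smaller one has decreased.
\<close>

lemma (in polform) weight_filtration_orthogonal: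
  assumes mon: "monodromy_weight_filtration N WN" and skewN: "\<And>u v. Q (N *v u) v = - Q u (N *v v)"
    and kl: "k + l < 0" and u: "u \<in> WN k" and v: "v \<in> WN l"
  shows "Q u v = 0"
proof -
  have inc: "WN k \<subseteq> WN (k + 1)" "\<exists>k. WN k = {0}" and NW: "(*v) N ` WN k \<subseteq> WN (k - 2)"
    and surj: "\<And>k::nat. \<forall>u\<in>WN (- int k). \<exists>v\<in>WN (int k). u - mat_power N k *v v \<in> WN (- int k - 1)" for k
    using mon by (simp_all add: monodromy_weight_filtration_def increasing_filtration_def)
  have mono: "WN k \<subseteq> WN l" if "k \<le> l" for k l by (rule int_chain_mono[of WN, OF inc(1) that])
  have NjW: "mat_power N j *v u \<in> WN (k - 2 * int j)" if "u \<in> WN k" for j u k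
  proof (induction j)
    case (Suc j)
    have "N *v (mat_power N j *v u) \<in> WN (k - 2 * int j - 2)" using NW Suc by blast
    then show ?case by (simp add: matrix_vector_mul_assoc algebra_simps)
  qed (use that in simp)
  obtain b where b: "WN b = {0}" using inc(2) by blast
  have claim: "Q u v = 0" if "k + l < 0" "min k l < b + int n" "u \<in> WN k" "v \<in> WN l" for n k l u v
    using that
  proof (induction n arbitrary: k l u v)
    case 0
    then have "u = 0 \<or> v = 0" using mono[of k b] mono[of l b] b by (auto simp: min_def split: if_splits)
    then show ?case by (auto simp: Q_simps)
  next
    case (Suc n)
    have main: "Q u v = 0" if kl: "k + l < 0" "l \<le> k" "l < b + int (Suc n)" and u: "u \<in> WN k" and v: "v \<in> WN l" for k l u v
    proof -
      define j where "j = nat (- l)"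
      have lj: "l = - int j" using kl by (simp add: j_def)
      obtain v' where v': "v' \<in> WN (int j)" "v - mat_power N j *v v' \<in> WN (l - 1)"
        using surj[of j] v unfolding lj by blast
      have "Q u (v - mat_power N j *v v') = 0"
        by (rule Suc.IH[OF _ _ u v'(2)]) (use kl in auto)
      moreover have "Q (mat_power N j *v u) v' = 0"
        by (rule Suc.IH[OF _ _ NjW[OF u] v'(1)]) (use kl lj in auto)
      ultimately show ?thesis using skew_power[OF skewN, of j u v'] by (simp add: Q_simps)
    qed
    show ?case
    proof (cases "l \<le> k")
      case True
      then show ?thesis using main[of k l u v] Suc.prems by simp
    next
      case False
      then have "Q v u = 0" using main[of l k v u] Suc.prems by simp
      then show ?thesis using Q_sym[of u v] by simp
    qed
  qed
  have "min k l < b + int (nat (min k l - b + 1))" by simp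
  from claim[OF kl this u v] show ?thesis .
qed

section \<open>Real matrices and their complexifications\<close>

definition cpx :: "(real, 'n::finite) sqmat \<Rightarrow> 'n cmat" where "cpx A = sqm (complexify_mat (mat_of A))"

abbreviation cm :: "real ^ 'n::finite ^ 'n \<Rightarrow> 'n cmat" where "cm A \<equiv> cpx (sqm A)"

lemma complexify_mat_simps:
  "complexify_mat (A + B) = complexify_mat A + complexify_mat B" "complexify_mat (r *\<^sub>R A) = r *\<^sub>R complexify_mat A"
  "complexify_mat (A ** B) = complexify_mat A ** complexify_mat B" "complexify_mat 0 = 0" "complexify_mat (mat 1) = mat 1"
  "complexify_mat (A - B) = complexify_mat A - complexify_mat B"
  by (simp_all add: complexify_mat_def map_matrix_def vec_eq_iff matrix_matrix_mult_def scaleR_conv_of_real[of _ "_ :: complex"] mat_def)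

lemma cpx_simps [simp]:
  "cpx (A + B) = cpx A + cpx B" "cpx (r *\<^sub>R A) = r *\<^sub>R cpx A" "cpx (A * B) = cpx A * cpx B" "cpx 0 = 0" "cpx 1 = 1"
  "cpx (A - B) = cpx A - cpx B" "cj (cpx A) = cpx A"
  by (simp_all add: cpx_def complexify_mat_simps plus_sqmat_def minus_sqmat_def scaleR_sqmat_def times_sqmat_def zero_sqmat_def one_sqmat_def)
     (simp add: cj_def complexify_mat_def map_matrix_def)

lemma cpx_power: "cpx (A ^ k) = cpx A ^ k" by (induction k) simp_all

lemma sqm_simps: "sqm (A + B) = sqm A + sqm B" "sqm (r *\<^sub>R A) = r *\<^sub>R sqm A" "sqm (A ** B) = sqm A * sqm B"
  "sqm (A - B) = sqm A - sqm B" "sqm (mat 1) = 1" "sqm 0 = 0"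
  for A B :: "real ^ 'n::finite ^ 'n"
  by (simp_all add: plus_sqmat_def minus_sqmat_def scaleR_sqmat_def times_sqmat_def one_sqmat_def zero_sqmat_def)

lemma sqm_sum: "sqm (\<Sum>i\<in>I. A i) = (\<Sum>i\<in>I. sqm (A i))" for A :: "'i \<Rightarrow> real ^ 'n::finite ^ 'n"
  by (induction I rule: infinite_finite_induct) (simp_all add: sqm_simps)

lemma mat_of_cm: "mat_of (cm A) = complexify_mat A" by (simp add: cpx_def)

lemma ap_cm: "ap (cm A) v = complexify_mat A *v v" by (simp add: ap_def mat_of_cm)

lemma re_im_cm: "re_vec (ap (cm A) v) = A *v re_vec v" "im_vec (ap (cm A) v) = A *v im_vec v"
  by (simp_all add: ap_cm complexify_mat_def map_matrix_def matrix_vector_mult_def re_vec_def im_vec_def vec_eq_iff)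

lemma cm_inj: "cm A = cm B \<longleftrightarrow> A = B"
  by (auto simp: cpx_def sqm_inject complexify_mat_def map_matrix_def vec_eq_iff)

lemma real_cm: assumes "cj X = X" obtains A where "X = cm A"
proof (rule that[of "map_matrix Re (mat_of X)"])
  have "mat_of (cj X) = mat_of X" using assms by simp
  then have "map_matrix cnj (mat_of X) = mat_of X" by (simp add: cj_def)
  then have "cnj (mat_of X $ i $ j) = mat_of X $ i $ j" for i j by (simp add: vec_eq_iff map_matrix_def)
  then have "of_real (Re (mat_of X $ i $ j)) = mat_of X $ i $ j" for i j
    by (metis Reals_cnj_iff of_real_Re)
  then have "complexify_mat (map_matrix Re (mat_of X)) = mat_of X"
    by (simp add: complexify_mat_def map_matrix_def vec_eq_iff)
  then show "X = cm (map_matrix Re (mat_of X))" by (simp add: cpx_def)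
qed

lemma bounded_linear_cpx: "bounded_linear (cpx :: (real, 'n::finite) sqmat \<Rightarrow> _)"
proof -
  have "bounded_linear (\<lambda>M::real ^ 'n ^ 'n. complexify_mat M)"
    by (rule linear_conv_bounded_linear[THEN iffD1], rule linearI) (simp_all add: complexify_mat_simps)
  then have "bounded_linear (\<lambda>A::(real, 'n) sqmat. complexify_mat (mat_of A))"
    by (rule bounded_linear_compose[OF _ bounded_linear_mat_of])
  then show ?thesis unfolding cpx_def[abs_def] by (rule bounded_linear_compose[OF bounded_linear_sqm])
qed

lemma cpx_exp: "cpx (exp A) = exp (cpx A)"
proof -
  have "cpx (exp A) = (\<Sum>k. cpx (A ^ k /\<^sub>R fact k))"
    unfolding exp_def by (rule bounded_linear.suminf[OF bounded_linear_cpx summable_exp_generic])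
  then show ?thesis by (simp add: cpx_power exp_def)
qed

lemma matrix_inv_inverse:
  fixes A :: "real ^ 'n ^ 'n"
  assumes "invertible A"
  shows "A ** matrix_inv A = mat 1" "matrix_inv A ** A = mat 1"
proof -
  have "A ** matrix_inv A = mat 1 \<and> matrix_inv A ** A = mat 1"
    unfolding matrix_inv_def by (rule someI_ex) (use assms in \<open>simp add: invertible_def\<close>)
  then show "A ** matrix_inv A = mat 1" "matrix_inv A ** A = mat 1" by blast+
qed

lemma matrix_inv_eq:
  fixes A B :: "real ^ 'n ^ 'n"
  assumes "A ** B = mat 1" "B ** A = mat 1"
  shows "matrix_inv A = B"
proof -
  have "invertible A" using assms by (auto simp: invertible_def)
  then have "matrix_inv A ** (A ** B) = B" by (simp add: matrix_mul_assoc matrix_inv_inverse)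
  then show ?thesis using assms by simp
qed

lemma mat_of_scal: "mat_of (scal c * A) $ i $ j = c * mat_of A $ i $ j"
  by (simp add: scal_def matrix_matrix_mult_def mat_def if_distrib[of "\<lambda>x. x * _"] cong: if_cong)

lemma mat_exp_inverse: "mat_exp A ** mat_exp (- A) = mat 1" "mat_exp (- A) ** mat_exp A = mat 1"
  for A :: "real ^ 'n ^ 'n"
proof -
  have m: "sqm (- A) = - sqm A" by (simp add: uminus_sqmat_def)
  have "mat_of (exp (sqm A) * exp (- sqm A)) = mat 1" "mat_of (exp (- sqm A) * exp (sqm A)) = mat 1"
    by (simp_all only: exp_minus_right exp_minus_left mat_of_simps)
  then show "mat_exp A ** mat_exp (- A) = mat 1" "mat_exp (- A) ** mat_exp A = mat 1"
    by (simp_all add: mat_exp_eq m)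
qed

context polform
begin

definition rskew :: "real ^ 'n ^ 'n \<Rightarrow> bool" where "rskew X \<longleftrightarrow> (\<forall>u v. Q (X *v u) v = - Q u (X *v v))"

lemma bounded_bilinear_Q: "bounded_bilinear Q" using bil bilinear_conv_bounded_bilinear by blast

lemma rskew_exp: assumes X: "rskew X" shows "Q (mat_exp X *v u) (mat_exp X *v v) = Q u v"
proof -
  let ?A = "sqm X"
  have sx: "Q (ap ?A x) y = - Q x (ap ?A y)" for x y using X by (simp add: rskew_def ap_def)
  have pw: "Q (ap (?A ^ k) u) v = Q u (ap ((- ?A) ^ k) v)" for k u v
  proof (induction k arbitrary: u v)
    case (Suc k)
    have "Q (ap (?A ^ Suc k) u) v = Q (ap (?A ^ k) u) (ap (- ?A) v)"
      by (simp add: sx Q_simps)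
    also have "\<dots> = Q u (ap ((- ?A) ^ k * (- ?A)) v)" by (simp only: Suc ap_simps)
    also have "(- ?A) ^ k * (- ?A) = (- ?A) ^ Suc k" by (rule power_Suc2[symmetric])
    finally show ?case .
  qed simp
  have e: "Q (ap (exp ?A) u) v = Q u (ap (exp (- ?A)) v)" for u v
  proof -
    have lim: "(\<lambda>n. ap (\<Sum>k<n. B ^ k /\<^sub>R fact k) x) \<longlonglongrightarrow> ap (exp B) x" for B :: "(real, 'n) sqmat" and x
      unfolding exp_def by (intro tendsto_intros summable_LIMSEQ summable_exp_generic)
    have "(\<lambda>n. Q (ap (\<Sum>k<n. ?A ^ k /\<^sub>R fact k) u) v) \<longlonglongrightarrow> Q (ap (exp ?A) u) v"
      by (intro bounded_bilinear.tendsto[OF bounded_bilinear_Q] lim tendsto_const)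
    moreover have "(\<lambda>n. Q u (ap (\<Sum>k<n. (- ?A) ^ k /\<^sub>R fact k) v)) \<longlonglongrightarrow> Q u (ap (exp (- ?A)) v)"
      by (intro bounded_bilinear.tendsto[OF bounded_bilinear_Q] lim tendsto_const)
    moreover have "Q (ap (\<Sum>k<n. ?A ^ k /\<^sub>R fact k) u) v = Q u (ap (\<Sum>k<n. (- ?A) ^ k /\<^sub>R fact k) v)" for n
      by (induction n) (simp_all add: Q_simps pw del: power_minus_mult)
    ultimately show ?thesis by (simp add: LIMSEQ_unique)
  qed
  have "Q (ap (exp ?A) u) (ap (exp ?A) v) = Q u (ap (exp (- ?A) * exp ?A) v)" by (simp add: e)
  then show ?thesis by (simp add: exp_minus_left mat_exp_eq ap_def[symmetric] del: ap_simps(1))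
qed

text \<open>
  One direction differentiates the invariance of the form under \<open>exp(tX)\<close> at \<open>t = 0\<close>; the other sums the
  identities \<open>Q(X\<^sup>k u, v) = Q(u, (-X)\<^sup>k v)\<close> over the exponential series.
\<close>

lemma g_real_iff: "X \<in> g_real Q \<longleftrightarrow> rskew X"
proof
  assume X: "rskew X"
  have "mat_exp (t *\<^sub>R X) \<in> Aut_form Q" for t
  proof -
    have "rskew (t *\<^sub>R X)" using X by (simp add: rskew_def scaleR_matrix_vector_mult Q_simps)
    then show ?thesis using mat_exp_inverse[of "t *\<^sub>R X"] by (auto simp: Aut_form_def rskew_exp invertible_def)
  qed
  then show "X \<in> g_real Q" by (simp add: g_real_def lie_algebra_def)
next
  assume "X \<in> g_real Q"
  then have inv: "Q (ap (exp (t *\<^sub>R sqm X)) u) (ap (exp (t *\<^sub>R sqm X)) v) = Q u v" for t u v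
    by (simp add: g_real_def lie_algebra_def Aut_form_def mat_exp_eq sqm_simps ap_def)
  have der: "((\<lambda>t. exp (t *\<^sub>R sqm X)) has_vector_derivative sqm X) (at 0)"
    unfolding has_vector_derivative_def by (rule exp_has_derivative_at_0[OF bounded_linear_scaleR_left])
  have e1: "((\<lambda>t. exp (t *\<^sub>R sqm X)) \<longlongrightarrow> 1) (at 0)"
    using has_vector_derivative_continuous[OF der] by (simp add: continuous_within)
  have ed: "((\<lambda>t. (exp (t *\<^sub>R sqm X) - 1) /\<^sub>R t) \<longlongrightarrow> sqm X) (at 0)"
    using der by (simp add: has_vector_derivative_0_iff)
  show "rskew X"
    unfolding rskew_def
  proof (intro allI)
    fix u v
    have "((\<lambda>t. Q (ap ((exp (t *\<^sub>R sqm X) - 1) /\<^sub>R t) u) (ap (exp (t *\<^sub>R sqm X)) v) + Q u (ap ((exp (t *\<^sub>R sqm X) - 1) /\<^sub>R t) v))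
      \<longlongrightarrow> Q (ap (sqm X) u) (ap 1 v) + Q u (ap (sqm X) v)) (at 0)"
      by (intro tendsto_add bounded_bilinear.tendsto[OF bounded_bilinear_Q] tendsto_ap tendsto_const e1 ed)
    moreover have "Q (ap ((exp (t *\<^sub>R sqm X) - 1) /\<^sub>R t) u) (ap (exp (t *\<^sub>R sqm X)) v) + Q u (ap ((exp (t *\<^sub>R sqm X) - 1) /\<^sub>R t) v) = 0" for t
      by (simp add: Q_simps inv right_diff_distrib)
    ultimately have "((\<lambda>t::real. 0) \<longlongrightarrow> Q (ap (sqm X) u) v + Q u (ap (sqm X) v)) (at 0)" by simp
    then have "Q (ap (sqm X) u) v + Q u (ap (sqm X) v) = 0" by (simp add: tendsto_const_iff)
    then show "Q (X *v u) v = - Q u (X *v v)" by (simp add: ap_def)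
  qed
qed

lemma skew_cm: "skew (cm X) \<longleftrightarrow> rskew X"
proof
  assume s: "skew (cm X)"
  show "rskew X"
    unfolding rskew_def
  proof (intro allI)
    fix u v
    let ?c = "\<lambda>x. (\<chi> i. of_real (x $ i)) :: complex ^ 'n"
    have c: "re_vec (?c x) = x" "im_vec (?c x) = 0" for x by (simp_all add: re_vec_def im_vec_def vec_eq_iff)
    have "QC (ap (cm X) (?c u)) (?c v) = - QC (?c u) (ap (cm X) (?c v))" using s by (simp add: skew_def)
    then show "Q (X *v u) v = - Q u (X *v v)"
      by (simp add: complexify_form_def re_im_cm c Q_simps complex_eq_iff)
  qed
qed (simp add: skew_def rskew_def complexify_form_def re_im_cm complex_eq_iff)

lemma g_complex_cm: "complexify_mat X \<in> g_complex Q \<longleftrightarrow> rskew X"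
proof -
  have "map_matrix Re (complexify_mat X) = X" "map_matrix Im (complexify_mat X) = 0"
    by (simp_all add: complexify_mat_def map_matrix_def vec_eq_iff)
  moreover have "rskew 0" by (simp add: rskew_def Q_simps)
  ultimately show ?thesis by (simp add: g_complex_def g_real_iff)
qed

lemma period_domain_pol_hodge: "\<Phi> \<in> period_domain Q w h \<Longrightarrow> pol_hodge \<Phi>"
  by (simp add: period_domain_def pol_hodge_def)

lemma nilpotent_orbit_pol_hodge:
  assumes "nilpotent_orbit Q w h F m Ns"
  shows "\<exists>c. \<forall>\<tau>. (\<forall>i\<in>{1..m}. \<tau> i > c) \<longrightarrow> pol_hodge (flow (exp (scal \<i> * cm (\<Sum>i=1..m. \<tau> i *\<^sub>R Ns i))) F)"
proof -
  obtain c where c: "\<And>z::nat \<Rightarrow> complex. (\<forall>i\<in>{1..m}. Im (z i) > c) \<Longrightarrow>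
        (\<lambda>p. (*v) (mat_exp (\<Sum>i=1..m. map_matrix (\<lambda>x. z i * complex_of_real x) (Ns i))) ` F p) \<in> period_domain Q w h"
    using assms unfolding nilpotent_orbit_def by blast
  show ?thesis
  proof (intro exI[of _ c] allI impI)
    fix \<tau> :: "nat \<Rightarrow> real" assume "\<forall>i\<in>{1..m}. \<tau> i > c"
    then have "(\<lambda>p. (*v) (mat_exp (\<Sum>i=1..m. map_matrix (\<lambda>x. (\<i> * of_real (\<tau> i)) * complex_of_real x) (Ns i))) ` F p) \<in> period_domain Q w h"
      by (intro c) simp
    moreover have "sqm (\<Sum>i=1..m. map_matrix (\<lambda>x. (\<i> * of_real (\<tau> i)) * complex_of_real x) (Ns i)) = scal \<i> * cm (\<Sum>i=1..m. \<tau> i *\<^sub>R Ns i)"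
      by (rule mat_of_inject[THEN iffD1])
         (simp add: vec_eq_iff mat_of_scal cpx_def complexify_mat_def map_matrix_def sum_distrib_left mult.assoc del: mat_of_simps)
    ultimately have "flow (exp (scal \<i> * cm (\<Sum>i=1..m. \<tau> i *\<^sub>R Ns i))) F \<in> period_domain Q w h"
      by (simp add: flow_def mat_exp_eq ap_def[abs_def])
    then show "pol_hodge (flow (exp (scal \<i> * cm (\<Sum>i=1..m. \<tau> i *\<^sub>R Ns i))) F)" by (rule period_domain_pol_hodge)
  qed
qed

end

section \<open>Orbits of the group of type (0,0)\<close>

context split_pol
begin

definition real_gl :: "int \<Rightarrow> (real ^ 'n ^ 'n) set" where "real_gl a = {A. rskew A \<and> cm A \<in> gl a a}"

lemma g_bigraded_iff: "complexify_mat X \<in> g_bigraded Q W F a a \<longleftrightarrow> X \<in> real_gl a"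
  by (simp add: g_bigraded_def g_complex_cm gl_iff real_gl_def ap_cm[abs_def])

lemma g_bigraded_real_eq: "g_bigraded_real Q W F a = real_gl a"
  by (auto simp: g_bigraded_real_def g_bigraded_iff) (simp add: g_real_iff real_gl_def)

lemma gl_linear: "0 \<in> gl a b" "X \<in> gl a b \<Longrightarrow> Y \<in> gl a b \<Longrightarrow> X + Y \<in> gl a b" "X \<in> gl a b \<Longrightarrow> c *\<^sub>R X \<in> gl a b"
  by (simp_all add: gl_def distrib_left distrib_right)

lemma subspace_real_gl: "subspace (real_gl a)"
  by (auto simp: subspace_def real_gl_def rskew_def sqm_simps gl_linear Q_simps matrix_vector_mult_add_rdistrib scaleR_matrix_vector_mult)

end

locale orbit_group = split_pol Q w W F
  for Q :: "real ^ 'n::finite \<Rightarrow> real ^ 'n \<Rightarrow> real" and w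
    and W :: "int \<Rightarrow> (real ^ 'n) set" and F :: "int \<Rightarrow> (complex ^ 'n) set" +
  fixes M :: "(real ^ 'n ^ 'n) set"
  assumes con: "connected_Lie_subgroup (Aut_form Q) M" and lieM: "lie_algebra M = real_gl 0"
begin

lemma M_exp: "X \<in> real_gl 0 \<Longrightarrow> mat_exp X \<in> M"
  unfolding lieM[symmetric] lie_algebra_def by (metis (mono_tags, lifting) mem_Collect_eq scaleR_one)

lemma cm_mat_exp: "cm (mat_exp X) = exp (cm X)"
  by (simp add: mat_exp_eq cpx_exp)

text \<open>
  Elements of \<open>M\<close> are products of exponentials of endomorphisms that preserve each piece of the bigrading.
\<close>

lemma M_gl: assumes "g \<in> M" shows "cm g \<in> gl 0 0"
proof -
  have one: "cm (mat 1) \<in> gl 0 0" by (simp add: sqm_simps gl_def E_mult)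
  have ex: "cm (mat_exp X) \<in> gl 0 0" if "X \<in> real_gl 0" for X
    unfolding gl_iff cm_mat_exp
  proof clarify
    fix r s v assume v: "v \<in> I r s"
    show "ap (exp (cm X)) v \<in> I (r + 0) (s + 0)"
      using closed_exp_invariant[OF complex_subspace_imp_real[OF subspace_deligne[of r s]], of "cm X" v]
        gl_ap[of "cm X" 0 0 _ r s] that v by (simp add: real_gl_def)
  qed
  obtain Xs where Xs: "set Xs \<subseteq> real_gl 0" "g = foldr (\<lambda>X a. mat_exp X ** a) Xs (mat 1)"
    using con assms unfolding connected_Lie_subgroup_def lieM by blast
  have "set Xs \<subseteq> real_gl 0 \<Longrightarrow> cm (foldr (\<lambda>X a. mat_exp X ** a) Xs (mat 1)) \<in> gl 0 0" for Xs
  proof (induction Xs)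
    case (Cons X Xs)
    then show ?case using gl_mult[OF ex[of X], of _ 0 0] by (simp add: sqm_simps)
  qed (simp add: one)
  then show ?thesis using Xs by blast
qed

lemma M_group: "mat 1 \<in> M" "g \<in> M \<Longrightarrow> h \<in> M \<Longrightarrow> g ** h \<in> M" "g \<in> M \<Longrightarrow> matrix_inv g \<in> M"
  and M_Aut: "g \<in> M \<Longrightarrow> invertible g" "g \<in> M \<Longrightarrow> Q (g *v u) (g *v v) = Q u v"
  using con unfolding connected_Lie_subgroup_def Aut_form_def by blast+

lemma M_inv: assumes "g \<in> M" shows "g ** matrix_inv g = mat 1" "matrix_inv g ** g = mat 1"
  using matrix_inv_inverse[OF M_Aut(1)[OF assms]] by simp_all

lemma Ad_real_gl: assumes g: "g \<in> M" and T: "T \<in> real_gl a" shows "g ** T ** matrix_inv g \<in> real_gl a"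
proof -
  let ?i = "matrix_inv g"
  have inv: "g *v (?i *v v) = v" for v by (simp add: matrix_vector_mul_assoc M_inv[OF g])
  have "Q ((g ** T ** ?i) *v u) v = - Q u ((g ** T ** ?i) *v v)" for u v
  proof -
    have "Q ((g ** T ** ?i) *v u) v = Q (g *v (T *v (?i *v u))) (g *v (?i *v v))"
      by (simp add: inv) (simp add: matrix_vector_mul_assoc matrix_mul_assoc)
    also have "\<dots> = Q (T *v (?i *v u)) (?i *v v)" by (rule M_Aut(2)[OF g])
    also have "\<dots> = - Q (?i *v u) (T *v (?i *v v))" using T by (simp add: real_gl_def rskew_def)
    also have "\<dots> = - Q (g *v (?i *v u)) (g *v (T *v (?i *v v)))" by (simp only: M_Aut(2)[OF g])
    also have "\<dots> = - Q u ((g ** T ** ?i) *v v)"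
      by (simp add: inv) (simp add: matrix_vector_mul_assoc matrix_mul_assoc)
    finally show ?thesis .
  qed
  moreover have "cm g * cm T * cm ?i \<in> gl (0 + a + 0) (0 + a + 0)"
    using T by (intro gl_mult M_gl g M_group) (simp add: real_gl_def)
  ultimately show ?thesis by (simp add: real_gl_def rskew_def sqm_simps)
qed

lemma Ad_orbit_sym: assumes "B \<in> Ad_orbit M A" shows "A \<in> Ad_orbit M B"
proof -
  obtain g where g: "g \<in> M" "B = g ** A ** matrix_inv g" using assms by (auto simp: Ad_orbit_def)
  have ii: "matrix_inv (matrix_inv g) = g" by (rule matrix_inv_eq) (simp_all add: M_inv[OF g(1)])
  have "matrix_inv g ** B ** g = (matrix_inv g ** g) ** A ** (matrix_inv g ** g)"
    by (simp only: g(2) matrix_mul_assoc)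
  then have "A = matrix_inv g ** B ** matrix_inv (matrix_inv g)" by (simp add: ii M_inv[OF g(1)])
  then show ?thesis using M_group(3)[OF g(1)] by (auto simp: Ad_orbit_def)
qed

lemma Ad_orbit_trans: assumes "B \<in> Ad_orbit M A" "C \<in> Ad_orbit M B" shows "C \<in> Ad_orbit M A"
proof -
  obtain g h where g: "g \<in> M" "B = g ** A ** matrix_inv g" and h: "h \<in> M" "C = h ** B ** matrix_inv h"
    using assms by (auto simp: Ad_orbit_def)
  have "matrix_inv (h ** g) = matrix_inv g ** matrix_inv h"
  proof (rule matrix_inv_eq)
    have "h ** g ** (matrix_inv g ** matrix_inv h) = h ** (g ** matrix_inv g) ** matrix_inv h"
      by (simp only: matrix_mul_assoc)
    then show "h ** g ** (matrix_inv g ** matrix_inv h) = mat 1" by (simp add: M_inv g h)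
    have "matrix_inv g ** matrix_inv h ** (h ** g) = matrix_inv g ** (matrix_inv h ** h) ** g"
      by (simp only: matrix_mul_assoc)
    then show "matrix_inv g ** matrix_inv h ** (h ** g) = mat 1" by (simp add: M_inv g h)
  qed
  then have "C = (h ** g) ** A ** matrix_inv (h ** g)" by (simp add: g(2) h(2) matrix_mul_assoc)
  then show ?thesis using M_group(2)[OF h(1) g(1)] by (auto simp: Ad_orbit_def)
qed

text \<open>
  The bracket with \<open>N\<close> has a linear right inverse \<open>Lf\<close> on \<open>real_gl (-1)\<close>. The map
  \<open>Z \<mapsto> Ad (exp (Lf (pr Z))) N + (Z - pr Z)\<close>, with \<open>pr\<close> a projection onto \<open>real_gl (-1)\<close>, has the identity as
  derivative at \<open>0\<close>, so its image is a neighbourhood of \<open>N\<close>. The second summand makes the derivative onto in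
  the space of all matrices; it is zero whenever the value lies in \<open>real_gl (-1)\<close>.
\<close>

lemma orbit_open:
  assumes N: "N \<in> real_gl (-1)" and inj: "\<And>X. X \<in> gl 1 1 \<Longrightarrow> X * cm N = cm N * X \<Longrightarrow> X = 0"
  obtains U where "open U" "N \<in> U" "U \<inter> real_gl (-1) \<subseteq> Ad_orbit M N"
proof -
  define br where "br Z = Z ** N - N ** Z" for Z :: "real ^ 'n ^ 'n"
  have linbr: "linear br"
    by (rule linearI) (simp_all add: br_def matrix_mult_add_rdistrib matrix_add_ldistrib scaleR_matrix_mult scaleR_diff_right)
  have onto: "T \<in> br ` real_gl 0" if T: "T \<in> real_gl (-1)" for T
  proof -
    obtain Z where Z: "Z \<in> gl 0 0" "cj Z = Z" "skew Z" "Z * cm N - cm N * Z = cm T"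
      using bracket_surjective[of "cm N" "cm T"] N T inj by (auto simp: real_gl_def skew_cm)
    obtain A where A: "Z = cm A" using real_cm[OF Z(2)] by blast
    have "cm (br A) = cm T" using Z(4) by (simp add: A br_def sqm_simps)
    then have "T = br A" by (simp add: cm_inj)
    moreover have "A \<in> real_gl 0" using Z by (simp add: real_gl_def A skew_cm)
    ultimately show ?thesis by blast
  qed
  obtain Lf where Lf: "range Lf \<subseteq> real_gl 0" "linear Lf" "\<And>T. T \<in> real_gl (-1) \<Longrightarrow> br (Lf T) = T"
    using linear_exists_right_inverse_on[OF linbr subspace_real_gl[of 0]] onto by blast
  obtain pr where pr: "range pr \<subseteq> real_gl (-1)" "linear pr" "\<And>T. T \<in> real_gl (-1) \<Longrightarrow> pr T = T"
    using linear_exists_left_inverse_on[OF linear_id subspace_real_gl[of "-1"]] by auto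
  define A where "A Z = sqm (Lf (pr Z))" for Z
  have "linear (\<lambda>Z. Lf (pr Z))" using linear_compose[OF pr(2) Lf(2)] by (simp add: o_def)
  then have "bounded_linear (\<lambda>Z. Lf (pr Z))" by (simp add: linear_conv_bounded_linear)
  then have blA: "bounded_linear A"
    unfolding A_def[abs_def] by (rule bounded_linear_compose[OF bounded_linear_sqm])
  then have blA': "bounded_linear (\<lambda>Z. - A Z)" by (rule bounded_linear_minus)
  have A0: "A 0 = 0" using blA by (simp add: bounded_linear.linear linear_0)
  define f where "f Z = mat_of (exp (A Z) * sqm N * exp (- A Z)) + (Z - pr Z)" for Z
  have blpr: "bounded_linear pr" using pr(2) by (simp add: linear_conv_bounded_linear)
  have cA: "continuous_on UNIV (\<lambda>Z. exp (A Z))" "continuous_on UNIV (\<lambda>Z. exp (- A Z))"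
    by (rule continuous_on_compose2[OF continuous_exp_banach_algebra linear_continuous_on[OF blA] subset_UNIV])
       (rule continuous_on_compose2[OF continuous_exp_banach_algebra linear_continuous_on[OF blA'] subset_UNIV])
  have contf: "continuous_on UNIV f"
    unfolding f_def
    by (intro continuous_intros linear_continuous_on[OF blpr] cA
        bounded_linear.continuous_on[OF bounded_linear_mat_of])
  have prgl: "pr Z \<in> real_gl (-1)" for Z using pr(1) by blast
  have derf: "(f has_derivative id) (at 0)"
  proof -
    have "((\<lambda>Z. exp (A Z) * sqm N) has_derivative (\<lambda>h. A h * sqm N)) (at 0)"
      by (rule has_derivative_mult_left[OF exp_has_derivative_at_0[OF blA]])
    then have "((\<lambda>Z. exp (A Z) * sqm N * exp (- A Z)) has_derivative
        (\<lambda>h. exp (A 0) * sqm N * (- A h) + (A h * sqm N) * exp (- A 0))) (at 0)"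
      by (rule has_derivative_mult[OF _ exp_has_derivative_at_0[OF blA']])
    then have "((\<lambda>Z. mat_of (exp (A Z) * sqm N * exp (- A Z))) has_derivative
        (\<lambda>h. mat_of (exp (A 0) * sqm N * (- A h) + (A h * sqm N) * exp (- A 0)))) (at 0)"
      by (rule bounded_linear.has_derivative[OF bounded_linear_mat_of])
    moreover have "((\<lambda>Z. Z - pr Z) has_derivative (\<lambda>h. h - pr h)) (at 0)"
      by (intro has_derivative_diff has_derivative_ident bounded_linear_imp_has_derivative blpr)
    ultimately have d1: "(f has_derivative (\<lambda>h. mat_of (exp (A 0) * sqm N * (- A h) + (A h * sqm N) * exp (- A 0)) + (h - pr h))) (at 0)"
      unfolding f_def[abs_def] by (rule has_derivative_add)
    have d2: "mat_of (exp (A 0) * sqm N * (- A h) + (A h * sqm N) * exp (- A 0)) + (h - pr h) = id h" for h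
    proof -
      have "mat_of (exp (A 0) * sqm N * (- A h) + (A h * sqm N) * exp (- A 0)) = mat_of (A h * sqm N - sqm N * A h)"
        by (simp only: A0) (simp del: mat_of_simps)
      also have "\<dots> = br (Lf (pr h))" by (simp add: A_def br_def)
      finally show ?thesis using Lf(3)[OF prgl] by simp
    qed
    show ?thesis using d1 unfolding d2 by (simp add: id_def)
  qed
  have "f 0 \<in> interior (f ` UNIV)"
    by (rule sussmann_open_mapping[OF open_UNIV contf UNIV_I derf bounded_linear_ident]) (auto simp: o_def id_def)
  moreover have "f 0 = N" using linear_0[OF pr(2)] by (simp add: f_def A0)
  ultimately have "N \<in> interior (range f)" by simp
  moreover have "interior (range f) \<inter> real_gl (-1) \<subseteq> Ad_orbit M N"
  proof
    fix B assume B: "B \<in> interior (range f) \<inter> real_gl (-1)"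
    then obtain Z where Z: "B = f Z" using interior_subset by blast
    define g where "g = mat_exp (Lf (pr Z))"
    have gM: "g \<in> M" unfolding g_def by (rule M_exp) (use Lf(1) in blast)
    have m: "sqm (- X) = - sqm X" for X :: "real ^ 'n ^ 'n" by (simp add: uminus_sqmat_def)
    have "matrix_inv g = mat_exp (- Lf (pr Z))"
      unfolding g_def by (rule matrix_inv_eq) (rule mat_exp_inverse)+
    then have Ad: "mat_of (exp (A Z) * sqm N * exp (- A Z)) = g ** N ** matrix_inv g"
      by (simp add: g_def mat_exp_eq A_def m)
    have "B - g ** N ** matrix_inv g \<in> real_gl (-1)"
      using B by (intro subspace_diff[OF subspace_real_gl] Ad_real_gl gM N) simp
    then have "Z - pr Z \<in> real_gl (-1)" by (simp add: Z f_def Ad del: mat_of_simps)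
    then have "Z - pr Z = pr (Z - pr Z)" by (simp add: pr(3))
    also have "\<dots> = 0" by (simp add: linear_diff[OF pr(2)] pr(3)[OF prgl])
    finally have "B = g ** N ** matrix_inv g" by (simp add: Z f_def Ad del: mat_of_simps)
    then show "B \<in> Ad_orbit M N" using gM by (auto simp: Ad_orbit_def)
  qed
  ultimately show thesis by (intro that[OF open_interior])
qed

end

section \<open>Nilpotent cones\<close>

lemma nilpotent_cone_memI:
  assumes "\<And>i. i \<in> {1..m} \<Longrightarrow> \<tau> i > 0"
  shows "(\<Sum>i=1..m. \<tau> i *\<^sub>R Ns i) \<in> nilpotent_cone m Ns"
  unfolding nilpotent_cone_def by (rule CollectI, rule exI[of _ \<tau>]) (use assms in simp)

context split_pol
begin

text \<open>
  The hypotheses of \<open>commuting_type\<close> concern the two-parameter family \<open>yN + s N\<^sub>j\<close>, whose coordinates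
  \<open>y t\<^sub>i + s \<delta>\<^sub>i\<^sub>j\<close> stay large when \<open>y\<close> is large and \<open>\<bar>s\<bar> \<le> t\<^sub>j y / 2\<close>.
\<close>

lemma cone_generator_type:
  assumes orb: "nilpotent_orbit Q w h F m Ns" and t: "\<And>i. i \<in> {1..m} \<Longrightarrow> t i > 0"
    and N: "N = (\<Sum>i=1..m. t i *\<^sub>R Ns i)" "cm N \<in> gl (-1) (-1)" and j: "j \<in> {1..m}"
  shows "Ns j \<in> real_gl (-1)"
proof -
  have props: "Ns j \<in> g_real Q" "nilpotent_mat (Ns j)" "\<And>i. i \<in> {1..m} \<Longrightarrow> Ns j ** Ns i = Ns i ** Ns j"
    "\<And>p. (*v) (complexify_mat (Ns j)) ` F p \<subseteq> F (p - 1)"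
    using orb j unfolding nilpotent_orbit_def by blast+
  obtain c where c0: "\<forall>\<tau>. (\<forall>i\<in>{1..m}. \<tau> i > c) \<longrightarrow> pol_hodge (flow (exp (scal \<i> * cm (\<Sum>i=1..m. \<tau> i *\<^sub>R Ns i))) F)"
    by (rule exE[OF nilpotent_orbit_pol_hodge[OF orb]])
  have c: "pol_hodge (flow (exp (scal \<i> * cm (\<Sum>i=1..m. \<tau> i *\<^sub>R Ns i))) F)" if "\<And>i. i \<in> {1..m} \<Longrightarrow> \<tau> i > c" for \<tau>
    using c0 that by blast
  obtain n where n: "mat_power (Ns j) n = 0" using props(2) by (auto simp: nilpotent_mat_def)
  \<comment> \<open>Makes \<open>y t\<^sub>i / 2 > c\<close> for all \<open>i\<close> at once when \<open>y \<ge> y0\<close>, with room for \<open>\<bar>s\<bar> \<le> t\<^sub>j y / 2\<close>.\<close>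
  define y0 where "y0 = 1 + (\<Sum>i=1..m. 2 * \<bar>c\<bar> / t i)"
  have y0: "y * t i / 2 > c" if "y \<ge> y0" "i \<in> {1..m}" for y i
  proof -
    have "2 * \<bar>c\<bar> / t i \<le> (\<Sum>i=1..m. 2 * \<bar>c\<bar> / t i)"
      by (rule member_le_sum[OF that(2)]) (use t in \<open>auto intro!: divide_nonneg_pos\<close>)
    then have "2 * \<bar>c\<bar> / t i < y" using that(1) by (simp add: y0_def)
    then show ?thesis using t[OF that(2)] by (simp add: field_simps)
  qed
  have "y0 \<ge> 0" using t unfolding y0_def by (intro add_nonneg_nonneg sum_nonneg) (auto intro!: divide_nonneg_pos)
  have "cm (Ns j) \<in> gl (-1) (-1)"
  proof (rule commuting_type[OF N(2), where \<rho> = "t j / 2" and ?y0.0 = y0 and n = n])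
    show "skew (cm (Ns j))" using props(1) by (simp add: g_real_iff skew_cm)
    show "cm (Ns j) * cm N = cm N * cm (Ns j)"
    proof -
      have "sqm (Ns j) * sqm (Ns i) = sqm (Ns i) * sqm (Ns j)" if "i \<in> {1..m}" for i
        using props(3)[OF that] by (simp flip: sqm_simps)
      then have "sqm (Ns j) * sqm N = sqm N * sqm (Ns j)"
        by (simp add: N(1) sqm_sum sqm_simps sum_distrib_left sum_distrib_right)
      from arg_cong[OF this, of cpx] show ?thesis by simp
    qed
    show "cm (Ns j) ^ n = 0"
    proof -
      have "sqm (Ns j) ^ n = 0" using n mat_of_power[of "sqm (Ns j)" n] by (metis mat_of_inverse sqm_simps(6) mat_of_simps(1) sqm_inverse UNIV_I)
      then show ?thesis by (simp flip: cpx_power)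
    qed
    show "ap (cm (Ns j)) v \<in> F (p - 1)" if "v \<in> F p" for p v using props(4)[of p] that by (auto simp: ap_cm)
    show "t j / 2 > 0" using t[OF j] by simp
    fix y s :: real assume y: "y0 \<le> y" and s: "\<bar>s\<bar> \<le> t j / 2 * y"
    have ypos: "y \<ge> 0" using y \<open>y0 \<ge> 0\<close> by simp
    define \<tau> where "\<tau> i = y * t i + (if i = j then s else 0)" for i
    have "\<tau> i > c" if "i \<in> {1..m}" for i
    proof -
      have "y * t i \<ge> 0" using ypos t[OF that] by simp
      moreover have "i = j \<Longrightarrow> s \<ge> - (y * t i / 2)" using s by (simp add: abs_le_iff mult.commute)
      ultimately show ?thesis using y0[OF y that] by (auto simp: \<tau>_def)
    qed
    then have "pol_hodge (flow (exp (scal \<i> * cm (\<Sum>i=1..m. \<tau> i *\<^sub>R Ns i))) F)" by (rule c)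
    moreover have "(\<Sum>i=1..m. \<tau> i *\<^sub>R Ns i) = y *\<^sub>R N + s *\<^sub>R Ns j"
    proof -
      have "(\<Sum>i=1..m. (if i = j then s else 0) *\<^sub>R Ns i) = s *\<^sub>R Ns j"
        using j by (simp add: if_distrib[of "\<lambda>x. x *\<^sub>R _"] cong: if_cong)
      then show ?thesis by (simp add: \<tau>_def N(1) scaleR_add_left sum.distrib scaleR_sum_right)
    qed
    ultimately show "pol_hodge (flow (exp (scal \<i> * (y *\<^sub>R cm N + s *\<^sub>R cm (Ns j)))) F)"
      by (simp add: sqm_simps)
  qed simp_all
  then show ?thesis using props(1) by (simp add: real_gl_def g_real_iff)
qed

text \<open>
  The ray through \<open>A\<close> is itself a nilpotent orbit in one variable.
\<close>

lemma cone_injective: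
  assumes orb: "nilpotent_orbit Q w h F m Ns" and A: "A \<in> nilpotent_cone m Ns"
    and X: "X \<in> gl 1 1" "X * cm A = cm A * X"
  shows "X = 0"
proof -
  obtain t where t: "A = (\<Sum>i=1..m. t i *\<^sub>R Ns i)" "\<And>i. i \<in> {1..m} \<Longrightarrow> t i > 0"
    using A by (auto simp: nilpotent_cone_def)
  obtain c where c0: "\<forall>\<tau>. (\<forall>i\<in>{1..m}. \<tau> i > c) \<longrightarrow> pol_hodge (flow (exp (scal \<i> * cm (\<Sum>i=1..m. \<tau> i *\<^sub>R Ns i))) F)"
    by (rule exE[OF nilpotent_orbit_pol_hodge[OF orb]])
  have c: "pol_hodge (flow (exp (scal \<i> * cm (\<Sum>i=1..m. \<tau> i *\<^sub>R Ns i))) F)" if "\<And>i. i \<in> {1..m} \<Longrightarrow> \<tau> i > c" for \<tau>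
    using c0 that by blast
  define y where "y = 1 + (\<Sum>i=1..m. \<bar>c\<bar> / t i)"
  have "y * t i > c" if "i \<in> {1..m}" for i
  proof -
    have "\<bar>c\<bar> / t i \<le> (\<Sum>i=1..m. \<bar>c\<bar> / t i)"
      by (rule member_le_sum[OF that]) (use t in \<open>auto intro!: divide_nonneg_pos\<close>)
    then have "\<bar>c\<bar> / t i < y" by (simp add: y_def)
    then show ?thesis using t(2)[OF that] by (simp add: field_simps)
  qed
  then have "pol_hodge (flow (exp (scal \<i> * cm (\<Sum>i=1..m. (y * t i) *\<^sub>R Ns i))) F)" by (rule c)
  moreover have "(\<Sum>i=1..m. (y * t i) *\<^sub>R Ns i) = y *\<^sub>R A" by (simp add: t(1) scaleR_sum_right)
  ultimately have "pol_hodge (flow (imag_exp y (cm A)) F)" by (simp add: imag_exp_def sqm_simps)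
  from commuting_positive_zero[OF _ this X(1) _ X(2)] show ?thesis by simp
qed

end

text \<open>
  Lying in the same orbit is an equivalence relation on the cone with open classes, and the cone is connected.
\<close>

lemma (in orbit_group) cone_in_orbit:
  assumes orb: "nilpotent_orbit Q w h F m Ns" and N: "N \<in> nilpotent_cone m Ns" "cm N \<in> gl (-1) (-1)"
  shows "nilpotent_cone m Ns \<subseteq> Ad_orbit M N" "\<forall>i\<in>{1..m}. Ns i \<in> closure (nilpotent_cone m Ns)"
    "\<And>A. A \<in> Ad_orbit M N \<Longrightarrow> A \<in> real_gl (-1)"
proof -
  obtain t where t: "N = (\<Sum>i=1..m. t i *\<^sub>R Ns i)" "\<And>i. i \<in> {1..m} \<Longrightarrow> t i > 0"
    using N(1) by (auto simp: nilpotent_cone_def)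
  have gen: "Ns i \<in> real_gl (-1)" if "i \<in> {1..m}" for i by (rule cone_generator_type[OF orb t(2,1) N(2) that])
  have cone: "A \<in> real_gl (-1)" if "A \<in> nilpotent_cone m Ns" for A
    using that by (auto simp: nilpotent_cone_def intro!: subspace_sum[OF subspace_real_gl] subspace_scale[OF subspace_real_gl] gen)
  show "A \<in> real_gl (-1)" if "A \<in> Ad_orbit M N" for A
    using that cone[OF N(1)] Ad_real_gl by (auto simp: Ad_orbit_def)
  have "convex (nilpotent_cone m Ns)"
    unfolding convex_alt
  proof (intro ballI allI impI)
    fix x y and u :: real assume x: "x \<in> nilpotent_cone m Ns" and y: "y \<in> nilpotent_cone m Ns" and u: "0 \<le> u \<and> u \<le> 1"
    obtain a where a: "x = (\<Sum>i=1..m. a i *\<^sub>R Ns i)" "\<forall>i\<in>{1..m}. a i > 0" using x by (auto simp: nilpotent_cone_def)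
    obtain b where b: "y = (\<Sum>i=1..m. b i *\<^sub>R Ns i)" "\<forall>i\<in>{1..m}. b i > 0" using y by (auto simp: nilpotent_cone_def)
    have pos: "(1 - u) * a i + u * b i > 0" if "i \<in> {1..m}" for i
    proof (cases "u = 0")
      case False
      then have "u * b i > 0" using b(2) u that by (intro mult_pos_pos) auto
      moreover have "(1 - u) * a i \<ge> 0"
        using a(2) u that by (intro mult_nonneg_nonneg) (auto intro: less_imp_le)
      ultimately show ?thesis by linarith
    qed (use a that in simp)
    have "(1 - u) *\<^sub>R x + u *\<^sub>R y = (\<Sum>i=1..m. ((1 - u) * a i + u * b i) *\<^sub>R Ns i)"
      by (simp add: a(1) b(1) scaleR_sum_right scaleR_add_left sum.distrib)
    then show "(1 - u) *\<^sub>R x + u *\<^sub>R y \<in> nilpotent_cone m Ns"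
      using nilpotent_cone_memI[of m "\<lambda>i. (1 - u) * a i + u * b i" Ns] pos by simp
  qed
  then have con: "connected (nilpotent_cone m Ns)" by (rule convex_connected)
  show "nilpotent_cone m Ns \<subseteq> Ad_orbit M N"
  proof
    fix A assume A: "A \<in> nilpotent_cone m Ns"
    show "A \<in> Ad_orbit M N"
    proof (rule connected_equivalence_relation[OF con N(1) A, where R = "\<lambda>x y. y \<in> Ad_orbit M x"])
      fix B assume B: "B \<in> nilpotent_cone m Ns"
      obtain U where U: "open U" "B \<in> U" "U \<inter> real_gl (-1) \<subseteq> Ad_orbit M B"
        by (rule orbit_open[OF cone[OF B] cone_injective[OF orb B]])
      show "\<exists>T. openin (top_of_set (nilpotent_cone m Ns)) T \<and> B \<in> T \<and> (\<forall>x\<in>T. x \<in> Ad_orbit M B)"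
        using U B cone by (intro exI[of _ "nilpotent_cone m Ns \<inter> U"]) (auto intro: openin_open_Int)
    qed (blast intro: Ad_orbit_sym Ad_orbit_trans)+
  qed
  show "\<forall>i\<in>{1..m}. Ns i \<in> closure (nilpotent_cone m Ns)"
  proof
    fix j assume j: "j \<in> {1..m}"
    have "Ns j + (1 / real (Suc k)) *\<^sub>R N \<in> nilpotent_cone m Ns" for k
    proof -
      define \<tau> where "\<tau> i = 1 / real (Suc k) * t i + (if i = j then 1 else 0)" for i
      have "(\<Sum>i=1..m. (if i = j then 1 else 0) *\<^sub>R Ns i) = Ns j"
        using j by (simp add: if_distrib[of "\<lambda>x. x *\<^sub>R _"] cong: if_cong)
      then have "Ns j + (1 / real (Suc k)) *\<^sub>R N = (\<Sum>i=1..m. \<tau> i *\<^sub>R Ns i)"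
        by (simp add: \<tau>_def t(1) scaleR_add_left sum.distrib scaleR_sum_right del: of_nat_Suc)
      moreover have "\<tau> i > 0" if "i \<in> {1..m}" for i
        unfolding \<tau>_def using t(2)[OF that] by (intro add_pos_nonneg) auto
      ultimately show ?thesis using nilpotent_cone_memI[of m \<tau> Ns] by simp
    qed
    moreover have "(\<lambda>k. Ns j + (1 / real (Suc k)) *\<^sub>R N) \<longlonglongrightarrow> Ns j + 0 *\<^sub>R N"
      by (intro tendsto_intros LIMSEQ_Suc[OF lim_1_over_n])
    ultimately show "Ns j \<in> closure (nilpotent_cone m Ns)"
      unfolding closure_sequential by (intro exI[of _ "\<lambda>k. Ns j + (1 / real (Suc k)) *\<^sub>R N"]) simp
  qed
qed

theorem corollary3p6:
  fixes VQ :: "(real ^ 'n) set"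
    and w :: int
    and Q :: "real ^ 'n \<Rightarrow> real ^ 'n \<Rightarrow> real"
    and h :: "int \<Rightarrow> nat"
    and F :: "int \<Rightarrow> (complex ^ 'n) set"
    and N :: "real ^ 'n ^ 'n"
    and WN W :: "int \<Rightarrow> (real ^ 'n) set"
    and M N0 :: "(real ^ 'n ^ 'n) set"
    and m :: nat
    and Ns :: "nat \<Rightarrow> real ^ 'n ^ 'n"
  assumes "rational_structure VQ"
    and "polarization_form VQ w Q"
    and "nilpotent_orbit Q w h F 1 (\<lambda>_. N)"
    and "monodromy_weight_filtration N WN"
    and "W = shift_filtration w WN"
    and "R_split_MHS W F"
    and "connected_Lie_subgroup (Aut_form Q) M"
    and "lie_algebra M = g_bigraded_real Q W F 0"
    and "N0 = Ad_orbit M N"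
    and "nilpotent_orbit Q w h F m Ns"
    and "N \<in> nilpotent_cone m Ns"
  shows "nilpotent_cone m Ns \<subseteq> N0 \<and>
         complexify_mat ` N0 \<subseteq> g_bigraded Q W F (-1) (-1) \<and>
         (\<forall>i\<in>{1..m}. Ns i \<in> closure N0)"
proof -
  interpret polform Q w
    by unfold_locales (use assms(2) in \<open>unfold polarization_form_def, blast+\<close>)
  have N: "rskew N" and N_shift: "\<And>p. (*v) (complexify_mat N) ` F p \<subseteq> F (p - 1)"
    and first: "first_bilinear_relation Q w F"
    using assms(3) by (simp_all add: nilpotent_orbit_def compact_dual_def g_real_iff)
  interpret split_pol Q w W F
  proof unfold_locales
    show "mixed_hodge_structure W F" "\<And>p q. cnj_vec ` deligne W F p q = deligne W F q p"
      using assms(6) by (simp_all add: R_split_MHS_def)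
    show "first_bilinear_relation Q w F" by (rule first)
    fix k l u v assume kl: "k + l < 2 * w" and u: "u \<in> W k" and v: "v \<in> W l"
    have skN: "Q (N *v u) v = - Q u (N *v v)" for u v using N by (simp add: rskew_def)
    show "Q u v = 0"
      by (rule weight_filtration_orthogonal[OF assms(4) skN, of "k - w" "l - w"])
         (use kl u v in \<open>simp_all add: assms(5) shift_filtration_def\<close>)
  qed
  interpret orbit_group Q w W F M
  proof unfold_locales
    show "connected_Lie_subgroup (Aut_form Q) M" by (rule assms(7))
    show "lie_algebra M = real_gl 0" using assms(8) unfolding g_bigraded_real_eq .
  qed
  have N_weight: "(*v) N ` W k \<subseteq> W (k - 2)" for k
  proof -
    have "(*v) N ` WN (k - w) \<subseteq> WN (k - w - 2)"
      using assms(4) unfolding monodromy_weight_filtration_def by blast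
    moreover have "k - w - 2 = k - 2 - w" by simp
    ultimately show ?thesis unfolding assms(5) shift_filtration_def by (simp only:)
  qed
  have "cm N \<in> gl (-1) (-1)"
    unfolding gl_iff
  proof clarify
    fix r s v assume v: "v \<in> I r s"
    have "cnj_vec (ap (cm N) v) = ap (cm N) (cnj_vec v)" by (simp add: cnj_vec_ap)
    moreover have "ap (cm N) x \<in> F (p - 1)" if "x \<in> F p" for x p using N_shift[of p] that by (auto simp: ap_cm)
    moreover have "ap (cm N) v \<in> CW (r + s - 2)"
      using deligne_type(3)[OF v] N_weight[of "r + s"] by (auto simp: complexify_space_def re_im_cm)
    ultimately show "ap (cm N) v \<in> I (r + - 1) (s + - 1)"
      unfolding deligne_iff using deligne_type(1,2)[OF v] by (simp add: algebra_simps)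
  qed
  note main = cone_in_orbit[OF assms(10,11) this]
  have "complexify_mat ` N0 \<subseteq> g_bigraded Q W F (-1) (-1)"
    using main(3) by (auto simp: assms(9) g_bigraded_iff)
  moreover have "closure (nilpotent_cone m Ns) \<subseteq> closure N0"
    unfolding assms(9) by (rule closure_mono[OF main(1)])
  ultimately show ?thesis using main(1,2) by (auto simp: assms(9))
qed

end
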